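(* Let $M/L/K$ be a tower as described, with $[L:K]=n$, $[M:L]=m$, $\nu=v_p(n)$, $\mu=v_p(m)$. Let $0\le l\le\nu+\mu$ and $x\in[0,\infty)$. Then (a) $\phi_{M/K}^l(x)\ge\lambda_{M/K}^l(x)$; (b) if there exists $l_0\le l$ such that $|S_l^{l_0}(x)|=1$, then $\phi_{M/K}^l(x)=\lambda_{M/K}^l(x)$.
   Context: Let $p$ be a prime and $K$ a field complete with respect to a discrete valuation whose residue field is perfect of characteristic $p$; fix a separable closure $K^{sep}$; $v_p$ is the $p$-adic valuation on $\mathbb{Z}$. $L/K$ is a finite totally ramified subextension of $K^{sep}/K$ of degree $n>1$ and $M/L$ is a finite totally ramified subextension of $K^{sep}/L$ of degree $m>1$; so $M/K$ is totally ramified of degree $nm$ with $v_p(nm)=\nu+\mu$. For any such totally ramified extension $E/F$ of degree $N>1$ with $\eta=v_p(N)$, the indices of inseparability $i_0,\dots,i_\eta$ are defined by: choose uniformizers $\pi_F,\pi_E$, let $\hat{\mathcal{F}}(X)=\sum_{h\ge0}a_hX^{h+N}$ be the unique series with coefficients in the Teichmüller representatives of the residue field such that $\hat{\mathcal{F}}(\pi_E)=\pi_F$, put $\tilde{\imath}_j=\min\{h\ge0:v_p(h+N)\le j,\ a_h\ne0\}$ (or $\infty$), $i_\eta=0$ and $i_j=\min\{\tilde{\imath}_j,i_{j+1}+v_E(p)\}$ for $j=\eta-1,\dots,0$ ($v_E$ normalized with $v_E(E^\times)=\mathbb{Z}$, $v_E(p)=\infty$ in characteristic $p$); they are independent of choices.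 Set $\tilde{\phi}_{E/F}^j(x)=i_j+p^jx$ and $\phi_{E/F}^j(x)=\min\{\tilde{\phi}_{E/F}^{j_0}(x):0\le j_0\le j\}$ for $x\ge0$. Let $i_0,\dots,i_\nu$ be the indices of $L/K$. For $0\le j\le\nu$ define $\tilde{\phi}_{L/K}^{j,m}(x)=m\tilde{\phi}_{L/K}^j(x/m)=mi_j+p^jx$ and $\phi_{L/K}^{j,m}(x)=m\phi_{L/K}^j(x/m)$. For $0\le l\le\nu+\mu$ let $\Omega_l=\{(j,k):0\le j\le\nu,\ 0\le k\le\mu,\ j+k=l\}$ and define $\lambda_{M/K}^l(x)=\min\{\phi_{L/K}^{j,m}(\phi_{M/L}^k(x)):(j,k)\in\Omega_l\}$ (equivalently, the minimum of $\tilde{\phi}_{L/K}^{j,m}(\tilde{\phi}_{M/L}^k(x))$ over $(j,k)\in\Omega_{l_0}$, $0\le l_0\le l$). For $0\le a\le l$ set $S_l^a(x)=\{(j,k)\in\Omega_a:\tilde{\phi}_{L/K}^{j,m}(\tilde{\phi}_{M/L}^k(x))=\lambda_{M/K}^l(x)\}$. *)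

theory Defs
  imports "HOL-Computational_Algebra.Computational_Algebra" "HOL-Library.Extended_Nat"
begin

definition subfield :: "'a::field set \<Rightarrow> bool" where
  "subfield E \<longleftrightarrow> 0 \<in> E \<and> 1 \<in> E \<and>
     (\<forall>x\<in>E. \<forall>y\<in>E. x + y \<in> E \<and> x - y \<in> E \<and> x * y \<in> E) \<and>
     (\<forall>x\<in>E. x \<noteq> 0 \<longrightarrow> inverse x \<in> E)"

text \<open>A normalized discrete valuation on E (values on nonzero elements; v 0 = infinity
  by convention, the value of v at 0 is never used).\<close>
definition discrete_valuation :: "'a::field set \<Rightarrow> ('a \<Rightarrow> int) \<Rightarrow> bool" where
  "discrete_valuation E v \<longleftrightarrow>
     (\<forall>x\<in>E. \<forall>y\<in>E. x \<noteq> 0 \<longrightarrow> y \<noteq> 0 \<longrightarrow> v (x * y) = v x + v y) \<and>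
     (\<forall>x\<in>E. \<forall>y\<in>E. x \<noteq> 0 \<longrightarrow> y \<noteq> 0 \<longrightarrow> x + y \<noteq> 0 \<longrightarrow> v (x + y) \<ge> min (v x) (v y)) \<and>
     (\<exists>\<pi>\<in>E. \<pi> \<noteq> 0 \<and> v \<pi> = 1)"

definition val_ring :: "'a::field set \<Rightarrow> ('a \<Rightarrow> int) \<Rightarrow> 'a set" where
  "val_ring E v = {x \<in> E. x = 0 \<or> v x \<ge> 0}"

definition val_converges :: "('a::field \<Rightarrow> int) \<Rightarrow> (nat \<Rightarrow> 'a) \<Rightarrow> 'a \<Rightarrow> bool" where
  "val_converges v s x \<longleftrightarrow> (\<forall>C::int. \<exists>N. \<forall>k\<ge>N. s k = x \<or> v (s k - x) \<ge> C)"

definition val_cauchy :: "('a::field \<Rightarrow> int) \<Rightarrow> (nat \<Rightarrow> 'a) \<Rightarrow> bool" where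
  "val_cauchy v s \<longleftrightarrow> (\<forall>C::int. \<exists>N. \<forall>k\<ge>N. \<forall>l\<ge>N. s k = s l \<or> v (s k - s l) \<ge> C)"

definition val_complete :: "'a::field set \<Rightarrow> ('a \<Rightarrow> int) \<Rightarrow> bool" where
  "val_complete E v \<longleftrightarrow>
     (\<forall>s. (\<forall>k. s k \<in> E) \<longrightarrow> val_cauchy v s \<longrightarrow> (\<exists>x\<in>E. val_converges v s x))"

definition residue_char :: "'a::field set \<Rightarrow> ('a \<Rightarrow> int) \<Rightarrow> nat \<Rightarrow> bool" where
  "residue_char E v p \<longleftrightarrow> prime p \<and> (of_nat p = (0::'a) \<or> v (of_nat p) > 0)"

definition residue_perfect :: "'a::field set \<Rightarrow> ('a \<Rightarrow> int) \<Rightarrow> nat \<Rightarrow> bool" where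
  "residue_perfect E v p \<longleftrightarrow>
     (\<forall>a\<in>val_ring E v. \<exists>b\<in>val_ring E v. a - b ^ p = 0 \<or> v (a - b ^ p) > 0)"

definition has_degree :: "'a::field set \<Rightarrow> 'a set \<Rightarrow> nat \<Rightarrow> bool" where
  "has_degree F E n \<longleftrightarrow> (\<exists>b. (\<forall>i<n. b i \<in> E) \<and>
     (\<forall>x\<in>E. \<exists>!c. (\<forall>i<n. c i \<in> F) \<and> (\<forall>i. n \<le> i \<longrightarrow> c i = 0) \<and> x = (\<Sum>i<n. c i * b i)))"

definition separable_ext :: "'a::field set \<Rightarrow> 'a set \<Rightarrow> bool" where
  "separable_ext F E \<longleftrightarrow> (\<forall>a\<in>E. \<exists>f :: 'a poly. f \<noteq> 0 \<and> (\<forall>i. coeff f i \<in> F) \<and>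
      poly f a = 0 \<and> coprime f (pderiv f))"

text \<open>Teichmueller (multiplicative) representatives of the residue field of F, characterized
  as in Serre, Local Fields II.4 Prop. 8: the elements of O_F that are p^k-th powers for all k.\<close>
definition teichmueller :: "'a::field set \<Rightarrow> ('a \<Rightarrow> int) \<Rightarrow> nat \<Rightarrow> 'a set" where
  "teichmueller F v p = {t \<in> val_ring F v. \<forall>k. \<exists>s\<in>val_ring F v. s ^ (p ^ k) = t}"

primrec ind_aux :: "(nat \<Rightarrow> enat) \<Rightarrow> enat \<Rightarrow> nat \<Rightarrow> nat \<Rightarrow> enat" where
  "ind_aux ti e eta 0 = 0"
| "ind_aux ti e eta (Suc d) = min (ti (eta - Suc d)) (ind_aux ti e eta d + e)"

definition tilde_ind :: "nat \<Rightarrow> nat \<Rightarrow> (nat \<Rightarrow> 'a::field) \<Rightarrow> nat \<Rightarrow> enat" where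
  "tilde_ind p N a j = (if \<exists>h. multiplicity p (h + N) \<le> j \<and> a h \<noteq> 0
      then enat (LEAST h. multiplicity p (h + N) \<le> j \<and> a h \<noteq> 0) else \<infinity>)"

definition val_of_p :: "('a::field \<Rightarrow> int) \<Rightarrow> nat \<Rightarrow> enat" where
  "val_of_p v p = (if of_nat p = (0::'a) then \<infinity> else enat (nat (v (of_nat p))))"

text \<open>is_indices p F E vF vE N i: the indices of inseparability i_0,...,i_eta
  (eta = v_p(N)) of the totally ramified extension E/F of degree N are i 0, ..., i eta.
  (They are finite for separable extensions; only values at j \<le> eta matter.)\<close>
definition is_indices :: "nat \<Rightarrow> 'a::field set \<Rightarrow> 'a set \<Rightarrow> ('a \<Rightarrow> int) \<Rightarrow> ('a \<Rightarrow> int) \<Rightarrow> nat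
    \<Rightarrow> (nat \<Rightarrow> nat) \<Rightarrow> bool" where
  "is_indices p F E vF vE N i \<longleftrightarrow>
    (\<exists>\<pi>F \<pi>E a. \<pi>F \<in> F \<and> \<pi>F \<noteq> 0 \<and> vF \<pi>F = 1 \<and> \<pi>E \<in> E \<and> \<pi>E \<noteq> 0 \<and> vE \<pi>E = 1 \<and>
       (\<forall>h. a h \<in> teichmueller F vF p) \<and>
       val_converges vE (\<lambda>k. \<Sum>h<k. a h * \<pi>E ^ (h + N)) \<pi>F \<and>
       (\<forall>j\<le>multiplicity p N.
          enat (i j) = ind_aux (tilde_ind p N a) (val_of_p vE p) (multiplicity p N)
                          (multiplicity p N - j)))"

definition phit :: "nat \<Rightarrow> (nat \<Rightarrow> nat) \<Rightarrow> nat \<Rightarrow> real \<Rightarrow> real" where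
  "phit p i j x = real (i j) + real p ^ j * x"

definition phi :: "nat \<Rightarrow> (nat \<Rightarrow> nat) \<Rightarrow> nat \<Rightarrow> real \<Rightarrow> real" where
  "phi p i j x = Min ((\<lambda>j0. phit p i j0 x) ` {..j})"

definition phitm :: "nat \<Rightarrow> (nat \<Rightarrow> nat) \<Rightarrow> nat \<Rightarrow> nat \<Rightarrow> real \<Rightarrow> real" where
  "phitm p i m j x = real m * phit p i j (x / real m)"

definition phim :: "nat \<Rightarrow> (nat \<Rightarrow> nat) \<Rightarrow> nat \<Rightarrow> nat \<Rightarrow> real \<Rightarrow> real" where
  "phim p i m j x = real m * phi p i j (x / real m)"

definition Omega :: "nat \<Rightarrow> nat \<Rightarrow> nat \<Rightarrow> (nat \<times> nat) set" where
  "Omega nu mu l = {(j, k). j \<le> nu \<and> k \<le> mu \<and> j + k = l}"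

definition lambdaMK :: "nat \<Rightarrow> (nat \<Rightarrow> nat) \<Rightarrow> (nat \<Rightarrow> nat) \<Rightarrow> nat \<Rightarrow> nat \<Rightarrow> nat \<Rightarrow> nat
    \<Rightarrow> real \<Rightarrow> real" where
  "lambdaMK p iLK iML m nu mu l x =
     Min ((\<lambda>(j, k). phim p iLK m j (phi p iML k x)) ` Omega nu mu l)"

definition S_set :: "nat \<Rightarrow> (nat \<Rightarrow> nat) \<Rightarrow> (nat \<Rightarrow> nat) \<Rightarrow> nat \<Rightarrow> nat \<Rightarrow> nat \<Rightarrow> nat \<Rightarrow> nat
    \<Rightarrow> real \<Rightarrow> (nat \<times> nat) set" where
  "S_set p iLK iML m nu mu l a x =
     {(j, k) \<in> Omega nu mu a. phitm p iLK m j (phit p iML k x) = lambdaMK p iLK iML m nu mu l x}"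

end

theory Submission
  imports Defs "HOL-Algebra.Exponent"
begin

text \<open>
  Give \<open>p^b z^(p^a)\<close> the weight \<open>p^a v(z) + b v(p)\<close>, and for a sequence c with
  \<open>c (j + 1) \<le> c j \<le> c (j + 1) + v(p)\<close> consider the additive group generated by the elements
  \<open>p^b z^(p^a)\<close> of weight at least \<open>r + c a\<close>. No uniformizer enters this definition. If p itself is a
  sum of pure powers \<open>z^(p^a)\<close> of weight at least \<open>v(p) + c a\<close>, up to higher weight, then every nonzero
  element of the group has a valuation s with \<open>p^a\<close> dividing s and \<open>s \<ge> r + c a\<close> for some a. Hence the
  indices of inseparability of E/F are the largest c such that a uniformizer of F lies in the group for
  r = [E:F], whatever uniformizers and digits they were computed from.

  In a tower, inserting the expansion of a uniformizer of L into that of a uniformizer of K shows that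
  the latter lies in the group of the sequence \<open>min {m i_j + p^j i_k : j + k \<le> l}\<close>; this is (a). If the
  minimum at l is attained by a single pair (j, k), the part of the expansion that belongs to this pair
  has an exact valuation which is not divisible by \<open>p^(l + 1)\<close>, while everything else lies in the group
  of a larger sequence; so the l-th index cannot be larger than the minimum, which is (b). When the
  minimum is also reached by lowering one step further at the cost of v(p), one descends from l to l + 1.
\<close>

section \<open>Discretely valued subfields\<close>

text \<open>The three index sequences come from unrelated choices: the uniformizer of L used for L/K
  need not be the one expanded for M/L. Digits along the tower cannot be compared directly, so
  independence of choices is built into the groups.

  The price is that the weight of \<open>p^b z^(p^a)\<close> need not be divisible by
  \<open>p^a\<close>. Since p lies in the base field, expanding it in a uniformizer of F gives pure
  powers, and with these the factors p are removed up to higher weight.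

  For (b) one argues by contradiction: were the index larger than the minimum, the uniformizer of K
  would lie in the group of a raised sequence. The raised sequence drops by at most v(p) at l unless
  the minimum at l is that at l + 1 plus v(p); this is where the final case distinction comes from.

  In characteristic p, where v(p) is infinite, a finite weight above all indices takes its place, so
  one argument serves both characteristics.\<close>

definition val_ge :: "('a::field \<Rightarrow> int) \<Rightarrow> int \<Rightarrow> 'a \<Rightarrow> bool" where
  "val_ge v w x \<longleftrightarrow> x = 0 \<or> w \<le> v x"

lemma val_ge_zero [simp]: "val_ge v w 0"
  by (simp add: val_ge_def)

lemma val_ge_mono: "val_ge v w x \<Longrightarrow> w' \<le> w \<Longrightarrow> val_ge v w' x"
  by (auto simp: val_ge_def)

locale valued_field =
  fixes E :: "'a::field set" and v :: "'a \<Rightarrow> int"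
  assumes subfield: "subfield E" and valuation: "discrete_valuation E v"
begin

lemma zero_mem [simp]: "0 \<in> E" and one_mem [simp]: "1 \<in> E"
  using subfield by (auto simp: subfield_def)

lemma add_mem: "x \<in> E \<Longrightarrow> y \<in> E \<Longrightarrow> x + y \<in> E"
  and diff_mem: "x \<in> E \<Longrightarrow> y \<in> E \<Longrightarrow> x - y \<in> E"
  and mult_mem: "x \<in> E \<Longrightarrow> y \<in> E \<Longrightarrow> x * y \<in> E"
  using subfield by (simp_all add: subfield_def)

lemma inverse_mem: "x \<in> E \<Longrightarrow> inverse x \<in> E"
  using subfield by (cases "x = 0") (simp_all add: subfield_def)

lemma uminus_mem: "x \<in> E \<Longrightarrow> - x \<in> E"
  using diff_mem[of 0 x] by simp

lemma power_mem: "x \<in> E \<Longrightarrow> x ^ k \<in> E"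
  by (induction k) (auto intro: mult_mem)

lemma of_nat_mem [simp]: "of_nat k \<in> E"
  by (induction k) (auto intro: add_mem)

lemma sum_mem: "(\<And>i. i \<in> A \<Longrightarrow> f i \<in> E) \<Longrightarrow> sum f A \<in> E"
  by (induction A rule: infinite_finite_induct) (auto intro: add_mem)

lemmas mem = add_mem diff_mem mult_mem inverse_mem uminus_mem power_mem sum_mem

lemma val_mult: "x \<in> E \<Longrightarrow> y \<in> E \<Longrightarrow> x \<noteq> 0 \<Longrightarrow> y \<noteq> 0 \<Longrightarrow> v (x * y) = v x + v y"
  using valuation by (auto simp: discrete_valuation_def)

lemma val_one [simp]: "v 1 = 0"
  using val_mult[of 1 1] by simp

lemma val_power: "x \<in> E \<Longrightarrow> x \<noteq> 0 \<Longrightarrow> v (x ^ k) = int k * v x"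
  by (induction k) (auto simp: val_mult power_mem algebra_simps)

lemma val_uminus_one [simp]: "v (- 1) = 0"
proof -
  have "v ((- 1) * (- 1)) = v (- 1) + v (- 1)"
    by (rule val_mult) (auto intro: uminus_mem)
  then show ?thesis by simp
qed

lemma val_uminus: "x \<in> E \<Longrightarrow> v (- x) = v x"
  using val_mult[of "- 1" x] uminus_mem[of 1] by (cases "x = 0") auto

lemma val_inverse: "x \<in> E \<Longrightarrow> x \<noteq> 0 \<Longrightarrow> v (inverse x) = - v x"
  using val_mult[of x "inverse x"] inverse_mem[of x] by auto

lemma val_ge_add:
  assumes "x \<in> E" "y \<in> E" "val_ge v w x" "val_ge v w y"
  shows "val_ge v w (x + y)"
proof (cases "x = 0 \<or> y = 0 \<or> x + y = 0")
  case False
  then have "min (v x) (v y) \<le> v (x + y)"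
    using valuation assms(1,2) by (simp add: discrete_valuation_def)
  then show ?thesis using assms(3,4) False by (auto simp: val_ge_def)
qed (use assms(3,4) in auto)

lemma val_ge_uminus: "x \<in> E \<Longrightarrow> val_ge v w (- x) \<longleftrightarrow> val_ge v w x"
  by (auto simp: val_ge_def val_uminus)

lemma val_ge_diff: "x \<in> E \<Longrightarrow> y \<in> E \<Longrightarrow> val_ge v w x \<Longrightarrow> val_ge v w y \<Longrightarrow> val_ge v w (x - y)"
  using val_ge_add[of x "- y" w] by (auto simp: val_ge_uminus intro: uminus_mem)

lemma val_ge_mult:
  "x \<in> E \<Longrightarrow> y \<in> E \<Longrightarrow> val_ge v w x \<Longrightarrow> val_ge v w' y \<Longrightarrow> val_ge v (w + w') (x * y)"
  by (cases "x = 0 \<or> y = 0") (auto simp: val_ge_def val_mult)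

lemma val_ge_power: "x \<in> E \<Longrightarrow> val_ge v w x \<Longrightarrow> val_ge v (int k * w) (x ^ k)"
  by (cases "x = 0") (auto simp: val_ge_def val_power power_0_left mult_left_mono)

lemma val_ge_sum:
  "(\<And>i. i \<in> A \<Longrightarrow> f i \<in> E) \<Longrightarrow> (\<And>i. i \<in> A \<Longrightarrow> val_ge v w (f i)) \<Longrightarrow> val_ge v w (sum f A)"
  by (induction A rule: infinite_finite_induct) (auto intro: val_ge_add sum_mem)

lemma val_ge_of_nat: "val_ge v 0 (of_nat k)"
  by (induction k) (auto intro!: val_ge_add simp: val_ge_def[of v 0 1])

lemma val_add_dominant:
  assumes "x \<in> E" "y \<in> E" "x \<noteq> 0" "val_ge v (v x + 1) y"
  shows "x + y \<noteq> 0" "v (x + y) = v x"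
proof -
  have le: "val_ge v (v x) (x + y)"
    using assms by (intro val_ge_add) (auto simp: val_ge_def)
  have "\<not> val_ge v (v x + 1) (x + y)"
  proof
    assume "val_ge v (v x + 1) (x + y)"
    then have "val_ge v (v x + 1) (x + y - y)"
      using assms by (intro val_ge_diff) (auto intro: add_mem)
    then show False using assms(3) by (simp add: val_ge_def)
  qed
  then show "x + y \<noteq> 0" "v (x + y) = v x"
    using le by (auto simp: val_ge_def)
qed

lemma uniformizer: obtains \<pi> where "\<pi> \<in> E" "\<pi> \<noteq> 0" "v \<pi> = 1"
  using valuation by (auto simp: discrete_valuation_def)

lemma group_closure_mem:
  assumes "S \<subseteq> E" "x \<in> group_closure S"
  shows "x \<in> E"
  using assms(2) by (induction rule: group_closure.induct) (use assms(1) in \<open>auto intro: diff_mem\<close>)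

lemma group_closure_val_ge:
  assumes "S \<subseteq> E" "\<And>g. g \<in> S \<Longrightarrow> val_ge v w g" "x \<in> group_closure S"
  shows "val_ge v w x"
  using assms(3)
proof (induction rule: group_closure.induct)
  case (diff s t)
  then show ?case using group_closure_mem[OF assms(1)] by (intro val_ge_diff) auto
qed (use assms(2) in auto)

lemma exists_val: obtains x where "x \<in> E" "x \<noteq> 0" "v x = k"
proof -
  obtain \<pi> where \<pi>: "\<pi> \<in> E" "\<pi> \<noteq> 0" "v \<pi> = 1" by (rule uniformizer)
  show thesis
  proof (cases "0 \<le> k")
    case True
    then show thesis using \<pi> by (intro that[of "\<pi> ^ nat k"]) (auto simp: val_power power_mem)
  next
    case False
    then show thesis using \<pi>
      by (intro that[of "inverse \<pi> ^ nat (- k)"])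
        (auto simp: val_power power_mem inverse_mem val_inverse)
  qed
qed

lemma val_ge_power_diff:
  assumes "x \<in> E" "y \<in> E" "val_ge v 0 x" "val_ge v 0 y" "val_ge v w (x - y)"
  shows "val_ge v w (x ^ k - y ^ k)"
proof (induction k)
  case (Suc k)
  have "val_ge v (0 + w) (x * (x ^ k - y ^ k))"
    using assms Suc by (intro val_ge_mult) (auto intro: mem)
  moreover have "val_ge v (w + int k * 0) ((x - y) * y ^ k)"
    using assms by (intro val_ge_mult val_ge_power) (auto intro: mem)
  ultimately have "val_ge v w (x * (x ^ k - y ^ k) + (x - y) * y ^ k)"
    using assms by (intro val_ge_add) (auto intro!: mem)
  then show ?case by (simp add: algebra_simps)
qed simp

text \<open>Convergence speaks of late partial sums only. The terms between index k and a late l all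
  have valuation at least N + k, so the bound holds at every k.\<close>

lemma val_ge_partial_sum:
  assumes "\<And>h. a h \<in> E" "\<And>h. val_ge v 0 (a h)" "\<pi> \<in> E" "\<pi> \<noteq> 0" "v \<pi> = 1" "z \<in> E"
    and conv: "val_converges v (\<lambda>k. \<Sum>h<k. a h * \<pi> ^ (h + N)) z"
  shows "val_ge v (int N + int k) (z - (\<Sum>h<k. a h * \<pi> ^ (h + N)))"
proof -
  let ?f = "\<lambda>h. a h * \<pi> ^ (h + N)"
  obtain K where K: "\<And>l. l \<ge> K \<Longrightarrow> (\<Sum>h<l. ?f h) = z \<or> v ((\<Sum>h<l. ?f h) - z) \<ge> int N + int k"
    using conv unfolding val_converges_def by blast
  define l where "l = max k K"
  have f: "?f h \<in> E" for h using assms by (auto intro!: mem)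
  have fv: "val_ge v (int N + int h) (?f h)" for h
    using val_ge_mult[of "a h" "\<pi> ^ (h + N)" 0 "int (h + N)"] assms
    by (auto simp: mem val_ge_def[of v _ "\<pi> ^ _"] val_power add.commute)
  have v1: "val_ge v (int N + int k) ((\<Sum>h<l. ?f h) - z)"
    using K[of l] by (auto simp: val_ge_def l_def)
  have v2: "val_ge v (int N + int k) (\<Sum>h\<in>{k..<l}. ?f h)"
    using f by (intro val_ge_sum) (auto intro: val_ge_mono[OF fv])
  have "val_ge v (int N + int k) ((\<Sum>h\<in>{k..<l}. ?f h) - ((\<Sum>h<l. ?f h) - z))"
    by (rule val_ge_diff[OF _ _ v2 v1]) (use f assms(6) in \<open>auto intro!: sum_mem diff_mem\<close>)
  moreover have "(\<Sum>h<l. ?f h) = (\<Sum>h<k. ?f h) + (\<Sum>h\<in>{k..<l}. ?f h)"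
    using sum.union_disjoint[of "{..<k}" "{k..<l}" ?f] by (simp add: ivl_disj_un ivl_disj_int l_def)
  ultimately show ?thesis by (simp add: algebra_simps)
qed

text \<open>The summand of least valuation dominates, so nothing cancels it. In
  \<open>residue_field_eq\<close> this excludes linear relations between powers of a
  uniformizer.\<close>

lemma sum_distinct_val:
  assumes "finite A" "\<And>i. i \<in> A \<Longrightarrow> f i \<in> E"
    and dist: "\<And>i j. i \<in> A \<Longrightarrow> j \<in> A \<Longrightarrow> i \<noteq> j \<Longrightarrow> f i \<noteq> 0 \<Longrightarrow> f j \<noteq> 0 \<Longrightarrow> v (f i) \<noteq> v (f j)"
    and "sum f A = 0" "i \<in> A"
  shows "f i = 0"
proof (rule ccontr)
  assume "f i \<noteq> 0"
  define B where "B = {i \<in> A. f i \<noteq> 0}"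
  have B: "finite B" "B \<noteq> {}" using assms(1,5) \<open>f i \<noteq> 0\<close> by (auto simp: B_def)
  define j where "j = arg_min_on (\<lambda>i. v (f i)) B"
  have j: "j \<in> B" "\<And>i. i \<in> B \<Longrightarrow> v (f j) \<le> v (f i)"
    unfolding j_def using B by (auto intro: arg_min_if_finite arg_min_least)
  have "val_ge v (v (f j) + 1) (f i)" if "i \<in> B - {j}" for i
    using that j(2)[of i] dist[of i j] j(1) by (fastforce simp: B_def val_ge_def)
  then have "val_ge v (v (f j) + 1) (sum f (B - {j}))"
    using assms(2) by (intro val_ge_sum) (auto simp: B_def)
  then have "f j + sum f (B - {j}) \<noteq> 0"
    using val_add_dominant(1)[of "f j" "sum f (B - {j})"] j(1) assms(2) by (auto simp: B_def intro: mem)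
  moreover have "sum f A = sum f B"
    unfolding B_def using assms(1) by (intro sum.mono_neutral_right) auto
  ultimately show False using assms(4) sum.remove[OF B(1) j(1), of f] by simp
qed

end

section \<open>Additive groups generated by a set, and prime powers of their elements\<close>

lemma group_closure_subset:
  fixes S T :: "'a::ab_group_add set"
  assumes "\<And>g. g \<in> S \<Longrightarrow> g \<in> group_closure T" "x \<in> group_closure S"
  shows "x \<in> group_closure T"
  using assms(2) by (induction rule: group_closure.induct) (auto intro: group_closure.diff assms(1))

lemma group_closure_mult:
  fixes S T U :: "'a::comm_ring_1 set"
  assumes ST: "\<And>g h. g \<in> S \<Longrightarrow> h \<in> T \<Longrightarrow> g * h \<in> group_closure U"
    and x: "x \<in> group_closure S" and y: "y \<in> group_closure T"
  shows "x * y \<in> group_closure U"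
  using x
proof (induction rule: group_closure.induct)
  case (base s)
  show ?case
    using y
  proof (induction rule: group_closure.induct)
    case (base t)
    then show ?case using \<open>s \<in> insert 0 S\<close> ST by auto
  qed (auto simp: right_diff_distrib intro: group_closure.diff)
qed (auto simp: left_diff_distrib intro: group_closure.diff)

lemma group_closure_sum_mem:
  fixes f :: "'b \<Rightarrow> 'a::ab_group_add"
  shows "(\<And>i. i \<in> A \<Longrightarrow> f i \<in> group_closure S) \<Longrightarrow> sum f A \<in> group_closure S"
  by (induction A rule: infinite_finite_induct) (auto intro: group_closure_add)

lemma group_closure_baseI: "x \<in> S \<Longrightarrow> x \<in> group_closure S"
  by (simp add: group_closure.base)

text \<open>From \<open>i * (N choose i) = N * (N - 1 choose (i - 1))\<close>: of the a factors p of
  N, at most b can be absorbed by i.\<close>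

lemma power_dvd_choose:
  fixes p :: nat
  assumes p: "prime p" and N: "p ^ a dvd N" and i: "\<not> p ^ Suc b dvd i" and "b \<le> a"
  shows "p ^ (a - b) dvd (N choose i)"
proof (cases "i = 0 \<or> N = 0")
  case False
  then have "i * (N choose i) = N * (N - 1 choose (i - 1))"
    by (intro times_binomial_minus1_eq) simp
  then have "p ^ ((a - b) + b) dvd i * (N choose i)"
    using N \<open>b \<le> a\<close> by simp
  with prime_imp_prime_elem[OF p] i show ?thesis
    by (rule div_combine)
next
  case True
  then show ?thesis using i by (cases "i = 0") (auto simp: binomial_eq_0)
qed

text \<open>For a family G graded under multiplication, each p-th power of a sum costs only cross
  terms, which carry a factor p and p times the degree. Iterating this gives the mixture of factors
  p and p-powers on the right. It is the means of raising the expansion of a uniformizer of L to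
  powers inside M.\<close>

lemma group_closure_prime_power:
  fixes G :: "nat \<Rightarrow> 'a::comm_ring_1 set"
  assumes p: "prime p" and G: "\<And>k l g h. g \<in> G k \<Longrightarrow> h \<in> G l \<Longrightarrow> g * h \<in> G (k + l)"
    and y: "y \<in> group_closure (G r)"
  shows "y ^ (p ^ a) \<in> group_closure {of_nat p ^ (a - \<alpha>) * g ^ (p ^ \<alpha>) | \<alpha> g. \<alpha> \<le> a \<and> g \<in> G (p ^ (a - \<alpha>) * r)}"
proof -
  define Y where "Y a r = group_closure {of_nat p ^ (a - \<alpha>) * g ^ (p ^ \<alpha>) | \<alpha> g. \<alpha> \<le> a \<and> g \<in> G (p ^ (a - \<alpha>) * r)}" for a r
  have p0: "0 < p" using p by (simp add: prime_gt_0_nat)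
  have Gpow: "g ^ k \<in> G (k * r)" if "g \<in> G r" "0 < k" for g k r
    using that(2)
  proof (induction k rule: nat_induct_non_zero)
    case (Suc n)
    then show ?case using G[OF that(1) Suc.IH] by simp
  qed (use that in simp)
  \<comment> \<open>The larger exponent is lowered to the smaller one by absorbing the difference in
    the base; the surplus factors p remain as an integer multiple.\<close>
  have genle: "(of_nat p ^ (a - \<alpha>) * g ^ (p ^ \<alpha>)) * (of_nat p ^ (a - \<beta>) * h ^ (p ^ \<beta>)) \<in> Y a (r + s)"
    if "\<alpha> \<le> \<beta>" "\<beta> \<le> a" "g \<in> G (p ^ (a - \<alpha>) * r)" "h \<in> G (p ^ (a - \<beta>) * s)" for a r s \<alpha> \<beta> g h
  proof -
    have h: "h ^ (p ^ \<beta>) = (h ^ (p ^ (\<beta> - \<alpha>))) ^ (p ^ \<alpha>)"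
      using that(1) by (simp flip: power_mult power_add)
    have "h ^ (p ^ (\<beta> - \<alpha>)) \<in> G (p ^ (\<beta> - \<alpha>) * (p ^ (a - \<beta>) * s))"
      using that(4) p0 by (intro Gpow) auto
    also have "p ^ (\<beta> - \<alpha>) * (p ^ (a - \<beta>) * s) = p ^ (a - \<alpha>) * s"
      using that by (simp flip: power_add mult.assoc)
    finally have "g * h ^ (p ^ (\<beta> - \<alpha>)) \<in> G (p ^ (a - \<alpha>) * (r + s))"
      unfolding distrib_left by (rule G[OF that(3)])
    then have "of_nat p ^ (a - \<alpha>) * (g * h ^ (p ^ (\<beta> - \<alpha>))) ^ (p ^ \<alpha>) \<in> Y a (r + s)"
      unfolding Y_def using that by (intro group_closure_baseI CollectI exI conjI) (rule refl, auto)
    then have "of_nat (p ^ (a - \<beta>)) * (of_nat p ^ (a - \<alpha>) * (g * h ^ (p ^ (\<beta> - \<alpha>))) ^ (p ^ \<alpha>)) \<in> Y a (r + s)"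
      unfolding Y_def by (rule group_closure_scalar_mult_left)
    then show ?thesis by (simp add: h power_mult_distrib mult_ac)
  qed
  have Ymult: "x * y \<in> Y a (r + s)" if "x \<in> Y a r" "y \<in> Y a s" for a r s x y
    unfolding Y_def
  proof (rule group_closure_mult[OF _ that[unfolded Y_def]], fold Y_def)
    fix g h
    assume g: "g \<in> {of_nat p ^ (a - \<alpha>) * g ^ (p ^ \<alpha>) | \<alpha> g. \<alpha> \<le> a \<and> g \<in> G (p ^ (a - \<alpha>) * r)}"
      and h: "h \<in> {of_nat p ^ (a - \<alpha>) * g ^ (p ^ \<alpha>) | \<alpha> g. \<alpha> \<le> a \<and> g \<in> G (p ^ (a - \<alpha>) * s)}"
    obtain \<alpha> g' where g': "g = of_nat p ^ (a - \<alpha>) * g' ^ (p ^ \<alpha>)" "\<alpha> \<le> a" "g' \<in> G (p ^ (a - \<alpha>) * r)"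
      using g by blast
    obtain \<beta> h' where h': "h = of_nat p ^ (a - \<beta>) * h' ^ (p ^ \<beta>)" "\<beta> \<le> a" "h' \<in> G (p ^ (a - \<beta>) * s)"
      using h by blast
    show "g * h \<in> Y a (r + s)"
    proof (cases "\<alpha> \<le> \<beta>")
      case True
      then show ?thesis using genle[OF True h'(2) g'(3) h'(3)] by (simp add: g' h')
    next
      case False
      then have "\<beta> \<le> \<alpha>" by simp
      then show ?thesis using genle[OF _ g'(2) h'(3) g'(3)] by (simp add: g' h' add.commute mult.commute)
    qed
  qed
  have Ypow: "x ^ k \<in> Y a (k * r)" if "x \<in> Y a r" "0 < k" for x a r k
    using that(2)
  proof (induction k rule: nat_induct_non_zero)
    case (Suc n)
    then show ?case using Ymult[OF that(1) Suc.IH] by simp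
  qed (use that in simp)
  have Yshift: "of_nat p * x \<in> Y (Suc a) r" if "x \<in> Y a (p * r)" for x a r
    using that unfolding Y_def
  proof (induction rule: group_closure.induct)
    case (base x)
    show ?case
    proof (cases "x = 0")
      case False
      then obtain \<alpha> g where g: "x = of_nat p ^ (a - \<alpha>) * g ^ (p ^ \<alpha>)" "\<alpha> \<le> a" "g \<in> G (p ^ (a - \<alpha>) * (p * r))"
        using base by blast
      then have "of_nat p * x = of_nat p ^ (Suc a - \<alpha>) * g ^ (p ^ \<alpha>)" "g \<in> G (p ^ (Suc a - \<alpha>) * r)"
        by (auto simp: Suc_diff_le mult_ac)
      then show ?thesis using g(2) by (intro group_closure_baseI CollectI exI conjI) auto
    qed simp
  qed (auto simp: right_diff_distrib intro: group_closure.diff)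
  \<comment> \<open>A generator stays a generator up to surplus factors p. For a difference, the
    middle binomial coefficients are divisible by p, and \<open>Yshift\<close> turns that p and a
    product of degree p * r into an element for \<open>Suc a\<close>.\<close>
  have step: "x ^ p \<in> Y (Suc a) r" if "x \<in> Y a r" for x a r
    using that unfolding Y_def[of a]
  proof (induction rule: group_closure.induct)
    case (base x)
    show ?case
    proof (cases "x = 0")
      case False
      then obtain \<alpha> g where g: "x = of_nat p ^ (a - \<alpha>) * g ^ (p ^ \<alpha>)" "\<alpha> \<le> a" "g \<in> G (p ^ (a - \<alpha>) * r)"
        using base by blast
      \<comment> \<open>The p-th power carries p * (a - \<alpha>) factors p, of which only a -
        \<alpha> are wanted; k counts the rest.\<close>
      define k where "k = p * (a - \<alpha>) - (a - \<alpha>)"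
      have "p * (a - \<alpha>) = k + (Suc a - Suc \<alpha>)" using p0 by (simp add: k_def)
      then have "x ^ p = of_nat (p ^ k) * (of_nat p ^ (Suc a - Suc \<alpha>) * g ^ (p ^ Suc \<alpha>))"
        by (simp add: g(1) power_mult_distrib mult.commute flip: power_mult power_add) (simp add: power_add mult_ac)
      moreover have "of_nat p ^ (Suc a - Suc \<alpha>) * g ^ (p ^ Suc \<alpha>) \<in> Y (Suc a) r"
        unfolding Y_def using g by (intro group_closure_baseI CollectI exI conjI) (rule refl, auto)
      ultimately show ?thesis
        unfolding Y_def by (metis (no_types, lifting) group_closure_scalar_mult_left)
    next
      case True
      then show ?thesis using p0 by (simp add: Y_def power_0_left)
    qed
  next
    case (diff s t)
    have st: "s \<in> Y a r" "- t \<in> Y a r" using diff by (simp_all add: Y_def)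
    let ?f = "\<lambda>i. of_nat (p choose i) * s ^ i * (- t) ^ (p - i)"
    have "{..p} = insert 0 (insert p {0<..<p})" by auto
    then have eq: "(s + - t) ^ p = (- t) ^ p + (s ^ p + (\<Sum>i\<in>{0<..<p}. ?f i))"
      using p0 by (subst binomial_ring) simp
    have f: "?f i \<in> Y (Suc a) r" if i: "i \<in> {0<..<p}" for i
    proof -
      have "p dvd (p choose i)" using power_dvd_choose[OF p, of 1 p 0 i] i nat_dvd_not_less[of i p] by auto
      then obtain q where q: "(p choose i) = p * q" by (elim dvdE)
      have "s ^ i * (- t) ^ (p - i) \<in> Y a (i * r + (p - i) * r)"
        using i st by (intro Ymult Ypow) auto
      also have "i * r + (p - i) * r = p * r" using i by (simp flip: add_mult_distrib)
      finally have "of_nat p * (s ^ i * (- t) ^ (p - i)) \<in> Y (Suc a) r" by (rule Yshift)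
      then have "of_nat q * (of_nat p * (s ^ i * (- t) ^ (p - i))) \<in> Y (Suc a) r"
        unfolding Y_def by (rule group_closure_scalar_mult_left)
      then show ?thesis by (simp add: q mult_ac)
    qed
    have "(- t) ^ p \<in> Y (Suc a) r"
      using diff.IH(2) by (cases "even p") (auto simp: Y_def)
    then show ?case
      unfolding diff_conv_add_uminus[of s t] eq
      using diff.IH(1) f unfolding Y_def by (intro group_closure_add group_closure_sum_mem) auto
  qed
  have "y ^ (p ^ a) \<in> Y a r"
  proof (induction a)
    case 0
    have "G r \<subseteq> {of_nat p ^ (0 - \<alpha>) * g ^ (p ^ \<alpha>) | \<alpha> g. \<alpha> \<le> 0 \<and> g \<in> G (p ^ (0 - \<alpha>) * r)}" by auto
    then show ?case using group_closure_subset[OF _ y] unfolding Y_def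
      by (metis (no_types, lifting) group_closure_baseI power_0 power_one_right subsetD)
  next
    case (Suc a)
    then show ?case using step[OF Suc] by (simp add: mult.commute flip: power_mult)
  qed
  then show ?thesis unfolding Y_def .
qed

lemma prime_power_dvd_iff:
  fixes p i :: nat
  shows "prime p \<Longrightarrow> 0 < i \<Longrightarrow> p ^ k dvd i \<longleftrightarrow> k \<le> multiplicity p i"
  by (intro power_dvd_iff_le_multiplicity) (auto simp: not_prime_unit)

section \<open>Weighted sums of p-powers\<close>

locale p_valued_field = valued_field E v for E :: "'a::field set" and v +
  fixes p e :: nat \<comment> \<open>if p = 0 in the field, then e is an arbitrary weight for p\<close>
  assumes prime_p: "prime p" and e_pos: "0 < e"
    and val_p: "of_nat p = (0::'a) \<or> v (of_nat p) = int e"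
    and perfect: "u \<in> E \<Longrightarrow> u \<noteq> 0 \<Longrightarrow> v u = 0 \<Longrightarrow> \<exists>s\<in>E. s \<noteq> 0 \<and> v s = 0 \<and> val_ge v 1 (u - s ^ p)"
begin

lemma p_pos [simp]: "0 < p" "p \<noteq> 0"
  using prime_p by (auto simp: prime_gt_0_nat)

definition weight :: "nat \<Rightarrow> nat \<Rightarrow> 'a \<Rightarrow> int" where
  "weight a b z = int p ^ a * v z + int b * int e"

definition profile :: "nat \<Rightarrow> (nat \<Rightarrow> int) \<Rightarrow> bool" where
  "profile \<eta> c \<longleftrightarrow> c \<eta> = 0 \<and> (\<forall>j<\<eta>. c (Suc j) \<le> c j \<and> c j \<le> c (Suc j) + int e)"

text \<open>The bound t restricts the generators with a factor p only. Taking t > r excludes the trivial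
  expression of p by itself, which would make the hypothesis of \<open>span_val\<close> below empty.\<close>

definition gens :: "nat \<Rightarrow> (nat \<Rightarrow> int) \<Rightarrow> int \<Rightarrow> int \<Rightarrow> int \<Rightarrow> 'a set" where
  "gens \<eta> c r w t = {of_nat p ^ b * z ^ (p ^ a) | a b z. a \<le> \<eta> \<and> z \<in> E \<and>
     (z = 0 \<or> r + c a \<le> weight a b z \<and> w \<le> weight a b z \<and> (b = 0 \<or> t \<le> weight a b z))}"

abbreviation span :: "nat \<Rightarrow> (nat \<Rightarrow> int) \<Rightarrow> int \<Rightarrow> int \<Rightarrow> int \<Rightarrow> 'a set" where
  "span \<eta> c r w t \<equiv> group_closure (gens \<eta> c r w t)"

lemma profile_antimono:
  assumes "profile \<eta> c" "a \<le> b" "b \<le> \<eta>"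
  shows "c b \<le> c a"
  using assms(2,3)
proof (induction b rule: dec_induct)
  case (step b)
  then have "c (Suc b) \<le> c b" using assms(1) by (simp add: profile_def)
  with step show ?case by simp
qed simp

lemma profile_le:
  assumes "profile \<eta> c" "a \<le> b" "b \<le> \<eta>"
  shows "c a \<le> c b + int (b - a) * int e"
  using assms(2,3)
proof (induction b rule: dec_induct)
  case (step b)
  then have "c a \<le> c b + int (b - a) * int e" "c b \<le> c (Suc b) + int e"
    using assms(1) by (auto simp: profile_def)
  moreover have "int (Suc b - a) * int e = int (b - a) * int e + int e"
    using step.hyps by (simp add: Suc_diff_le algebra_simps)
  ultimately show ?case by linarith
qed simp

lemma profile_nonneg: "profile \<eta> c \<Longrightarrow> a \<le> \<eta> \<Longrightarrow> 0 \<le> c a"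
  using profile_antimono[of \<eta> c a \<eta>] by (simp add: profile_def)

lemma val_ge_p_power: "val_ge v (int b * int e) (of_nat p ^ b)"
proof (cases "of_nat p = (0::'a)")
  case False
  then show ?thesis using val_p by (simp add: val_ge_def val_power)
qed (auto simp: power_0_left val_ge_def)

lemma val_ge_gen:
  assumes "z \<in> E" "z = 0 \<or> w \<le> weight a b z"
  shows "val_ge v w (of_nat p ^ b * z ^ (p ^ a))"
proof (cases "z = 0")
  case False
  then have "val_ge v (int b * int e + int (p ^ a) * v z) (of_nat p ^ b * z ^ (p ^ a))"
    using assms by (intro val_ge_mult val_ge_p_power val_ge_power) (auto intro: power_mem simp: val_ge_def)
  then show ?thesis
    by (rule val_ge_mono) (use assms False in \<open>simp add: weight_def\<close>)
qed (simp add: power_0_left)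

lemma gens_mem: "gens \<eta> c r w t \<subseteq> E"
  by (auto simp: gens_def intro!: mult_mem power_mem)

lemma span_mem: "x \<in> span \<eta> c r w t \<Longrightarrow> x \<in> E"
  using group_closure_mem[OF gens_mem] .

lemma span_val_ge: "x \<in> span \<eta> c r w t \<Longrightarrow> val_ge v w x"
  by (rule group_closure_val_ge[OF gens_mem]) (auto simp: gens_def intro!: val_ge_gen)

lemma gens_mono:
  assumes "g \<in> gens \<eta> c r w t" "r' \<le> r" "w' \<le> w" "t' \<le> t" "\<And>a. a \<le> \<eta> \<Longrightarrow> c' a \<le> c a"
  shows "g \<in> gens \<eta> c' r' w' t'"
proof -
  obtain a b z where abz: "g = of_nat p ^ b * z ^ (p ^ a)" "a \<le> \<eta>" "z \<in> E"
      "z = 0 \<or> r + c a \<le> weight a b z \<and> w \<le> weight a b z \<and> (b = 0 \<or> t \<le> weight a b z)"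
    using assms(1) by (auto simp: gens_def)
  have "z = 0 \<or> r' + c' a \<le> weight a b z \<and> w' \<le> weight a b z \<and> (b = 0 \<or> t' \<le> weight a b z)"
    using abz(4) assms(2-4) assms(5)[OF abz(2)] by auto
  then show ?thesis using abz(1-3) unfolding gens_def by blast
qed

lemma span_mono:
  assumes "x \<in> span \<eta> c r w t" "r' \<le> r" "w' \<le> w" "t' \<le> t" "\<And>a. a \<le> \<eta> \<Longrightarrow> c' a \<le> c a"
  shows "x \<in> span \<eta> c' r' w' t'"
  by (rule group_closure_subset[OF _ assms(1)]) (auto intro!: group_closure_baseI intro: gens_mono assms)

lemma genI:
  assumes "a \<le> \<eta>" "z \<in> E"
    "z \<noteq> 0 \<Longrightarrow> r + c a \<le> weight a b z \<and> w \<le> weight a b z \<and> (b = 0 \<or> t \<le> weight a b z)"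
  shows "of_nat p ^ b * z ^ (p ^ a) \<in> span \<eta> c r w t"
  using assms unfolding gens_def by (intro group_closure_baseI) blast

text \<open>The larger p-power is absorbed in the base of the smaller one, so the smaller exponent
  survives and the weights add up.\<close>

lemma gen_mult:
  assumes "a \<le> a'" "y \<in> E" "z \<in> E"
  obtains x where "x \<in> E" "(of_nat p ^ b * y ^ (p ^ a)) * (of_nat p ^ b' * z ^ (p ^ a')) = of_nat p ^ (b + b') * x ^ (p ^ a)"
    "x \<noteq> 0 \<Longrightarrow> y \<noteq> 0 \<and> z \<noteq> 0 \<and> weight a (b + b') x = weight a b y + weight a' b' z"
proof -
  define x where "x = y * z ^ (p ^ (a' - a))"
  have "z ^ (p ^ a') = (z ^ (p ^ (a' - a))) ^ (p ^ a)"
    using \<open>a \<le> a'\<close> by (simp flip: power_mult power_add)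
  then have eq: "(of_nat p ^ b * y ^ (p ^ a)) * (of_nat p ^ b' * z ^ (p ^ a')) = of_nat p ^ (b + b') * x ^ (p ^ a)"
    by (simp add: x_def power_add power_mult_distrib mult_ac)
  have "int p ^ a * int p ^ (a' - a) = int p ^ a'"
    using \<open>a \<le> a'\<close> by (simp flip: power_add)
  then have "y \<noteq> 0 \<and> z \<noteq> 0 \<and> weight a (b + b') x = weight a b y + weight a' b' z" if "x \<noteq> 0"
    using that assms unfolding weight_def x_def
    by (auto simp: val_mult power_mem val_power algebra_simps)
  moreover have "x \<in> E" using assms by (auto simp: x_def intro!: mem)
  ultimately show thesis using eq by (intro that[of x])
qed

lemma gens_mult_le:
  assumes c: "profile \<eta> c" and "a \<le> a'" "a' \<le> \<eta>" "y \<in> E" "z \<in> E"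
    and y: "y = 0 \<or> r + c a \<le> weight a b y \<and> w \<le> weight a b y \<and> (b = 0 \<or> t \<le> weight a b y)"
    and z: "z = 0 \<or> r' + c a' \<le> weight a' b' z \<and> w' \<le> weight a' b' z \<and> (b' = 0 \<or> t' \<le> weight a' b' z)"
    and s: "s \<le> t + w'" "s \<le> w + t'"
  shows "(of_nat p ^ b * y ^ (p ^ a)) * (of_nat p ^ b' * z ^ (p ^ a'))
    \<in> span \<eta> c (r + r') (w + w') s"
proof -
  obtain x where "x \<in> E"
    and eq: "(of_nat p ^ b * y ^ (p ^ a)) * (of_nat p ^ b' * z ^ (p ^ a')) = of_nat p ^ (b + b') * x ^ (p ^ a)"
    and wt: "x \<noteq> 0 \<Longrightarrow> y \<noteq> 0 \<and> z \<noteq> 0 \<and> weight a (b + b') x = weight a b y + weight a' b' z"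
    using gen_mult[OF assms(2,4,5), of b b'] by metis
  have "0 \<le> c a'" using c \<open>a' \<le> \<eta>\<close> by (rule profile_nonneg)
  then show ?thesis
    unfolding eq using assms(2,3) \<open>x \<in> E\<close> y z s wt by (intro genI) auto
qed

text \<open>A product with a factor p inherits it from one of the two generators, whose weight is
  then at least t or t', while the other has at least w' or w. This is the origin of the two
  conditions on s.\<close>

lemma span_mult:
  assumes c: "profile \<eta> c" and x: "x \<in> span \<eta> c r w t" and y: "y \<in> span \<eta> c r' w' t'"
    and s: "s \<le> t + w'" "s \<le> w + t'"
  shows "x * y \<in> span \<eta> c (r + r') (w + w') s"
proof (rule group_closure_mult[OF _ x y])
  fix g h assume "g \<in> gens \<eta> c r w t" "h \<in> gens \<eta> c r' w' t'"
  then obtain a b y a' b' z where g: "g = of_nat p ^ b * y ^ (p ^ a)" "a \<le> \<eta>" "y \<in> E"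
      "y = 0 \<or> r + c a \<le> weight a b y \<and> w \<le> weight a b y \<and> (b = 0 \<or> t \<le> weight a b y)"
    and h: "h = of_nat p ^ b' * z ^ (p ^ a')" "a' \<le> \<eta>" "z \<in> E"
      "z = 0 \<or> r' + c a' \<le> weight a' b' z \<and> w' \<le> weight a' b' z \<and> (b' = 0 \<or> t' \<le> weight a' b' z)"
    unfolding gens_def mem_Collect_eq by metis
  show "g * h \<in> span \<eta> c (r + r') (w + w') s"
  proof (cases "a \<le> a'")
    case True
    then show ?thesis
      unfolding g(1) h(1) using gens_mult_le[OF c True h(2) g(3) h(3) g(4) h(4) s] by simp
  next
    case False
    then show ?thesis
      unfolding g(1) h(1)
      using gens_mult_le[OF c _ g(2) h(3) g(3) h(4) g(4), of s] s by (simp add: add.commute mult.commute)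
  qed
qed

text \<open>A cross term loses p-powers but gains as many factors p, which the profile inequality
  \<open>c j \<le> c (j + 1) + e\<close> permits.\<close>

lemma span_cross_term:
  assumes c: "profile \<eta> c" and "a \<le> \<eta>" "x \<in> E" "y \<in> E" and i: "0 < i" "i < p ^ a"
    and x: "x = 0 \<or> s \<le> weight a b x" and y: "y = 0 \<or> s \<le> weight a b y"
    and s: "r + c a \<le> s" "w \<le> s + int e" "t \<le> s + int e"
  shows "of_nat p ^ b * (of_nat (p ^ a choose i) * x ^ i * y ^ (p ^ a - i)) \<in> span \<eta> c r w t"
proof -
  \<comment> \<open>Both i and \<open>p ^ a - i\<close> are multiples of
    \<open>p ^ \<alpha>\<close>, and the binomial coefficient supplies the other a - \<alpha>
    factors p.\<close>
  define \<alpha> where "\<alpha> = multiplicity p i"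
  have "p ^ \<alpha> dvd i" "\<not> p ^ Suc \<alpha> dvd i"
    using i prime_p unfolding \<alpha>_def by (auto simp: prime_power_dvd_iff simp del: power_Suc)
  have "\<alpha> < a"
  proof (rule ccontr)
    assume "\<not> \<alpha> < a"
    then have "p ^ a dvd p ^ \<alpha>" by (intro le_imp_power_dvd) simp
    then have "p ^ a dvd i" using \<open>p ^ \<alpha> dvd i\<close> by (rule dvd_trans)
    then show False using i by (auto dest: dvd_imp_le)
  qed
  have "p ^ \<alpha> dvd p ^ a" using \<open>\<alpha> < a\<close> by (intro le_imp_power_dvd) simp
  then have "p ^ \<alpha> dvd p ^ a - i" using \<open>p ^ \<alpha> dvd i\<close> by (rule dvd_diff_nat)
  obtain k where k: "i = p ^ \<alpha> * k" using \<open>p ^ \<alpha> dvd i\<close> by (elim dvdE)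
  obtain l where l: "p ^ a - i = p ^ \<alpha> * l" using \<open>p ^ \<alpha> dvd p ^ a - i\<close> by (elim dvdE)
  have "p ^ (a - \<alpha>) dvd (p ^ a choose i)"
    using prime_p \<open>\<not> p ^ Suc \<alpha> dvd i\<close> \<open>\<alpha> < a\<close> by (intro power_dvd_choose) auto
  then obtain q where q: "(p ^ a choose i) = p ^ (a - \<alpha>) * q" by (elim dvdE)
  define z where "z = x ^ k * y ^ l"
  have xi: "x ^ i = (x ^ k) ^ (p ^ \<alpha>)" by (simp add: k mult.commute flip: power_mult)
  have yl: "y ^ (p ^ a - i) = (y ^ l) ^ (p ^ \<alpha>)" by (simp add: l mult.commute flip: power_mult)
  have qq: "of_nat (p ^ a choose i) = (of_nat p ^ (a - \<alpha>) * of_nat q :: 'a)" by (simp add: q)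
  have "of_nat p ^ b * (of_nat (p ^ a choose i) * x ^ i * y ^ (p ^ a - i))
     = of_nat q * (of_nat p ^ (b + (a - \<alpha>)) * z ^ (p ^ \<alpha>))"
    unfolding xi yl qq z_def by (simp only: power_add power_mult_distrib mult_ac)
  moreover have "of_nat p ^ (b + (a - \<alpha>)) * z ^ (p ^ \<alpha>) \<in> span \<eta> c r w t"
  proof (rule genI)
    show "\<alpha> \<le> \<eta>" using \<open>\<alpha> < a\<close> \<open>a \<le> \<eta>\<close> by simp
    show "z \<in> E" using assms by (auto simp: z_def intro!: mult_mem power_mem)
    assume "z \<noteq> 0"
    then have "x \<noteq> 0" "y \<noteq> 0" using i k l by (auto simp: z_def)
    have kl: "int p ^ \<alpha> * int k + int p ^ \<alpha> * int l = int p ^ a"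
      using k l i by (metis add_diff_inverse_nat of_nat_add of_nat_mult of_nat_power less_imp_le_nat not_less)
    have sx: "s - int b * int e \<le> int p ^ a * v x" "s - int b * int e \<le> int p ^ a * v y"
      using x y \<open>x \<noteq> 0\<close> \<open>y \<noteq> 0\<close> by (auto simp: weight_def)
    \<comment> \<open>\<open>v z\<close> is a combination of \<open>v x\<close> and
      \<open>v y\<close> with coefficients k and l, where
      \<open>p ^ \<alpha> * (k + l) = p ^ a\<close>. Multiplying by \<open>p ^ a\<close> keeps the
      estimate within the integers.\<close>
    have "int p ^ a * (int p ^ \<alpha> * v z) = int p ^ \<alpha> * int k * (int p ^ a * v x) + int p ^ \<alpha> * int l * (int p ^ a * v y)"
      using \<open>x \<noteq> 0\<close> \<open>y \<noteq> 0\<close> assms(3,4) by (simp add: z_def val_mult val_power power_mem algebra_simps)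
    also have "\<dots> \<ge> int p ^ \<alpha> * int k * (s - int b * int e) + int p ^ \<alpha> * int l * (s - int b * int e)"
      using sx by (intro add_mono mult_left_mono) auto
    also have "int p ^ \<alpha> * int k * (s - int b * int e) + int p ^ \<alpha> * int l * (s - int b * int e)
       = int p ^ a * (s - int b * int e)"
      by (simp flip: kl add: algebra_simps)
    finally have "s - int b * int e \<le> int p ^ \<alpha> * v z" by simp
    then have wt: "s + int (a - \<alpha>) * int e \<le> weight \<alpha> (b + (a - \<alpha>)) z"
      by (simp add: weight_def algebra_simps)
    have "c \<alpha> \<le> c a + int (a - \<alpha>) * int e"
      using c \<open>\<alpha> < a\<close> \<open>a \<le> \<eta>\<close> by (intro profile_le) auto
    moreover have "1 * int e \<le> int (a - \<alpha>) * int e"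
      using \<open>\<alpha> < a\<close> by (intro mult_right_mono) auto
    ultimately show "r + c \<alpha> \<le> weight \<alpha> (b + (a - \<alpha>)) z \<and> w \<le> weight \<alpha> (b + (a - \<alpha>)) z \<and>
        (b + (a - \<alpha>) = 0 \<or> t \<le> weight \<alpha> (b + (a - \<alpha>)) z)"
      using wt s by auto
  qed
  ultimately show ?thesis by (metis group_closure_scalar_mult_left)
qed

text \<open>Only cross terms remain. Each carries at least one factor p, which explains the gain of
  e over s in the bounds for w and t.\<close>

lemma span_power_sum:
  assumes c: "profile \<eta> c" and "a \<le> \<eta>" "x \<in> E" "y \<in> E"
    and x: "x = 0 \<or> s \<le> weight a b x" and y: "y = 0 \<or> s \<le> weight a b y"
    and s: "r + c a \<le> s" "w \<le> s + int e" "t \<le> s + int e"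
  shows "of_nat p ^ b * ((x + y) ^ (p ^ a) - x ^ (p ^ a) - y ^ (p ^ a)) \<in> span \<eta> c r w t"
proof -
  let ?f = "\<lambda>i. of_nat (p ^ a choose i) * x ^ i * y ^ (p ^ a - i)"
  have "{..p ^ a} = insert 0 (insert (p ^ a) {0<..<p ^ a})" by auto
  then have "(x + y) ^ (p ^ a) = y ^ (p ^ a) + (x ^ (p ^ a) + (\<Sum>i\<in>{0<..<p ^ a}. ?f i))"
    by (simp add: binomial_ring)
  then have "of_nat p ^ b * ((x + y) ^ (p ^ a) - x ^ (p ^ a) - y ^ (p ^ a)) = (\<Sum>i\<in>{0<..<p ^ a}. of_nat p ^ b * ?f i)"
    by (simp add: sum_distrib_left)
  also have "\<dots> \<in> span \<eta> c r w t"
    using assms by (intro group_closure_sum_mem span_cross_term) auto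
  finally show ?thesis .
qed

lemma perfect_power:
  assumes "u \<in> E" "u \<noteq> 0" "v u = 0"
  shows "\<exists>s\<in>E. s \<noteq> 0 \<and> v s = 0 \<and> val_ge v 1 (u - s ^ (p ^ k))"
proof (induction k)
  case 0
  show ?case using assms by (intro bexI[of _ u]) auto
next
  case (Suc k)
  then obtain s where s: "s \<in> E" "s \<noteq> 0" "v s = 0" "val_ge v 1 (u - s ^ (p ^ k))" by blast
  obtain t where t: "t \<in> E" "t \<noteq> 0" "v t = 0" "val_ge v 1 (s - t ^ p)"
    using perfect[OF s(1-3)] by blast
  have "val_ge v 1 (s ^ (p ^ k) - (t ^ p) ^ (p ^ k))"
    using s t by (intro val_ge_power_diff) (auto intro: mem simp: val_ge_def val_power)
  then have "val_ge v 1 ((u - s ^ (p ^ k)) + (s ^ (p ^ k) - (t ^ p) ^ (p ^ k)))"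
    using s t assms by (intro val_ge_add) (auto intro!: mem)
  then show ?case using t by (intro bexI[of _ t]) (auto simp: power_mult)
qed

text \<open>The sum vanishes for odd \<open>p ^ A\<close>. Otherwise p = 2 and the sum is p times a
  p-power, so its weight rises by e.\<close>

lemma span_neg_power:
  assumes "A \<le> \<eta>" "Y \<in> E" "Y \<noteq> 0 \<Longrightarrow> s \<le> int p ^ A * v Y" "Y \<noteq> 0 \<Longrightarrow> r + c A \<le> s" "w \<le> s + int e" "t \<le> s + int e"
  shows "(- Y) ^ (p ^ A) + Y ^ (p ^ A) \<in> span \<eta> c r w t"
proof (cases "odd (p ^ A)")
  case False
  then have "even p" by auto
  then have p2: "p = 2" using prime_p primes_dvd_imp_eq[of 2 p] by simp
  have "of_nat p ^ 1 * Y ^ (p ^ A) \<in> span \<eta> c r w t"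
    using assms by (intro genI) (auto simp: weight_def)
  then show ?thesis using False by (simp add: p2)
qed simp

text \<open>Factors p of a generator are traded, one at a time, for the expression of p as a sum of pure
  p-powers; the remaining p-powers of weight w are then brought to the largest exponent that
  divisibility of w allows, using that the residue field is perfect.\<close>

lemma span_leading_power:
  assumes c: "profile \<eta> c" and P: "of_nat p \<in> span \<eta> c (int e) (int e) (int e + 1)"
    and A: "A \<le> \<eta>" "w = int p ^ A * w'" "\<And>a. a \<le> \<eta> \<Longrightarrow> int p ^ a dvd w \<Longrightarrow> a \<le> A"
    and x: "x \<in> span \<eta> c r w w"
  shows "\<exists>Y\<in>E. val_ge v w' Y \<and> (Y = 0 \<or> r + c A \<le> w) \<and> x - Y ^ (p ^ A) \<in> span \<eta> c r (w + 1) (w + 1)"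
proof -
  let ?S = "span \<eta> c r (w + 1) (w + 1)"
  define good where "good x \<longleftrightarrow> (\<exists>Y\<in>E. val_ge v w' Y \<and> (Y = 0 \<or> r + c A \<le> w) \<and> x - Y ^ (p ^ A) \<in> ?S)" for x
  have pos: "0 < int p ^ n" for n by simp
  have goodS: "good x" if "x \<in> ?S" for x
    unfolding good_def using that by (intro bexI[of _ 0]) (auto simp: power_0_left)
  have wY: "w \<le> int p ^ A * v Y" if "val_ge v w' Y" "Y \<noteq> 0" for Y
    using that A(2) by (auto simp: val_ge_def)
  have good_diff: "good (x - y)" if xy: "good x" "good y" for x y
  proof -
    obtain Y1 Y2 where Y1: "Y1 \<in> E" "val_ge v w' Y1" "Y1 = 0 \<or> r + c A \<le> w" "x - Y1 ^ (p ^ A) \<in> ?S"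
      and Y2: "Y2 \<in> E" "val_ge v w' Y2" "Y2 = 0 \<or> r + c A \<le> w" "y - Y2 ^ (p ^ A) \<in> ?S"
      using xy unfolding good_def by blast
    show ?thesis
    proof (cases "Y1 = 0 \<and> Y2 = 0")
      case True
      then have "(x - Y1 ^ (p ^ A)) - (y - Y2 ^ (p ^ A)) = x - y" by simp
      then show ?thesis using group_closure.diff[OF Y1(4) Y2(4)] goodS by simp
    next
      case False
      then have r: "r + c A \<le> w" using Y1(3) Y2(3) by auto
      have "of_nat p ^ 0 * ((Y1 + - Y2) ^ (p ^ A) - Y1 ^ (p ^ A) - (- Y2) ^ (p ^ A)) \<in> ?S"
        using c A(1) Y1 Y2 r e_pos wY
        by (intro span_power_sum[where s = w]) (auto intro: mem simp: weight_def val_uminus)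
      moreover have "(- Y2) ^ (p ^ A) + Y2 ^ (p ^ A) \<in> ?S"
        using A(1) Y2 r e_pos wY by (intro span_neg_power[where s = w]) auto
      moreover have "(x - Y1 ^ (p ^ A)) - (y - Y2 ^ (p ^ A)) \<in> ?S"
        using Y1(4) Y2(4) by (rule group_closure.diff)
      ultimately have "(x - Y1 ^ (p ^ A)) - (y - Y2 ^ (p ^ A)) - of_nat p ^ 0 * ((Y1 + - Y2) ^ (p ^ A) - Y1 ^ (p ^ A) - (- Y2) ^ (p ^ A))
          - ((- Y2) ^ (p ^ A) + Y2 ^ (p ^ A)) \<in> ?S"
        by (metis (no_types) group_closure.diff)
      then have "(x - y) - (Y1 - Y2) ^ (p ^ A) \<in> ?S" by (simp add: algebra_simps)
      moreover have "val_ge v w' (Y1 - Y2)" using Y1 Y2 by (intro val_ge_diff)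
      ultimately show ?thesis
        unfolding good_def using Y1 Y2 r by (intro bexI[of _ "Y1 - Y2"]) (auto intro: mem)
    qed
  qed
  have good_pure: "good (z ^ (p ^ a))"
    if z: "a \<le> \<eta>" "z \<in> E" "z \<noteq> 0" "r + c a \<le> w" "int p ^ a * v z = w" for a z
  proof -
    have aA: "a \<le> A" using A(3)[of a] z by auto
    define q where "q = p ^ (A - a)"
    have qA: "q * p ^ a = p ^ A" using aA by (simp add: q_def flip: power_add)
    then have qA': "int p ^ A = int q * int p ^ a" by (metis of_nat_mult of_nat_power)
    have "int p ^ a * v z = int p ^ a * (int q * w')" using z(5) A(2) qA' by (simp add: mult_ac)
    then have vz: "v z = int q * w'" by simp
    \<comment> \<open>z has the valuation of \<open>\<omega> ^ q\<close>. Their quotient is a unit,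
      hence a q-th power up to positive valuation, so z is a q-th power up to an error \<epsilon> of
      higher valuation.\<close>
    obtain \<omega> where \<omega>: "\<omega> \<in> E" "\<omega> \<noteq> 0" "v \<omega> = w'" by (rule exists_val)
    define u where "u = z * inverse (\<omega> ^ q)"
    have u: "u \<in> E" "u \<noteq> 0" using z \<omega> by (auto simp: u_def intro!: mem)
    have "v u = v z + v (inverse (\<omega> ^ q))" unfolding u_def using z \<omega> by (intro val_mult) (auto intro: mem)
    also have "\<dots> = 0" using \<omega> vz by (simp add: val_inverse val_power mem)
    finally have "v u = 0" .
    then obtain s where s: "s \<in> E" "s \<noteq> 0" "v s = 0" "val_ge v 1 (u - s ^ q)"
      using perfect_power[OF u, of "A - a"] unfolding q_def by blast
    define Y where "Y = s * \<omega>"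
    define \<epsilon> where "\<epsilon> = \<omega> ^ q * (u - s ^ q)"
    have zY: "z = Y ^ q + \<epsilon>" using \<omega> by (simp add: Y_def \<epsilon>_def u_def field_simps power_mult_distrib)
    have Y: "Y \<in> E" "Y \<noteq> 0" "v Y = w'" using s \<omega> by (auto simp: Y_def val_mult intro: mem)
    have "val_ge v (int q * w' + 1) \<epsilon>"
      unfolding \<epsilon>_def using \<omega> s u by (intro val_ge_mult) (auto intro!: mem simp: val_ge_def val_power)
    then have \<epsilon>: "\<epsilon> \<in> E" "\<epsilon> = 0 \<or> int q * w' + 1 \<le> v \<epsilon>"
      using \<omega> s u by (auto simp: \<epsilon>_def val_ge_def intro!: mem)
    have \<epsilon>': "w + 1 \<le> int p ^ a * v \<epsilon>" if "\<epsilon> \<noteq> 0"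
    proof -
      have "w + int p ^ a = int p ^ a * (int q * w' + 1)" using A(2) qA' by (simp add: algebra_simps)
      also have "\<dots> \<le> int p ^ a * v \<epsilon>" using \<epsilon> that by (intro mult_left_mono) auto
      finally show ?thesis using pos[of a] by linarith
    qed
    have "of_nat p ^ 0 * ((Y ^ q + \<epsilon>) ^ (p ^ a) - (Y ^ q) ^ (p ^ a) - \<epsilon> ^ (p ^ a)) \<in> ?S"
      using c z Y \<epsilon> e_pos \<epsilon>' A(2) qA'
      by (intro span_power_sum[where s = w]) (auto intro: mem simp: weight_def val_power mult_ac)
    moreover have "of_nat p ^ 0 * \<epsilon> ^ (p ^ a) \<in> ?S"
      using z \<epsilon> \<epsilon>' by (intro genI) (auto simp: weight_def)
    ultimately have "of_nat p ^ 0 * ((Y ^ q + \<epsilon>) ^ (p ^ a) - (Y ^ q) ^ (p ^ a) - \<epsilon> ^ (p ^ a)) + of_nat p ^ 0 * \<epsilon> ^ (p ^ a) \<in> ?S"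
      by (rule group_closure_add)
    then have "z ^ (p ^ a) - Y ^ (p ^ A) \<in> ?S"
      by (simp add: zY qA flip: power_mult)
    moreover have "c A \<le> c a" using c aA A(1) by (rule profile_antimono)
    ultimately show ?thesis
      unfolding good_def using Y z(4) by (intro bexI[of _ Y]) (auto simp: val_ge_def)
  qed
  have good_gen: "good (of_nat p ^ b * z ^ (p ^ a))"
    if "a \<le> \<eta>" "z \<in> E" "z \<noteq> 0 \<Longrightarrow> r + c a \<le> weight a b z \<and> w \<le> weight a b z" for a b z
    using that
  proof (induction b arbitrary: a z)
    case 0
    show ?case
    proof (cases "z \<noteq> 0 \<and> weight a 0 z = w")
      case True
      then show ?thesis using 0 good_pure[of a z] by (auto simp: weight_def)
    next
      case False
      then show ?thesis using 0 by (intro goodS genI) auto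
    qed
  next
    case (Suc b)
    \<comment> \<open>One factor p is replaced by its expression P. A summand of P that itself has a
      factor p weighs more than e and leads to weight at least w + 1; a pure summand leaves b
      factors p, and the induction hypothesis applies.\<close>
    define g where "g = of_nat p ^ b * z ^ (p ^ a)"
    have "good (x * g)" if "x \<in> span \<eta> c (int e) (int e) (int e + 1)" for x
      using that
    proof (induction rule: group_closure.induct)
      case (diff s t)
      then show ?case using good_diff by (simp add: left_diff_distrib)
    next
      case (base x)
      show ?case
      proof (cases "x = 0 \<or> z = 0")
        case True
        then show ?thesis using goodS[of 0] by (auto simp: g_def power_0_left)
      next
        case False
        then obtain a' b' y where y: "x = of_nat p ^ b' * y ^ (p ^ a')" "a' \<le> \<eta>" "y \<in> E"
          "y = 0 \<or> int e + c a' \<le> weight a' b' y \<and> int e \<le> weight a' b' y \<and> (b' = 0 \<or> int e + 1 \<le> weight a' b' y)"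
          using base by (auto simp: gens_def)
        have wz: "weight a (Suc b) z = weight a b z + int e" by (simp add: weight_def algebra_simps)
        have cnn: "0 \<le> c a" "0 \<le> c a'" using c Suc.prems(1) y(2) by (auto intro: profile_nonneg)
        obtain d X where X: "d = a \<or> d = a'" "X \<in> E" "x * g = of_nat p ^ (b' + b) * X ^ (p ^ d)"
          "X \<noteq> 0 \<Longrightarrow> y \<noteq> 0 \<and> weight d (b' + b) X = weight a b z + weight a' b' y"
        proof (cases "a \<le> a'")
          case True
          from gen_mult[OF True Suc.prems(2) y(3), of b b'] obtain X where
            "X \<in> E" "g * x = of_nat p ^ (b + b') * X ^ (p ^ a)"
            "X \<noteq> 0 \<Longrightarrow> z \<noteq> 0 \<and> y \<noteq> 0 \<and> weight a (b + b') X = weight a b z + weight a' b' y"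
            unfolding g_def y(1) by metis
          then show thesis by (intro that[of a X]) (auto simp: add.commute mult.commute)
        next
          case False
          then have "a' \<le> a" by simp
          from gen_mult[OF this y(3) Suc.prems(2), of b' b] obtain X where
            "X \<in> E" "x * g = of_nat p ^ (b' + b) * X ^ (p ^ a')"
            "X \<noteq> 0 \<Longrightarrow> y \<noteq> 0 \<and> z \<noteq> 0 \<and> weight a' (b' + b) X = weight a' b' y + weight a b z"
            unfolding g_def y(1) by metis
          then show thesis by (intro that[of a' X]) (auto simp: add.commute)
        qed
        have d: "d \<le> \<eta>" using X(1) Suc.prems(1) y(2) by auto
        have w1: "r + c d \<le> weight d (b' + b) X \<and> w \<le> weight d (b' + b) X" if "X \<noteq> 0"
          using X(1) X(4)[OF that] y(4) Suc.prems(3) False wz cnn by auto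
        have w2: "w + 1 \<le> weight d (b' + b) X" if "X \<noteq> 0" "b' \<noteq> 0"
          using X(4)[OF that(1)] y(4) Suc.prems(3) False wz that(2) by auto
        show ?thesis
        proof (cases "b' = 0")
          case True
          then show ?thesis using Suc.IH[OF d X(2)] w1 X(3) by simp
        next
          case False
          then show ?thesis unfolding X(3) using w1 w2 d X(2) by (intro goodS genI) auto
        qed
      qed
    qed
    from this[OF P] show ?case by (simp add: g_def mult_ac)
  qed
  have "good x"
    using x
  proof (induction rule: group_closure.induct)
    case (base s)
    then show ?case using goodS[of 0] good_gen by (auto simp: gens_def)
  qed (rule good_diff)
  then show ?thesis unfolding good_def .
qed

text \<open>The bound w is raised by one at a time. If the leading \<open>p ^ A\<close>-th power has
  valuation w, this is the valuation of z and A is the exponent sought; if not, that power already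
  lies in the group for w + 1, and so does z. Once w reaches \<open>r + c 0\<close>, exponent 0
  serves.\<close>

theorem span_val:
  assumes c: "profile \<eta> c" and P: "of_nat p \<in> span \<eta> c (int e) (int e) (int e + 1)"
    and z: "z \<in> span \<eta> c r w w" "z \<noteq> 0"
  shows "\<exists>a\<le>\<eta>. int p ^ a dvd v z \<and> r + c a \<le> v z"
  using z(1)
proof (induction "nat (r + c 0 - w)" arbitrary: w rule: less_induct)
  case less
  have vz: "w \<le> v z" using span_val_ge[OF less.prems] z(2) by (simp add: val_ge_def)
  show ?case
  proof (cases "r + c 0 \<le> w")
    case True
    then show ?thesis using vz by (intro exI[of _ 0]) auto
  next
    case False
    define A where "A = (GREATEST a. a \<le> \<eta> \<and> int p ^ a dvd w)"
    have A: "A \<le> \<eta> \<and> int p ^ A dvd w"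
      unfolding A_def by (rule GreatestI_nat[where k = 0 and b = \<eta>]) auto
    have A': "a \<le> A" if "a \<le> \<eta>" "int p ^ a dvd w" for a
      unfolding A_def using that by (intro Greatest_le_nat[where b = \<eta>]) auto
    obtain w' where w': "w = int p ^ A * w'" using A by (auto elim: dvdE)
    obtain Y where Y: "Y \<in> E" "val_ge v w' Y" "Y = 0 \<or> r + c A \<le> w"
      "z - Y ^ (p ^ A) \<in> span \<eta> c r (w + 1) (w + 1)"
      using span_leading_power[OF c P _ w' A' less.prems] A by blast
    show ?thesis
    proof (cases "Y \<noteq> 0 \<and> v Y = w'")
      case True
      then have "v (Y ^ (p ^ A)) = w" using Y(1) w' by (simp add: val_power)
      then have "v (Y ^ (p ^ A) + (z - Y ^ (p ^ A))) = w"
        using val_add_dominant(2)[of "Y ^ (p ^ A)" "z - Y ^ (p ^ A)"] True Y span_mem[OF Y(4)]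
          span_val_ge[OF Y(4)] by (simp add: power_mem)
      then have "v z = w" by simp
      then show ?thesis using A Y(3) True by (intro exI[of _ A]) auto
    next
      case False
      have "w + 1 \<le> weight A 0 Y" if "Y \<noteq> 0"
      proof -
        have "int p ^ A * (w' + 1) \<le> int p ^ A * v Y"
          using that False Y(2) by (intro mult_left_mono) (auto simp: val_ge_def)
        moreover have "0 < int p ^ A" by simp
        ultimately show ?thesis unfolding w' weight_def distrib_left by linarith
      qed
      then have "of_nat p ^ 0 * Y ^ (p ^ A) \<in> span \<eta> c r (w + 1) (w + 1)"
        using A Y(1,3) by (intro genI) auto
      then have "(z - Y ^ (p ^ A)) + of_nat p ^ 0 * Y ^ (p ^ A) \<in> span \<eta> c r (w + 1) (w + 1)"
        using Y(4) by (intro group_closure_add)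
      then have "z \<in> span \<eta> c r (w + 1) (w + 1)" by simp
      then show ?thesis using less.hyps[of "w + 1"] \<open>\<not> r + c 0 \<le> w\<close> by auto
    qed
  qed
qed

section \<open>Finite expansions in a uniformizer, and the positions of nonzero digits\<close>

lemma expansion:
  assumes \<pi>: "\<pi> \<in> E" "\<pi> \<noteq> 0" "v \<pi> = 1" and y: "y \<in> E" "val_ge v (int s) y"
  shows "\<exists>w. (\<forall>i. w i \<in> E \<and> val_ge v 0 (w i)) \<and>
    val_ge v (int s + int C) (y - (\<Sum>i<C. w i ^ (p ^ k) * \<pi> ^ (s + i)))"
proof (induction C)
  case 0
  show ?case using y by (intro exI[of _ "\<lambda>_. 0"]) auto
next
  case (Suc C)
  then obtain w where w: "\<And>i. w i \<in> E" "\<And>i. val_ge v 0 (w i)"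
    and R: "val_ge v (int s + int C) (y - (\<Sum>i<C. w i ^ (p ^ k) * \<pi> ^ (s + i)))" by blast
  define R where "R = y - (\<Sum>i<C. w i ^ (p ^ k) * \<pi> ^ (s + i))"
  have RE: "R \<in> E" using w y \<pi> by (auto simp: R_def intro!: mem)
  \<comment> \<open>The quotient of the remainder by \<open>\<pi> ^ (s + C)\<close> is a unit if it
    matters at all, and a unit is a \<open>p ^ k\<close>-th power up to positive valuation.\<close>
  obtain x where x: "x \<in> E" "val_ge v 0 x" "val_ge v (int s + int C + 1) (R - x ^ (p ^ k) * \<pi> ^ (s + C))"
  proof (cases "R \<noteq> 0 \<and> v R = int s + int C")
    case True
    define u where "u = R * inverse (\<pi> ^ (s + C))"
    have u: "u \<in> E" "u \<noteq> 0" using True RE \<pi> by (auto simp: u_def intro!: mem)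
    have "v u = v R + v (inverse (\<pi> ^ (s + C)))"
      unfolding u_def using True RE \<pi> by (intro val_mult) (auto intro: mem)
    then have "v u = 0" using True \<pi> by (simp add: val_inverse val_power mem)
    then obtain x where x: "x \<in> E" "x \<noteq> 0" "v x = 0" "val_ge v 1 (u - x ^ (p ^ k))"
      using perfect_power[OF u] by blast
    have "val_ge v (1 + int (s + C)) ((u - x ^ (p ^ k)) * \<pi> ^ (s + C))"
      using x u \<pi> by (intro val_ge_mult) (auto intro!: mem simp: val_ge_def[of v _ "\<pi> ^ _"] val_power)
    moreover have "(u - x ^ (p ^ k)) * \<pi> ^ (s + C) = R - x ^ (p ^ k) * \<pi> ^ (s + C)"
      using \<pi> by (simp add: u_def field_simps)
    ultimately show thesis using x by (intro that[of x]) (auto simp: val_ge_def[of v 0] add_ac)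
  next
    case False
    then show thesis using R RE by (intro that[of 0]) (auto simp: val_ge_def R_def power_0_left)
  qed
  let ?w = "w(C := x)"
  have "(\<Sum>i<Suc C. ?w i ^ (p ^ k) * \<pi> ^ (s + i)) = (\<Sum>i<C. w i ^ (p ^ k) * \<pi> ^ (s + i)) + x ^ (p ^ k) * \<pi> ^ (s + C)"
    by simp
  then have "y - (\<Sum>i<Suc C. ?w i ^ (p ^ k) * \<pi> ^ (s + i)) = R - x ^ (p ^ k) * \<pi> ^ (s + C)"
    by (simp add: R_def)
  then have "val_ge v (int s + int (Suc C)) (y - (\<Sum>i<Suc C. ?w i ^ (p ^ k) * \<pi> ^ (s + i)))"
    using x(3) by (simp only: of_nat_Suc add_ac)
  then show ?case using x w by (intro exI[of _ ?w]) simp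
qed

lemma pow_gen:
  assumes "s \<in> E" "\<pi> \<in> E" "\<pi> \<noteq> 0" "p ^ b dvd N" "b \<le> \<eta>"
  obtains y where "y \<in> E" "s ^ (p ^ \<eta>) * \<pi> ^ N = y ^ (p ^ b)"
    "y \<noteq> 0 \<Longrightarrow> s \<noteq> 0 \<and> int p ^ b * v y = int p ^ \<eta> * v s + int N * v \<pi>"
proof -
  obtain k where k: "N = p ^ b * k" using assms(4) by (elim dvdE)
  define y where "y = s ^ (p ^ (\<eta> - b)) * \<pi> ^ k"
  have "int p ^ b * int p ^ (\<eta> - b) = int p ^ \<eta>" using assms(5) by (simp flip: power_add)
  then have "y \<noteq> 0 \<Longrightarrow> s \<noteq> 0 \<and> int p ^ b * v y = int p ^ \<eta> * v s + int N * v \<pi>"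
    using assms by (auto simp: y_def k val_mult val_power mem algebra_simps)
  moreover have "s ^ (p ^ \<eta>) * \<pi> ^ N = y ^ (p ^ b)"
    using assms(5) unfolding y_def k
    by (simp add: power_mult_distrib mult.commute flip: power_mult power_add)
  moreover have "y \<in> E" using assms by (auto simp: y_def intro!: mem)
  ultimately show thesis by (intro that)
qed

text \<open>By induction the earlier nonzero terms satisfy the bound and are themselves in the
  group. Subtracting them from z leaves an element of valuation exactly h + N, to which
  \<open>span_val\<close> applies.\<close>

lemma digit_bound:
  assumes c: "profile \<eta> c" and P: "of_nat p \<in> span \<eta> c (int e) (int e) (int e + 1)"
    and z: "z \<in> span \<eta> c (int N) (int N) (int N)"
    and \<pi>: "\<pi> \<in> E" "\<pi> \<noteq> 0" "v \<pi> = 1"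
    and digit: "\<And>h. \<exists>s\<in>E. a h = s ^ (p ^ \<eta>) \<and> (s = 0 \<or> v s = 0)"
    and conv: "\<And>k. val_ge v (int N + int k) (z - (\<Sum>h<k. a h * \<pi> ^ (h + N)))"
    and "a h \<noteq> 0"
  shows "\<exists>b\<le>\<eta>. p ^ b dvd h + N \<and> c b \<le> int h"
  using \<open>a h \<noteq> 0\<close>
proof (induction h rule: less_induct)
  case (less h)
  let ?f = "\<lambda>h. a h * \<pi> ^ (h + N)"
  have fE: "?f k \<in> E" for k using digit[of k] \<pi> by (auto intro!: mem)
  have zE: "z \<in> E" using z by (rule span_mem)
  have "?f k \<in> span \<eta> c (int N) (int N) (int N)" if kh: "k < h" for k
  proof (cases "a k = 0")
    case False
    then obtain b where b: "b \<le> \<eta>" "p ^ b dvd k + N" "c b \<le> int k"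
      using less.IH[OF kh] by blast
    obtain s where s: "s \<in> E" "a k = s ^ (p ^ \<eta>)" "s = 0 \<or> v s = 0" using digit by blast
    obtain y where y: "y \<in> E" "s ^ (p ^ \<eta>) * \<pi> ^ (k + N) = y ^ (p ^ b)"
      "y \<noteq> 0 \<Longrightarrow> s \<noteq> 0 \<and> int p ^ b * v y = int p ^ \<eta> * v s + int (k + N) * v \<pi>"
      using pow_gen[OF s(1) \<pi>(1,2) b(2,1)] by blast
    have "of_nat p ^ 0 * y ^ (p ^ b) \<in> span \<eta> c (int N) (int N) (int N)"
      using y s \<pi> b by (intro genI) (auto simp: weight_def)
    then show ?thesis using y s by simp
  qed simp
  then have "(\<Sum>k<h. ?f k) \<in> span \<eta> c (int N) (int N) (int N)"
    by (intro group_closure_sum_mem) auto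
  then have zh: "z - (\<Sum>k<h. ?f k) \<in> span \<eta> c (int N) (int N) (int N)"
    using z by (intro group_closure.diff)
  have vf: "?f h \<noteq> 0" "v (?f h) = int (h + N)"
  proof -
    obtain s where s: "s \<in> E" "a h = s ^ (p ^ \<eta>)" "s = 0 \<or> v s = 0" using digit by blast
    then have "a h \<in> E" "v (a h) = 0" using less.prems by (auto simp: mem val_power)
    then show "?f h \<noteq> 0" "v (?f h) = int (h + N)"
      using less.prems \<pi> by (auto simp: val_mult val_power mem)
  qed
  have "val_ge v (v (?f h) + 1) (z - (\<Sum>k<Suc h. ?f k))"
    using conv[of "Suc h"] vf by (simp add: add_ac)
  then have "?f h + (z - (\<Sum>k<Suc h. ?f k)) \<noteq> 0" "v (?f h + (z - (\<Sum>k<Suc h. ?f k))) = int (h + N)"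
    using val_add_dominant[of "?f h" "z - (\<Sum>k<Suc h. ?f k)"] vf fE zE by (simp_all add: mem)
  then have "z - (\<Sum>k<h. ?f k) \<noteq> 0" "v (z - (\<Sum>k<h. ?f k)) = int (h + N)"
    by simp_all
  then obtain b where "b \<le> \<eta>" "int p ^ b dvd int (h + N)" "int N + c b \<le> int (h + N)"
    using span_val[OF c P zh] by auto
  moreover then have "p ^ b dvd h + N" by (metis of_nat_dvd_iff of_nat_power)
  ultimately show ?case by auto
qed

text \<open>Generators without factors p, closed under multiplication, so that
  \<open>group_closure_prime_power\<close> applies to them. Expansions with Teichmueller digits are
  of this form. The lower bound \<open>lo\<close> on the exponents later separates the part of a
  uniformizer of L with exponents above k.\<close>

definition pure_gens :: "nat \<Rightarrow> (nat \<Rightarrow> int) \<Rightarrow> nat \<Rightarrow> int \<Rightarrow> int \<Rightarrow> 'a set" where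
  "pure_gens \<eta> c lo r t = {z ^ (p ^ a) | a z. lo \<le> a \<and> a \<le> \<eta> \<and> z \<in> E \<and>
     (z = 0 \<or> r + c a \<le> int p ^ a * v z \<and> t \<le> int p ^ a * v z)}"

abbreviation pure_span :: "nat \<Rightarrow> (nat \<Rightarrow> int) \<Rightarrow> nat \<Rightarrow> int \<Rightarrow> int \<Rightarrow> 'a set" where
  "pure_span \<eta> c lo r t \<equiv> group_closure (pure_gens \<eta> c lo r t)"

lemma pure_genI:
  assumes "lo \<le> a" "a \<le> \<eta>" "z \<in> E" "z \<noteq> 0 \<Longrightarrow> r + c a \<le> int p ^ a * v z \<and> t \<le> int p ^ a * v z"
  shows "z ^ (p ^ a) \<in> pure_span \<eta> c lo r t"
  using assms unfolding pure_gens_def by (intro group_closure_baseI) blast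

lemma pure_gens_mono:
  assumes "g \<in> pure_gens \<eta> c lo r t" "lo' \<le> lo" "r' \<le> r" "t' \<le> t"
  shows "g \<in> pure_gens \<eta> c lo' r' t'"
proof -
  obtain a z where az: "g = z ^ (p ^ a)" "lo \<le> a" "a \<le> \<eta>" "z \<in> E"
      "z = 0 \<or> r + c a \<le> int p ^ a * v z \<and> t \<le> int p ^ a * v z"
    using assms(1) by (auto simp: pure_gens_def)
  have "z = 0 \<or> r' + c a \<le> int p ^ a * v z \<and> t' \<le> int p ^ a * v z" "lo' \<le> a"
    using az(2,5) assms(2-4) by auto
  then show ?thesis using az(1,3,4) unfolding pure_gens_def by blast
qed

lemma pure_span_mono:
  assumes "x \<in> pure_span \<eta> c lo r t" "lo' \<le> lo" "r' \<le> r" "t' \<le> t"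
  shows "x \<in> pure_span \<eta> c lo' r' t'"
  by (rule group_closure_subset[OF _ assms(1)]) (auto intro!: group_closure_baseI intro: pure_gens_mono assms)

lemma pure_gens_mem: "pure_gens \<eta> c lo r t \<subseteq> E"
  by (auto simp: pure_gens_def intro!: mem)

lemma pure_span_mem: "x \<in> pure_span \<eta> c lo r t \<Longrightarrow> x \<in> E"
  using group_closure_mem[OF pure_gens_mem] .

lemma pure_span_val_ge: "x \<in> pure_span \<eta> c lo r t \<Longrightarrow> val_ge v t x"
proof (rule group_closure_val_ge[OF pure_gens_mem])
  fix g assume "g \<in> pure_gens \<eta> c lo r t"
  then obtain a y where "g = y ^ (p ^ a)" "y \<in> E" "y = 0 \<or> t \<le> int p ^ a * v y"
    by (auto simp: pure_gens_def)
  then show "val_ge v t g" by (cases "y = 0") (auto simp: val_ge_def val_power)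
qed

lemma pure_gens_mult:
  assumes c: "profile \<eta> c" and g: "g \<in> pure_gens \<eta> c lo r t" and h: "h \<in> pure_gens \<eta> c lo r' t'"
  shows "g * h \<in> pure_gens \<eta> c lo (r + r') (t + t')"
proof -
  have le: "y ^ (p ^ a) * z ^ (p ^ a') \<in> pure_gens \<eta> c lo (r + r') (t + t')"
    if H: "lo \<le> a" "a \<le> a'" "a' \<le> \<eta>" "y \<in> E" "z \<in> E"
      "y = 0 \<or> r + c a \<le> int p ^ a * v y \<and> t \<le> int p ^ a * v y"
      "z = 0 \<or> r' + c a' \<le> int p ^ a' * v z \<and> t' \<le> int p ^ a' * v z" for a a' y z r r' t t'
  proof -
    obtain x where x: "x \<in> E" "(of_nat p ^ 0 * y ^ (p ^ a)) * (of_nat p ^ 0 * z ^ (p ^ a')) = of_nat p ^ (0 + 0) * x ^ (p ^ a)"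
      "x \<noteq> 0 \<Longrightarrow> y \<noteq> 0 \<and> z \<noteq> 0 \<and> weight a (0 + 0) x = weight a 0 y + weight a' 0 z"
      using gen_mult[OF H(2,4,5)] by blast
    have "0 \<le> c a'" using c H(3) by (rule profile_nonneg)
    then have "x = 0 \<or> (r + r') + c a \<le> int p ^ a * v x \<and> t + t' \<le> int p ^ a * v x"
      using x(3) H(6,7) by (auto simp: weight_def)
    moreover have "y ^ (p ^ a) * z ^ (p ^ a') = x ^ (p ^ a)" "a \<le> \<eta>" using x(2) H(2,3) by auto
    ultimately show ?thesis using x(1) H(1) unfolding pure_gens_def by blast
  qed
  obtain a y where y: "g = y ^ (p ^ a)" "lo \<le> a" "a \<le> \<eta>" "y \<in> E"
      "y = 0 \<or> r + c a \<le> int p ^ a * v y \<and> t \<le> int p ^ a * v y"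
    using g by (auto simp: pure_gens_def)
  obtain a' z where z: "h = z ^ (p ^ a')" "lo \<le> a'" "a' \<le> \<eta>" "z \<in> E"
      "z = 0 \<or> r' + c a' \<le> int p ^ a' * v z \<and> t' \<le> int p ^ a' * v z"
    using h by (auto simp: pure_gens_def)
  show ?thesis
  proof (cases "a \<le> a'")
    case True
    then show ?thesis using le[OF y(2) True z(3) y(4) z(4) y(5) z(5)] y(1) z(1) by simp
  next
    case False
    then show ?thesis using le[OF z(2) _ y(3) z(4) y(4) z(5) y(5)] y(1) z(1) by (simp add: add.commute mult.commute)
  qed
qed

lemma pure_span_mult:
  assumes c: "profile \<eta> c" and x: "x \<in> pure_span \<eta> c lo r t" and y: "y \<in> pure_span \<eta> c lo r' t'"
  shows "x * y \<in> pure_span \<eta> c lo (r + r') (t + t')"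
  by (rule group_closure_mult[OF _ x y]) (auto intro!: group_closure_baseI pure_gens_mult[OF c])

lemma pure_span_power:
  assumes c: "profile \<eta> c" and x: "x \<in> pure_span \<eta> c lo r t" and "0 < k"
  shows "x ^ k \<in> pure_span \<eta> c lo (int k * r) (int k * t)"
  using \<open>0 < k\<close>
proof (induction k rule: nat_induct_non_zero)
  case (Suc n)
  then show ?case using pure_span_mult[OF c x Suc.IH] by (simp add: algebra_simps)
qed (use x in simp)

lemma integral_power_mem_pure_span:
  assumes "profile \<eta> c" "s \<in> E" "val_ge v 0 s" "lo \<le> \<eta>"
  shows "s ^ (p ^ \<eta>) \<in> pure_span \<eta> c lo 0 0"
  using assms by (intro pure_genI) (auto simp: profile_def val_ge_def)

lemma pure_span_subset_span: 
  assumes "profile \<eta> c" "x \<in> pure_span \<eta> c lo r r'" 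
  shows "x \<in> span \<eta> c r r t"
proof (rule group_closure_subset[OF _ assms(2)])
  fix g assume "g \<in> pure_gens \<eta> c lo r r'"
  then obtain a y where y: "g = y ^ (p ^ a)" "a \<le> \<eta>" "y \<in> E" "y = 0 \<or> r + c a \<le> int p ^ a * v y"
    by (auto simp: pure_gens_def)
  have "0 \<le> c a" using assms(1) y(2) by (rule profile_nonneg)
  then have "of_nat p ^ 0 * y ^ (p ^ a) \<in> span \<eta> c r r t"
    using y by (intro genI) (auto simp: weight_def)
  then show "g \<in> span \<eta> c r r t" using y by simp
qed

lemma span_integral_power:
  assumes "profile \<eta> c" "s \<in> E" "val_ge v 0 s"
  shows "s ^ (p ^ \<eta>) \<in> span \<eta> c 0 0 t"
  using pure_span_subset_span[OF assms(1) integral_power_mem_pure_span[OF assms, of 0]] by simp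

text \<open>The part of X prime to p is a unit, for otherwise a Bezout relation with p would give 1
  positive valuation. Meant for a binomial coefficient, which in characteristic p must be prime to
  p.\<close>

lemma val_of_nat:
  assumes X: "0 < X" "multiplicity p X = t" and t: "t = 0 \<or> of_nat p \<noteq> (0::'a)"
  shows "of_nat X \<noteq> (0::'a)" "v (of_nat X) = int t * int e"
proof -
  have "X \<noteq> 0" "\<not> is_unit p" using X prime_p by (auto simp: not_prime_unit)
  then obtain Y where Y: "X = p ^ t * Y" "\<not> p dvd Y" using multiplicity_decompose'[of X p] X(2) by auto
  have "coprime p Y" using Y(2) prime_p by (simp add: prime_imp_coprime)
  then have "gcd Y p = 1" by (simp add: coprime_iff_gcd_eq_1 gcd.commute)
  moreover have "Y \<noteq> 0" using Y(2) by (metis dvd_0_right)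
  ultimately obtain x y where xy: "Y * x = p * y + 1" using bezout_nat[of Y p] by auto
  have p1: "val_ge v 1 (of_nat p)" using val_p e_pos by (auto simp: val_ge_def)
  have "\<not> val_ge v 1 (of_nat Y)"
  proof
    assume "val_ge v 1 (of_nat Y)"
    then have "val_ge v (1 + 0) (of_nat Y * of_nat x)" "val_ge v (1 + 0) (of_nat p * of_nat y)"
      using p1 by (auto intro!: val_ge_mult val_ge_of_nat simp del: add_0_right)
    then have "val_ge v 1 (of_nat Y * of_nat x - of_nat p * of_nat y)"
      by (intro val_ge_diff) (auto intro: mem)
    also have "of_nat Y * of_nat x - of_nat p * of_nat y = (1::'a)"
      using arg_cong[OF xy, of "of_nat :: nat \<Rightarrow> 'a"] by simp
    finally show False by (simp add: val_ge_def)
  qed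
  then have Y0: "of_nat Y \<noteq> (0::'a)" "v (of_nat Y) = 0" using val_ge_of_nat[of Y] by (auto simp: val_ge_def)
  have p0: "of_nat p ^ t \<noteq> (0::'a)" "v (of_nat p ^ t) = int t * int e"
    using t val_p by (auto simp: val_power)
  have X: "of_nat X = (of_nat p ^ t * of_nat Y :: 'a)" by (simp add: Y(1))
  show "of_nat X \<noteq> (0::'a)" "v (of_nat X) = int t * int e"
    unfolding X using Y0 p0 by (auto simp: val_mult mem)
qed

lemma pure_span_power':
  assumes c: "profile \<eta> c" and x: "x \<in> pure_span \<eta> c lo r t" and "lo \<le> \<eta>"
  shows "x ^ k \<in> pure_span \<eta> c lo (int k * r) (int k * t)"
proof (cases "k = 0")
  case True
  then show ?thesis using integral_power_mem_pure_span[OF c one_mem _ assms(3)] by (simp add: val_ge_def)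
qed (use pure_span_power[OF c x] in simp)

end

section \<open>Elements of the smaller field in the groups of the larger one\<close>

locale p_valued_ext = F: p_valued_field F vF p eF + E: p_valued_field E vE p eE
  for F E :: "'a::field set" and vF vE p eF eE +
  fixes N :: nat
  assumes sub: "F \<subseteq> E" and N_pos: "0 < N" and e_mult: "eE = N * eF"
    and val_ext: "y \<in> F \<Longrightarrow> y \<noteq> 0 \<Longrightarrow> vE y = int N * vF y"
begin

lemma val_ge_ext: "y \<in> F \<Longrightarrow> val_ge vF w y \<Longrightarrow> val_ge vE (int N * w) y"
  by (cases "y = 0") (auto simp: val_ge_def val_ext mult_left_mono)

text \<open>Common core for \<open>span\<close> and \<open>pure_span\<close>: y is expanded in
  powers of \<pi> with digits that are \<open>p ^ k\<close>-th powers, and the remainder after T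
  terms falls under \<open>tail\<close>.\<close>

lemma mem_graded:
  fixes G :: "int \<Rightarrow> 'a set"
  assumes G0: "\<And>r. 0 \<in> G r" and add: "\<And>r x y. x \<in> G r \<Longrightarrow> y \<in> G r \<Longrightarrow> x + y \<in> G r"
    and mult: "\<And>r s x y. x \<in> G r \<Longrightarrow> y \<in> G s \<Longrightarrow> x * y \<in> G (r + s)"
    and anti: "\<And>r s x. x \<in> G r \<Longrightarrow> s \<le> r \<Longrightarrow> x \<in> G s"
    and coeff: "\<And>w. w \<in> F \<Longrightarrow> val_ge vF 0 w \<Longrightarrow> w ^ (p ^ k) \<in> G 0"
    and tail: "\<And>r y. y \<in> E \<Longrightarrow> val_ge vE (r + int T) y \<Longrightarrow> y \<in> G r"
    and \<pi>: "\<pi> \<in> F" "\<pi> \<noteq> 0" "vF \<pi> = 1" "\<pi> \<in> G (int N)"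
    and y: "y \<in> F" "val_ge vF (int s) y"
  shows "y \<in> G (int s * int N)"
proof -
  have "1 \<in> G 0" using coeff[of 1] by (simp add: val_ge_def)
  have pow: "\<pi> ^ j \<in> G (int j * int N)" for j
  proof (induction j)
    case (Suc j)
    then show ?case using mult[OF \<pi>(4) Suc] by (simp add: algebra_simps)
  qed (use \<open>1 \<in> G 0\<close> in simp)
  obtain w where w: "\<And>i. w i \<in> F" "\<And>i. val_ge vF 0 (w i)"
    and R: "val_ge vF (int s + int T) (y - (\<Sum>i<T. w i ^ (p ^ k) * \<pi> ^ (s + i)))"
    using F.expansion[OF \<pi>(1-3) y, of T k] by blast
  define R where "R = y - (\<Sum>i<T. w i ^ (p ^ k) * \<pi> ^ (s + i))"
  have "R \<in> F" using w y \<pi> by (auto simp: R_def intro!: F.mem)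
  have "w i ^ (p ^ k) * \<pi> ^ (s + i) \<in> G (int s * int N)" for i
    using anti[OF mult[OF coeff[OF w] pow[of "s + i"]], of "int s * int N" i] by (simp add: algebra_simps)
  then have "(\<Sum>i<T. w i ^ (p ^ k) * \<pi> ^ (s + i)) \<in> G (int s * int N)"
    by (induction T) (auto intro: G0 add)
  moreover have "R \<in> G (int s * int N)"
  proof (rule tail)
    have "val_ge vE (int N * (int s + int T)) R" using R \<open>R \<in> F\<close> unfolding R_def by (intro val_ge_ext)
    moreover have "1 * int T \<le> int N * int T" using N_pos by (intro mult_right_mono) auto
    ultimately show "val_ge vE (int s * int N + int T) R"
      by (rule_tac val_ge_mono) (auto simp: algebra_simps)
  qed (use \<open>R \<in> F\<close> sub in auto)
  ultimately have "R + (\<Sum>i<T. w i ^ (p ^ k) * \<pi> ^ (s + i)) \<in> G (int s * int N)" by (intro add)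
  then show ?thesis by (simp add: R_def)
qed

text \<open>This is the independence of choices: membership of one uniformizer of F passes to every
  other one, and to p.\<close>

lemma mem_span:
  assumes c: "E.profile \<eta> c" and \<pi>: "\<pi> \<in> F" "\<pi> \<noteq> 0" "vF \<pi> = 1" "\<pi> \<in> E.span \<eta> c (int N) (int N) (int N + 1)"
    and y: "y \<in> F" "val_ge vF (int s) y"
  shows "y \<in> E.span \<eta> c (int s * int N) (int s * int N) (int s * int N + 1)"
proof (rule mem_graded[where G = "\<lambda>r. E.span \<eta> c r r (r + 1)" and T = "nat (c 0)" and k = \<eta> and \<pi> = \<pi>])
  fix r s x y assume "x \<in> E.span \<eta> c r r (r + 1)" "y \<in> E.span \<eta> c s s (s + 1)"
  then show "x * y \<in> E.span \<eta> c (r + s) (r + s) (r + s + 1)"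
    by (rule E.span_mult[OF c]) auto
next
  fix r y assume y: "y \<in> E" "val_ge vE (r + int (nat (c 0))) y"
  have "0 \<le> c 0" using c by (intro E.profile_nonneg[of \<eta>]) auto
  then have "of_nat p ^ 0 * y ^ (p ^ 0) \<in> E.span \<eta> c r r (r + 1)"
    using y by (intro E.genI) (auto simp: E.weight_def val_ge_def)
  then show "y \<in> E.span \<eta> c r r (r + 1)" by simp
next
  fix w assume "w \<in> F" "val_ge vF 0 w"
  then show "w ^ (p ^ \<eta>) \<in> E.span \<eta> c 0 0 (0 + 1)"
    using val_ge_ext[of w 0] sub by (intro E.span_integral_power[OF c]) auto
qed (use \<pi> y in \<open>auto intro: group_closure_add E.span_mono\<close>)

text \<open>Supplies the assumption of \<open>span_val\<close>: p has valuation eF in F, which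
  becomes N * eF = eE in E, or else p is 0.\<close>

lemma p_mem_span:
  assumes c: "E.profile \<eta> c" and \<pi>: "\<pi> \<in> F" "\<pi> \<noteq> 0" "vF \<pi> = 1" "\<pi> \<in> E.span \<eta> c (int N) (int N) (int N + 1)"
  shows "of_nat p \<in> E.span \<eta> c (int eE) (int eE) (int eE + 1)"
  using mem_span[OF c \<pi>, of "of_nat p" eF] F.val_p by (auto simp: val_ge_def e_mult mult.commute)

lemma mem_pure_span:
  assumes c: "E.profile \<eta> c" and \<pi>: "\<pi> \<in> F" "\<pi> \<noteq> 0" "vF \<pi> = 1" "\<pi> \<in> E.pure_span \<eta> c 0 (int N) (int N)"
    and y: "y \<in> F" "val_ge vF (int s) y"
  shows "y \<in> E.pure_span \<eta> c 0 (int s * int N) (int s * int N)"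
proof (rule mem_graded[where G = "\<lambda>r. E.pure_span \<eta> c 0 r r" and T = "nat (c 0)" and k = \<eta> and \<pi> = \<pi>])
  fix r y assume y: "y \<in> E" "val_ge vE (r + int (nat (c 0))) y"
  have "0 \<le> c 0" using c by (intro E.profile_nonneg[of \<eta>]) auto
  then have "y ^ (p ^ 0) \<in> E.pure_span \<eta> c 0 r r"
    using y by (intro E.pure_genI) (auto simp: val_ge_def)
  then show "y \<in> E.pure_span \<eta> c 0 r r" by simp
next
  fix w assume "w \<in> F" "val_ge vF 0 w"
  then show "w ^ (p ^ \<eta>) \<in> E.pure_span \<eta> c 0 0 0"
    using val_ge_ext[of w 0] sub by (intro E.integral_power_mem_pure_span[OF c]) auto
qed (use \<pi> y in \<open>auto intro: group_closure_add E.pure_span_mono E.pure_span_mult[OF c]\<close>)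

end

section \<open>Totally ramified extensions and their indices\<close>

lemma exists_linear_relation:
  fixes b :: "nat \<Rightarrow> 'a::field" and u :: "'i \<Rightarrow> 'a"
  assumes F: "subfield F" and "finite I" "card I = Suc n"
    and "\<And>k. k \<in> I \<Longrightarrow> u k = (\<Sum>i<n. C k i * b i)" "\<And>k i. k \<in> I \<Longrightarrow> i < n \<Longrightarrow> C k i \<in> F"
  shows "\<exists>c. (\<forall>k\<in>I. c k \<in> F) \<and> (\<exists>k\<in>I. c k \<noteq> 0) \<and> (\<Sum>k\<in>I. c k * u k) = 0"
  using assms(2-5)
proof (induction n arbitrary: I u C)
  case 0
  then obtain k where "I = {k}" by (auto simp: card_1_singleton_iff)
  then show ?case using 0(3) F by (intro exI[of _ "\<lambda>_. 1"]) (auto simp: subfield_def)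
next
  case (Suc n)
  have F': "x - y \<in> F" "x * y \<in> F" if "x \<in> F" "y \<in> F" for x y using F that by (auto simp: subfield_def)
  have F0: "0 \<in> F" using F by (auto simp: subfield_def)
  have Finv: "inverse x \<in> F" if "x \<in> F" for x using F that by (cases "x = 0") (auto simp: subfield_def)
  have Fsum: "sum f A \<in> F" if "\<And>i. i \<in> A \<Longrightarrow> f i \<in> F" for f :: "'i \<Rightarrow> 'a" and A
    using that F by (induction A rule: infinite_finite_induct) (auto simp: subfield_def)
  \<comment> \<open>Pivot for eliminating the last coordinate. If that coordinate vanishes
    throughout I, any element will do and the multipliers \<rho> are 0.\<close>
  obtain k0 where k0: "k0 \<in> I" "(\<exists>k\<in>I. C k n \<noteq> 0) \<Longrightarrow> C k0 n \<noteq> 0"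
  proof (cases "\<exists>k\<in>I. C k n \<noteq> 0")
    case True
    then show thesis using that by blast
  next
    case False
    have "I \<noteq> {}" using Suc.prems(2) by auto
    then show thesis using that False by blast
  qed
  define \<rho> where "\<rho> k = C k n * inverse (C k0 n)" for k
  define u' where "u' k = u k - \<rho> k * u k0" for k
  have \<rho>F: "\<rho> k \<in> F" if "k \<in> I" for k
    unfolding \<rho>_def using that k0(1) Suc.prems(4) by (intro F' Finv) auto
  have "u' k = (\<Sum>i<n. (C k i - \<rho> k * C k0 i) * b i)" if k: "k \<in> I - {k0}" for k
  proof -
    have "C k n - \<rho> k * C k0 n = 0" using k0 k by (cases "C k0 n = 0") (auto simp: \<rho>_def)
    moreover have "u' k = (\<Sum>i<Suc n. (C k i - \<rho> k * C k0 i) * b i)"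
      using Suc.prems(3) k k0(1) by (simp add: u'_def sum_subtractf sum_distrib_left algebra_simps)
    ultimately show ?thesis by simp
  qed
  moreover have "card (I - {k0}) = Suc n" using k0 Suc.prems by simp
  moreover have "C k i - \<rho> k * C k0 i \<in> F" if "k \<in> I - {k0}" "i < n" for k i
    using that k0(1) Suc.prems(4) \<rho>F by (intro F') auto
  ultimately obtain c where c: "\<forall>k\<in>I - {k0}. c k \<in> F" "\<exists>k\<in>I - {k0}. c k \<noteq> 0" "(\<Sum>k\<in>I - {k0}. c k * u' k) = 0"
    using Suc.IH[of "I - {k0}" u' "\<lambda>k i. C k i - \<rho> k * C k0 i"] Suc.prems(1) by auto
  define c' where "c' k = (if k = k0 then - (\<Sum>k\<in>I - {k0}. c k * \<rho> k) else c k)" for k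
  have "- (\<Sum>k\<in>I - {k0}. c k * \<rho> k) \<in> F"
    using F'(1)[OF F0 Fsum[of "I - {k0}" "\<lambda>k. c k * \<rho> k"]] F'(2) c(1) \<rho>F by auto
  then have "\<forall>k\<in>I. c' k \<in> F" using c(1) by (auto simp: c'_def)
  moreover have "\<exists>k\<in>I. c' k \<noteq> 0" using c(2) by (auto simp: c'_def)
  moreover have "(\<Sum>k\<in>I. c' k * u k) = 0"
  proof -
    have "(\<Sum>k\<in>I. c' k * u k) = c' k0 * u k0 + (\<Sum>k\<in>I - {k0}. c' k * u k)"
      using Suc.prems(1) k0(1) by (rule sum.remove)
    also have "(\<Sum>k\<in>I - {k0}. c' k * u k) = (\<Sum>k\<in>I - {k0}. c k * u k)"
      by (rule sum.cong) (auto simp: c'_def)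
    also have "c' k0 * u k0 + \<dots> = (\<Sum>k\<in>I - {k0}. c k * u' k)"
      by (simp add: c'_def u'_def sum_subtractf sum_distrib_left algebra_simps)
    finally show ?thesis using c(3) by simp
  qed
  ultimately show ?case by blast
qed

text \<open>The ramification index already exhausts the degree. A unit u with a residue outside that
  of F would make the n + 1 elements 1, \<pi>, ..., \<open>\<pi> ^ (n - 1)\<close>, u linearly
  independent over F.\<close>

lemma residue_field_eq:
  assumes "valued_field F vF" "valued_field E vE" "F \<subseteq> E" "has_degree F E n" "0 < n"
    and ext: "\<And>y. y \<in> F \<Longrightarrow> y \<noteq> 0 \<Longrightarrow> vE y = int n * vF y"
    and u: "u \<in> E" "u \<noteq> 0" "vE u = 0"
  shows "\<exists>w\<in>F. w \<noteq> 0 \<and> vF w = 0 \<and> val_ge vE 1 (u - w)"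
proof (rule ccontr)
  assume no: "\<not> ?thesis"
  interpret F: valued_field F vF by fact
  interpret E: valued_field E vE by fact
  \<comment> \<open>For integral w the difference is a unit; otherwise w dominates, and its
    valuation in E is a multiple of n.\<close>
  have far: "u - w \<noteq> 0 \<and> vE (u - w) \<le> 0 \<and> int n dvd vE (u - w)" if w: "w \<in> F" for w
  proof (cases "w = 0 \<or> 0 \<le> vF w")
    case True
    have wE: "w \<in> E" using w assms(3) by auto
    have "val_ge vE 0 w"
    proof (cases "w = 0")
      case False
      then show ?thesis using True ext[OF w] by (simp add: val_ge_def)
    qed simp
    then have ge: "val_ge vE 0 (u - w)" using u wE by (intro E.val_ge_diff) (auto simp: val_ge_def)
    have "\<not> val_ge vE 1 (u - w)"
    proof
      assume 1: "val_ge vE 1 (u - w)"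
      show False
      proof (cases "w \<noteq> 0 \<and> vF w = 0")
        case False
        then have "val_ge vE 1 w"
        proof (cases "w = 0")
          case nz: False
          then have "1 \<le> vF w" using True False by auto
          then have "1 * 1 \<le> int n * vF w" using assms(5) by (intro mult_mono) auto
          then show ?thesis using ext[OF w nz] by (simp add: val_ge_def)
        qed simp
        then have "val_ge vE 1 ((u - w) + w)" using 1 u wE by (intro E.val_ge_add) (auto intro: E.mem)
        then show False using u by (simp add: val_ge_def)
      qed (use no 1 w in blast)
    qed
    then have "u - w \<noteq> 0 \<and> vE (u - w) = 0" using ge by (auto simp: val_ge_def)
    then show ?thesis by simp
  next
    case False
    have wE: "- w \<in> E" "w \<in> E" using w assms(3) by (auto intro: E.mem)
    have vw: "vE w = int n * vF w" "vE w < 0" using False ext[OF w] assms(5) by (auto simp: mult_less_0_iff)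
    then have "- w + u \<noteq> 0" "vE (- w + u) = vE (- w)"
      using E.val_add_dominant[of "- w" u] False wE u by (auto simp: E.val_uminus val_ge_def)
    then show ?thesis using vw wE by (simp add: E.val_uminus)
  qed
  obtain b where b: "\<forall>x\<in>E. \<exists>!c. (\<forall>i<n. c i \<in> F) \<and> (\<forall>i. n \<le> i \<longrightarrow> c i = 0) \<and> x = (\<Sum>i<n. c i * b i)"
    using assms(4) unfolding has_degree_def by blast
  obtain \<pi> where \<pi>: "\<pi> \<in> E" "\<pi> \<noteq> 0" "vE \<pi> = 1" by (rule E.uniformizer)
  define U where "U k = (if k < n then \<pi> ^ k else u)" for k
  have UE: "U k \<in> E" for k using \<pi> u by (auto simp: U_def intro: E.mem)
  then have "\<exists>c. (\<forall>i<n. c i \<in> F) \<and> U k = (\<Sum>i<n. c i * b i)" for k using b by blast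
  then obtain C where C: "\<And>k i. i < n \<Longrightarrow> C k i \<in> F" "\<And>k. U k = (\<Sum>i<n. C k i * b i)" by metis
  obtain c where c: "\<forall>k\<in>{..n}. c k \<in> F" "\<exists>k\<in>{..n}. c k \<noteq> 0" "(\<Sum>k\<le>n. c k * U k) = 0"
    using exists_linear_relation[of F "{..n}" n U C b] F.subfield C by auto
  \<comment> \<open>The terms of 1 and u are merged into one. By \<open>far\<close> its valuation is
    still a multiple of n, so the n nonzero terms have valuations in different classes modulo
    n.\<close>
  define x where "x k = (if k = 0 then c 0 + c n * u else c k * \<pi> ^ k)" for k
  have cE: "c k \<in> E" if "k \<le> n" for k using that c(1) assms(3) by auto
  have xE: "x k \<in> E" if "k < n" for k using that cE \<pi> u by (auto simp: x_def intro!: E.mem)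
  have cn: "c n = 0" if "x 0 = 0"
  proof (rule ccontr)
    assume "c n \<noteq> 0"
    have "- c 0 * inverse (c n) \<in> F" using c(1) by (auto intro!: F.mem)
    then have "u - (- c 0 * inverse (c n)) \<noteq> 0" using far by blast
    moreover have "c n * (u - (- c 0 * inverse (c n))) = x 0" using \<open>c n \<noteq> 0\<close> by (simp add: x_def field_simps)
    ultimately show False using that \<open>c n \<noteq> 0\<close> by auto
  qed
  have vx: "int n dvd vE (x k) - int k" if "k < n" "x k \<noteq> 0" for k
  proof (cases "k = 0")
    case False
    then have "c k \<noteq> 0" using that by (auto simp: x_def)
    then show ?thesis using that False c(1) cE[of k] \<pi> ext[of "c k"]
      by (auto simp: x_def E.val_mult E.val_power E.mem)
  next
    case True
    show ?thesis
    proof (cases "c n = 0")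
      case 1: True
      then show ?thesis using True that ext[of "c 0"] c(1) by (auto simp: x_def)
    next
      case False
      let ?w = "- c 0 * inverse (c n)"
      have w: "?w \<in> F" using c(1) by (auto intro!: F.mem)
      then have wE: "u - ?w \<in> E" using assms(3) by (intro E.diff_mem[OF u(1)]) blast
      have eq: "c n * (u - ?w) = x 0" using False by (simp add: x_def field_simps)
      have "vE (x 0) = vE (c n) + vE (u - ?w)"
        unfolding eq[symmetric] using False far[OF w] wE cE[of n] by (intro E.val_mult) auto
      then show ?thesis using True far[OF w] ext[of "c n"] False c(1) by auto
    qed
  qed
  have "(\<Sum>k<n. x k) = 0"
  proof -
    obtain m where n: "n = Suc m" using assms(5) by (cases n) auto
    have "(\<Sum>k<n. c k * \<pi> ^ k) + c n * u = (\<Sum>k\<le>n. c k * U k)"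
      by (simp add: lessThan_Suc_atMost[symmetric] U_def)
    moreover have "(\<Sum>k<n. x k) = (\<Sum>k<n. c k * \<pi> ^ k) + c n * u"
      unfolding n sum.lessThan_Suc_shift by (simp add: x_def n)
    ultimately show ?thesis using c(3) by simp
  qed
  have x0: "x k = 0" if "k < n" for k
  proof (rule E.sum_distinct_val[of "{..<n}" x])
    fix i j assume ij: "i \<in> {..<n}" "j \<in> {..<n}" "i \<noteq> j" "x i \<noteq> 0" "x j \<noteq> 0"
    show "vE (x i) \<noteq> vE (x j)"
    proof
      assume "vE (x i) = vE (x j)"
      have "int n dvd vE (x j) - int j" "int n dvd vE (x i) - int i" using vx ij by auto
      then have "int n dvd (vE (x j) - int j) - (vE (x i) - int i)" by (rule dvd_diff)
      then have "int n dvd int i - int j" using \<open>vE (x i) = vE (x j)\<close> by simp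
      then show False using ij zdvd_imp_le[of "int n" "int i - int j"] zdvd_imp_le[of "int n" "int j - int i"]
        by (cases "i < j") (auto simp: dvd_diff_commute)
    qed
  qed (use xE \<open>(\<Sum>k<n. x k) = 0\<close> that in auto)
  then have "c n = 0" using cn assms(5) by auto
  have "c k = 0" if "k \<le> n" for k
    using x0[of k] x0[of 0] \<open>c n = 0\<close> that \<pi> assms(5) by (cases "k = n") (auto simp: x_def split: if_splits)
  then show False using c(2) by auto
qed

lemma p_valued_field_base:
  assumes "subfield K" "discrete_valuation K vK" "residue_char K vK p" "residue_perfect K vK p"
    "0 < e" "of_nat p = (0::'a::field) \<or> vK (of_nat p :: 'a) = int e"
  shows "p_valued_field K vK p e"
proof -
  interpret valued_field K vK by standard fact+
  show ?thesis
  proof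
    show "prime p" using assms(3) by (simp add: residue_char_def)
    show "0 < e" "of_nat p = (0::'a) \<or> vK (of_nat p :: 'a) = int e" by fact+
    fix u assume u: "u \<in> K" "u \<noteq> 0" "vK u = 0"
    then have "u \<in> val_ring K vK" by (simp add: val_ring_def)
    then obtain b where "b \<in> val_ring K vK" "u - b ^ p = 0 \<or> vK (u - b ^ p) > 0"
      using assms(4) unfolding residue_perfect_def by blast
    then have b: "b \<in> K" "b = 0 \<or> 0 \<le> vK b" "val_ge vK 1 (u - b ^ p)"
      by (auto simp: val_ring_def val_ge_def)
    have "\<not> val_ge vK 1 b"
    proof
      assume "val_ge vK 1 b"
      then have "val_ge vK (int p * 1) (b ^ p)" using b(1) by (intro val_ge_power)
      moreover have "1 \<le> int p" using \<open>prime p\<close> prime_gt_0_nat[of p] by simp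
      ultimately have "val_ge vK 1 (b ^ p)" by (auto intro: val_ge_mono)
      then have "val_ge vK 1 ((u - b ^ p) + b ^ p)" using b u by (intro val_ge_add) (auto intro: mem)
      then show False using u by (simp add: val_ge_def)
    qed
    then show "\<exists>s\<in>K. s \<noteq> 0 \<and> vK s = 0 \<and> val_ge vK 1 (u - s ^ p)"
      using b by (intro bexI[of _ b]) (auto simp: val_ge_def)
  qed
qed

text \<open>Perfectness passes to E: a unit of E is close to a unit of F, which is close to a p-th
  power.\<close>

lemma p_valued_ext_total:
  fixes F E :: "'a::field set"
  assumes "p_valued_field F vF p eF" "valued_field E vE" "F \<subseteq> E" "has_degree F E n" "0 < n"
    and ext: "\<And>y. y \<in> F \<Longrightarrow> y \<noteq> 0 \<Longrightarrow> vE y = int n * vF y"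
  shows "p_valued_ext F E vF vE p eF (n * eF) n"
proof -
  interpret F: p_valued_field F vF p eF by fact
  interpret E: valued_field E vE by fact
  interpret E: p_valued_field E vE p "n * eF"
  proof
    show "of_nat p = (0::'a) \<or> vE (of_nat p) = int (n * eF)"
      using F.val_p ext[of "of_nat p"] by (cases "of_nat p = (0::'a)") auto
    fix u assume u: "u \<in> E" "u \<noteq> 0" "vE u = 0"
    obtain w where w: "w \<in> F" "w \<noteq> 0" "vF w = 0" "val_ge vE 1 (u - w)"
      using residue_field_eq[OF F.valued_field_axioms assms(2-5) ext u] by blast
    obtain s where s: "s \<in> F" "s \<noteq> 0" "vF s = 0" "val_ge vF 1 (w - s ^ p)"
      using F.perfect[OF w(1-3)] by blast
    have "val_ge vE 1 (w - s ^ p)"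
    proof (cases "w - s ^ p = 0")
      case False
      have "1 * 1 \<le> int n * vF (w - s ^ p)" using s(4) False assms(5) by (intro mult_mono) (auto simp: val_ge_def)
      then show ?thesis using ext[of "w - s ^ p"] False w s assms(5) by (simp add: val_ge_def F.mem)
    qed simp
    then have "val_ge vE 1 ((u - w) + (w - s ^ p))"
      using w s u assms(3) by (intro E.val_ge_add) (auto intro!: E.mem)
    then show "\<exists>s\<in>E. s \<noteq> 0 \<and> vE s = 0 \<and> val_ge vE 1 (u - s ^ p)"
      using s assms(3) ext[of s] by (intro bexI[of _ s]) auto
  qed (use F.prime_p F.e_pos assms(5) in auto)
  show ?thesis by standard (use assms in auto)
qed

section \<open>What the recursion for the indices says about the digits\<close>

definition index_facts :: "nat \<Rightarrow> nat \<Rightarrow> nat \<Rightarrow> nat \<Rightarrow> (nat \<Rightarrow> 'a::field) \<Rightarrow> (nat \<Rightarrow> nat) \<Rightarrow> bool" where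
  "index_facts p \<eta> N e a i \<longleftrightarrow> i \<eta> = 0 \<and> a 0 \<noteq> 0 \<and>
     (\<forall>j<\<eta>. i (Suc j) \<le> i j \<and> i j \<le> i (Suc j) + e \<and> 0 < i j \<and>
        (i j < i (Suc j) + e \<longrightarrow> a (i j) \<noteq> 0 \<and> \<not> p ^ Suc j dvd i j + N)) \<and>
     (\<forall>j\<le>\<eta>. \<forall>h. a h \<noteq> 0 \<longrightarrow> \<not> p ^ Suc j dvd h + N \<longrightarrow> i j \<le> h)"

lemma tilde_ind_le: "a h \<noteq> 0 \<Longrightarrow> multiplicity p (h + N) \<le> j \<Longrightarrow> tilde_ind p N a j \<le> enat h"
  by (auto simp: tilde_ind_def intro!: Least_le)

lemma tilde_ind_eq: "tilde_ind p N a j = enat h \<Longrightarrow> a h \<noteq> 0 \<and> multiplicity p (h + N) \<le> j"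
  using LeastI_ex[of "\<lambda>h. multiplicity p (h + N) \<le> j \<and> a h \<noteq> 0"]
  by (auto simp: tilde_ind_def split: if_splits)

lemma tilde_ind_antimono: "j \<le> k \<Longrightarrow> tilde_ind p N a k \<le> tilde_ind p N a j"
  by (cases "tilde_ind p N a j") (auto dest!: tilde_ind_eq intro!: tilde_ind_le)

text \<open>If V is infinite, the recursion never takes its second branch. Neither would it with e
  in place of V, since every index is at most \<open>i 0 < e\<close>; hence the finite e serves in
  both characteristics.\<close>

lemma index_factsI:
  fixes i :: "nat \<Rightarrow> nat"
  assumes p: "prime p" and N: "0 < N" and \<eta>: "\<eta> = multiplicity p N"
    and i: "\<And>j. j \<le> \<eta> \<Longrightarrow> enat (i j) = ind_aux (tilde_ind p N a) V \<eta> (\<eta> - j)"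
    and V: "V = \<infinity> \<and> i 0 < e \<or> V = enat e" and e: "0 < e" and a0: "a 0 \<noteq> 0"
  shows "index_facts p \<eta> N e a i"
proof -
  let ?t = "tilde_ind p N a"
  have i\<eta>: "i \<eta> = 0" using i[of \<eta>] by (simp add: zero_enat_def)
  have rec: "enat (i j) = min (?t j) (enat (i (Suc j)) + V)" if "j < \<eta>" for j
  proof -
    have "\<eta> - j = Suc (\<eta> - Suc j)" "\<eta> - Suc (\<eta> - Suc j) = j" using that by auto
    then show ?thesis using i[of j] i[of "Suc j"] that by simp
  qed
  have it: "enat (i j) \<le> ?t j" if "j \<le> \<eta>" for j
    using that rec[of j] i\<eta> by (cases "j = \<eta>") (auto simp: zero_enat_def[symmetric])
  have anti: "i (Suc j) \<le> i j" if "j < \<eta>" for j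
  proof -
    have "enat (i (Suc j)) \<le> ?t j" using it[of "Suc j"] tilde_ind_antimono[of j "Suc j" p N a] that by simp
    moreover have "enat (i (Suc j)) \<le> enat (i (Suc j)) + V" by simp
    ultimately show ?thesis using rec[OF that] by (metis enat_ord_simps(1) min_def)
  qed
  have le0: "i j \<le> i 0" if "j \<le> \<eta>" for j
    using that
  proof (induction j)
    case (Suc j)
    then show ?case using anti[of j] by simp
  qed simp
  have dvd: "multiplicity p (h + N) \<le> j \<longleftrightarrow> \<not> p ^ Suc j dvd h + N" for h j
    using prime_power_dvd_iff[OF p, of "h + N" "Suc j"] N by auto
  have upper: "i j \<le> i (Suc j) + e" if "j < \<eta>" for j
    using V
  proof
    assume "V = \<infinity> \<and> i 0 < e"
    then show ?thesis using le0[of j] that by simp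
  next
    assume "V = enat e"
    then show ?thesis using rec[OF that] by (metis enat_ord_simps(1) min.cobounded2 plus_enat_simps(1))
  qed
  have digit: "a (i j) \<noteq> 0 \<and> \<not> p ^ Suc j dvd i j + N" if "j < \<eta>" "i j < i (Suc j) + e" for j
  proof -
    have "enat (i j) \<noteq> enat (i (Suc j)) + V" using V that(2) by auto
    then have "?t j = enat (i j)" using rec[OF that(1)] by (metis min_def)
    then show ?thesis using tilde_ind_eq dvd by blast
  qed
  have pos: "0 < i j" if "j < \<eta>" for j
  proof (rule ccontr)
    assume 0: "\<not> 0 < i j"
    then have "i j < i (Suc j) + e" using e by simp
    then have "\<not> p ^ Suc j dvd 0 + N" using digit[OF that] 0 by auto
    then show False using dvd[of 0 j] that \<eta> by simp
  qed
  have bound: "i j \<le> h" if "j \<le> \<eta>" "a h \<noteq> 0" "\<not> p ^ Suc j dvd h + N" for j h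
    using it[OF that(1)] tilde_ind_le[of a h p N j] that(2,3) dvd by (metis enat_ord_simps(1) order_trans)
  have "\<forall>j<\<eta>. i (Suc j) \<le> i j \<and> i j \<le> i (Suc j) + e \<and> 0 < i j \<and>
        (i j < i (Suc j) + e \<longrightarrow> a (i j) \<noteq> 0 \<and> \<not> p ^ Suc j dvd i j + N)"
    using anti upper pos digit by simp
  moreover have "\<forall>j\<le>\<eta>. \<forall>h. a h \<noteq> 0 \<longrightarrow> \<not> p ^ Suc j dvd h + N \<longrightarrow> i j \<le> h"
    using bound by simp
  ultimately show ?thesis unfolding index_facts_def using i\<eta> a0 by (intro conjI)
qed

lemma is_indices_facts:
  assumes ind: "is_indices p F E vF vE N i" and "valued_field F vF" "valued_field E vE" "F \<subseteq> E"
    and p: "prime p" and N: "0 < N" and ext: "\<And>y. y \<in> F \<Longrightarrow> y \<noteq> 0 \<Longrightarrow> vE y = int N * vF y"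
    and e: "0 < e" "of_nat p = (0::'a::field) \<and> i 0 < e \<or> of_nat p \<noteq> (0::'a) \<and> vE (of_nat p :: 'a) = int e"
  obtains \<pi>F \<pi>E a where "\<pi>F \<in> F" "\<pi>F \<noteq> 0" "vF \<pi>F = 1" "\<pi>E \<in> E" "\<pi>E \<noteq> 0" "vE \<pi>E = 1"
    "\<forall>h k. \<exists>s\<in>F. a h = s ^ (p ^ k) \<and> (s = 0 \<or> vE s = 0)"
    "\<forall>k. val_ge vE (int N + int k) (\<pi>F - (\<Sum>h<k. a h * \<pi>E ^ (h + N)))"
    "index_facts p (multiplicity p N) N e a i"
proof -
  interpret F: valued_field F vF by fact
  interpret E: valued_field E vE by fact
  obtain \<pi>F \<pi>E a where \<pi>: "\<pi>F \<in> F" "\<pi>F \<noteq> 0" "vF \<pi>F = 1" "\<pi>E \<in> E" "\<pi>E \<noteq> 0" "vE \<pi>E = 1"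
    and a: "\<And>h. a h \<in> teichmueller F vF p"
    and conv: "val_converges vE (\<lambda>k. \<Sum>h<k. a h * \<pi>E ^ (h + N)) \<pi>F"
    and i: "\<And>j. j \<le> multiplicity p N \<Longrightarrow> enat (i j) = ind_aux (tilde_ind p N a) (val_of_p vE p) (multiplicity p N)
                          (multiplicity p N - j)"
    using ind unfolding is_indices_def by blast
  \<comment> \<open>The valuation is a multiple of \<open>p ^ k\<close> for every k. Taking k to be
    the valuation itself suffices, as \<open>k < p ^ k\<close>.\<close>
  have unit: "vF (a h) = 0" if "a h \<noteq> 0" for h
  proof -
    define k where "k = nat (vF (a h))"
    have nn: "0 \<le> vF (a h)" using a[of h] that by (auto simp: teichmueller_def val_ring_def)
    obtain s where s: "s \<in> F" "s = 0 \<or> 0 \<le> vF s" "s ^ (p ^ k) = a h"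
      using a[of h] unfolding teichmueller_def val_ring_def by blast
    have "s \<noteq> 0" using s that p prime_gt_0_nat[of p] by (auto simp: power_0_left)
    then have eq: "int p ^ k * vF s = vF (a h)" using s F.val_power[of s "p ^ k"] by simp
    show ?thesis
    proof (rule ccontr)
      assume "vF (a h) \<noteq> 0"
      then have "1 \<le> vF s" using eq s(2) \<open>s \<noteq> 0\<close> by (cases "vF s = 0") auto
      then have "int p ^ k * 1 \<le> int p ^ k * vF s" by (intro mult_left_mono) auto
      moreover have "k < p ^ k" using prime_gt_1_nat[OF p] power_gt_expt[of p k] by simp
      then have "int k < int (p ^ k)" by (simp only: of_nat_less_iff)
      ultimately show False using eq nn by (simp add: k_def)
    qed
  qed
  have digit: "\<exists>s\<in>F. a h = s ^ (p ^ k) \<and> (s = 0 \<or> vE s = 0)" for h k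
  proof -
    obtain s where s: "s \<in> F" "s ^ (p ^ k) = a h"
      using a[of h] unfolding teichmueller_def val_ring_def by blast
    have "s = 0 \<or> vE s = 0"
    proof (cases "s = 0")
      case False
      then have "int p ^ k * vF s = vF (a h)" "a h \<noteq> 0" using s F.val_power[of s "p ^ k"] by auto
      then have "vF s = 0" using unit p by auto
      then show ?thesis using ext[OF s(1) False] by simp
    qed simp
    then show ?thesis using s by (intro bexI[of _ s]) simp_all
  qed
  have aE: "a h \<in> E" "val_ge vE 0 (a h)" for h
  proof -
    obtain s where s: "s \<in> F" "a h = s ^ (p ^ 0)" "s = 0 \<or> vE s = 0" using digit by blast
    then show "a h \<in> E" "val_ge vE 0 (a h)" using assms(4) by (auto simp: val_ge_def)
  qed
  have conv': "val_ge vE (int N + int k) (\<pi>F - (\<Sum>h<k. a h * \<pi>E ^ (h + N)))" for k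
    using aE \<pi> assms(4) conv by (intro E.val_ge_partial_sum) auto
  have "a 0 \<noteq> 0"
  proof
    assume "a 0 = 0"
    then have "val_ge vE (int N + 1) \<pi>F" using conv'[of 1] by simp
    then show False using ext[of \<pi>F] \<pi> by (simp add: val_ge_def)
  qed
  moreover have "val_of_p vE p = \<infinity> \<and> i 0 < e \<or> val_of_p vE p = enat e"
    using e(2) by (auto simp: val_of_p_def)
  ultimately have "index_facts p (multiplicity p N) N e a i"
    using p N e(1) i by (intro index_factsI[of p N "multiplicity p N" i a "val_of_p vE p"]) auto
  with \<pi> digit conv' show thesis by (intro that[of \<pi>F \<pi>E a] allI)
qed

section \<open>Minima of affine functions, and the level of a digit\<close>

lemma phi_le: "j \<le> l \<Longrightarrow> phi p i l x \<le> phit p i j x"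
  unfolding phi_def by (intro Min_le) auto

lemma phi_attained: obtains j where "j \<le> l" "phi p i l x = phit p i j x"
proof -
  have "phi p i l x \<in> (\<lambda>j0. phit p i j0 x) ` {..l}" unfolding phi_def by (intro Min_in) auto
  then show thesis using that by auto
qed

text \<open>The exponent with which the term at h enters the group as a p-power; it is capped at
  \<eta>, where the profiles end.\<close>

definition level :: "nat \<Rightarrow> nat \<Rightarrow> nat \<Rightarrow> nat \<Rightarrow> nat" where
  "level p \<eta> N h = min \<eta> (multiplicity p (h + N))"

lemma level_le [simp]: "level p \<eta> N h \<le> \<eta>"
  by (simp add: level_def)

lemma level_dvd: "p ^ level p \<eta> N h dvd h + N"
  by (simp add: level_def multiplicity_dvd')

lemma level_not_dvd: "prime p \<Longrightarrow> 0 < N \<Longrightarrow> level p \<eta> N h < \<eta> \<Longrightarrow> \<not> p ^ Suc (level p \<eta> N h) dvd h + N"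
  by (subst prime_power_dvd_iff) (auto simp: level_def min_def split: if_splits)

lemma le_level: "prime p \<Longrightarrow> 0 < N \<Longrightarrow> j \<le> \<eta> \<Longrightarrow> p ^ j dvd h + N \<Longrightarrow> j \<le> level p \<eta> N h"
  by (subst (asm) prime_power_dvd_iff) (auto simp: level_def)

text \<open>At its own level, the position of a digit bounds the index, and each step down the
  levels costs at most e.\<close>

lemma index_facts_bound:
  assumes "index_facts p \<eta> N e a i" "prime p" "0 < N" "a h \<noteq> 0" "j \<le> level p \<eta> N h"
  shows "i j \<le> h + (level p \<eta> N h - j) * e"
proof -
  let ?l = "level p \<eta> N h"
  have "i ?l \<le> h"
  proof (cases "?l = \<eta>")
    case False
    then have "?l < \<eta>" using level_le[of p \<eta> N h] by linarith
    then show ?thesis using assms(1,4) level_not_dvd[OF assms(2,3), of \<eta> h] unfolding index_facts_def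
      by (metis level_le)
  qed (use assms(1) in \<open>simp add: index_facts_def\<close>)
  moreover have "i j \<le> i k + (k - j) * e" if "j \<le> k" "k \<le> \<eta>" for k
    using that
  proof (induction k rule: dec_induct)
    case (step k)
    then have "i j \<le> i k + (k - j) * e" "i k \<le> i (Suc k) + e" using assms(1) by (auto simp: index_facts_def)
    then show ?case using step.hyps by (simp add: Suc_diff_le)
  qed simp
  ultimately show ?thesis using assms(5) level_le[of p \<eta> N h] by (meson add_le_mono1 le_trans)
qed

text \<open>Unwinding the recursion: an index is the position of a digit or the next index plus e.
  The maximum covers a digit whose level lies below j, where nothing is paid.\<close>

lemma index_facts_attained:
  assumes "index_facts p \<eta> N e a i" "prime p" "0 < N" "0 < e" "j \<le> \<eta>"
  shows "\<exists>h. a h \<noteq> 0 \<and> i j = h + (max j (level p \<eta> N h) - j) * e"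
  using \<open>j \<le> \<eta>\<close>
proof (induction j rule: inc_induct)
  case base
  show ?case using assms(1) by (intro exI[of _ 0]) (simp add: index_facts_def max_absorb1)
next
  case (step j)
  let ?l = "level p \<eta> N"
  show ?case
  proof (cases "i j < i (Suc j) + e")
    case True
    then have h: "a (i j) \<noteq> 0" "\<not> p ^ Suc j dvd i j + N" using assms(1) step.hyps by (auto simp: index_facts_def)
    have "?l (i j) \<le> j"
    proof (rule ccontr)
      assume "\<not> ?l (i j) \<le> j"
      then have "p ^ Suc j dvd p ^ ?l (i j)" by (intro le_imp_power_dvd) simp
      then show False using h(2) level_dvd[of p \<eta> N "i j"] dvd_trans by blast
    qed
    then show ?thesis using h by (intro exI[of _ "i j"]) (simp add: max_absorb1)
  next
    case False
    then have ij: "i j = i (Suc j) + e" using assms(1) step.hyps by (auto simp: index_facts_def intro!: antisym)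
    obtain h where h: "a h \<noteq> 0" "i (Suc j) = h + (max (Suc j) (?l h) - Suc j) * e" using step.IH by blast
    \<comment> \<open>A digit of lower level would already bound \<open>i j\<close> by h, although
      \<open>i j\<close> exceeds \<open>i (Suc j)\<close> by e.\<close>
    have "Suc j \<le> ?l h"
    proof (rule ccontr)
      assume "\<not> Suc j \<le> ?l h"
      then have "?l h \<le> j" "?l h < \<eta>" using step.hyps by auto
      then have "\<not> p ^ Suc (?l h) dvd h + N" by (intro level_not_dvd assms)
      moreover have "p ^ Suc (?l h) dvd p ^ Suc j" using \<open>?l h \<le> j\<close> by (intro le_imp_power_dvd) simp
      ultimately have "\<not> p ^ Suc j dvd h + N" using dvd_trans by blast
      then have "i j \<le> h" using assms(1) h(1) step.hyps unfolding index_facts_def by (metis less_imp_le_nat)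
      then show False using ij h(2) assms(4) by simp
    qed
    then have "max (Suc j) (?l h) = ?l h" "max j (?l h) = ?l h" "?l h - j = Suc (?l h - Suc j)" by auto
    then show ?thesis using h ij by (intro exI[of _ h]) simp
  qed
qed

section \<open>Digit expansions as sums of pure p-powers, and powers of such sums\<close>

context p_valued_field
begin

lemma index_profile: "index_facts p \<eta> N e a i \<Longrightarrow> profile \<eta> (\<lambda>j. int (i j))"
  unfolding index_facts_def profile_def by (metis of_nat_0 of_nat_add of_nat_le_iff)

text \<open>Each term is a p-power whose exponent is its level. The tail from position
  \<open>i 0\<close> on is a single generator of exponent 0.\<close>

lemma digits_pure_span:
  assumes i: "index_facts p \<eta> N e a i" and N: "0 < N"
    and \<pi>: "\<pi> \<in> E" "\<pi> \<noteq> 0" "v \<pi> = 1" and z: "z \<in> E"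
    and digit: "\<And>h. \<exists>s\<in>E. a h = s ^ (p ^ \<eta>) \<and> (s = 0 \<or> v s = 0)"
    and conv: "\<And>k. val_ge v (int N + int k) (z - (\<Sum>h<k. a h * \<pi> ^ (h + N)))"
  shows "z \<in> pure_span \<eta> (\<lambda>j. int (i j)) 0 (int N) (int N)"
proof -
  let ?S = "pure_span \<eta> (\<lambda>j. int (i j)) 0 (int N) (int N)"
  have "a h * \<pi> ^ (h + N) \<in> ?S" for h
  proof (cases "a h = 0")
    case False
    let ?b = "level p \<eta> N h"
    obtain s where s: "s \<in> E" "a h = s ^ (p ^ \<eta>)" "s = 0 \<or> v s = 0" using digit by blast
    obtain y where y: "y \<in> E" "s ^ (p ^ \<eta>) * \<pi> ^ (h + N) = y ^ (p ^ ?b)"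
      "y \<noteq> 0 \<Longrightarrow> s \<noteq> 0 \<and> int p ^ ?b * v y = int p ^ \<eta> * v s + int (h + N) * v \<pi>"
      using pow_gen[OF s(1) \<pi>(1,2) level_dvd level_le] by blast
    have "i ?b \<le> h" using index_facts_bound[OF i prime_p N False order_refl] by simp
    then have "y ^ (p ^ ?b) \<in> ?S" using y(1,3) s(3) \<pi> by (intro pure_genI) auto
    then show ?thesis using s(2) y(2) by simp
  qed simp
  then have "(\<Sum>h<i 0. a h * \<pi> ^ (h + N)) \<in> ?S" by (intro group_closure_sum_mem)
  moreover have "(z - (\<Sum>h<i 0. a h * \<pi> ^ (h + N))) ^ (p ^ 0) \<in> ?S"
  proof (rule pure_genI)
    show "z - (\<Sum>h<i 0. a h * \<pi> ^ (h + N)) \<in> E"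
    proof -
      have "a h \<in> E" for h using digit[of h] power_mem by metis
      then show ?thesis using z \<pi> by (auto intro!: mem)
    qed
  qed (use conv[of "i 0"] in \<open>auto simp: val_ge_def\<close>)
  ultimately have "(z - (\<Sum>h<i 0. a h * \<pi> ^ (h + N))) ^ (p ^ 0) + (\<Sum>h<i 0. a h * \<pi> ^ (h + N)) \<in> ?S"
    by (intro group_closure_add)
  then show ?thesis by simp
qed

text \<open>\<open>bound\<close> is the arithmetic left to the caller: W stands for the weight of a
  generator with b + (k - \<alpha>) factors p and p-exponent \<alpha> + a, as produced by
  \<open>group_closure_prime_power\<close>. Its two premises on W come from the two lower bounds r
  and t for y.\<close>

lemma pure_span_prime_power:
  assumes J: "profile \<mu> J" and y: "y \<in> pure_span \<mu> J lo r t"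
    and bound: "\<And>\<alpha> a W. \<alpha> \<le> k \<Longrightarrow> lo \<le> a \<Longrightarrow> a \<le> \<mu> \<Longrightarrow>
       int p ^ k * r + int p ^ \<alpha> * J a + int (b + (k - \<alpha>)) * int e \<le> W \<Longrightarrow>
       int p ^ k * t + int (b + (k - \<alpha>)) * int e \<le> W \<Longrightarrow>
       \<alpha> + a \<le> \<eta> \<and> r' + c (\<alpha> + a) \<le> W \<and> w' \<le> W \<and> (b + (k - \<alpha>) = 0 \<or> t' \<le> W)"
  shows "of_nat p ^ b * y ^ (p ^ k) \<in> span \<eta> c r' w' t'"
proof -
  define G where "G n = pure_gens \<mu> J lo (int n * r) (int n * t)" for n :: nat
  have "g * h \<in> G (k + l)" if "g \<in> G k" "h \<in> G l" for g h k l
    using pure_gens_mult[OF J that[unfolded G_def]] by (simp add: G_def algebra_simps)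
  moreover have "y \<in> group_closure (G 1)" using y by (simp add: G_def)
  ultimately have yk: "y ^ (p ^ k) \<in> group_closure {of_nat p ^ (k - \<alpha>) * g ^ (p ^ \<alpha>) | \<alpha> g. \<alpha> \<le> k \<and> g \<in> G (p ^ (k - \<alpha>) * 1)}"
    by (intro group_closure_prime_power prime_p)
  have gen: "of_nat p ^ b * g \<in> span \<eta> c r' w' t'"
    if gm: "g \<in> {of_nat p ^ (k - \<alpha>) * g ^ (p ^ \<alpha>) | \<alpha> g. \<alpha> \<le> k \<and> g \<in> G (p ^ (k - \<alpha>) * 1)}" for g
  proof -
    obtain \<alpha> a z where z: "g = of_nat p ^ (k - \<alpha>) * (z ^ (p ^ a)) ^ (p ^ \<alpha>)" "\<alpha> \<le> k" "lo \<le> a" "a \<le> \<mu>" "z \<in> E"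
      "z = 0 \<or> int p ^ (k - \<alpha>) * r + J a \<le> int p ^ a * v z \<and> int p ^ (k - \<alpha>) * t \<le> int p ^ a * v z"
      using gm unfolding G_def pure_gens_def by auto
    \<comment> \<open>This conclusion does not mention W, so the maximum of the two lower bounds is
      used for W.\<close>
    have "\<alpha> + a \<le> \<eta>" using bound[OF z(2-4) max.cobounded1 max.cobounded2] by blast
    have "of_nat p ^ (b + (k - \<alpha>)) * z ^ (p ^ (\<alpha> + a)) \<in> span \<eta> c r' w' t'"
    proof (rule genI)
      assume "z \<noteq> 0"
      have pk: "int p ^ \<alpha> * int p ^ (k - \<alpha>) = int p ^ k" using z(2) by (simp flip: power_add)
      have "int p ^ \<alpha> * (int p ^ (k - \<alpha>) * r + J a) \<le> int p ^ \<alpha> * (int p ^ a * v z)"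
        "int p ^ \<alpha> * (int p ^ (k - \<alpha>) * t) \<le> int p ^ \<alpha> * (int p ^ a * v z)"
        using z(6) \<open>z \<noteq> 0\<close> by (auto intro!: mult_left_mono)
      then have "int p ^ k * r + int p ^ \<alpha> * J a \<le> int p ^ (\<alpha> + a) * v z"
        "int p ^ k * t \<le> int p ^ (\<alpha> + a) * v z"
        by (simp_all add: power_add distrib_left mult.assoc flip: pk)
      then show "r' + c (\<alpha> + a) \<le> weight (\<alpha> + a) (b + (k - \<alpha>)) z \<and> w' \<le> weight (\<alpha> + a) (b + (k - \<alpha>)) z \<and>
          (b + (k - \<alpha>) = 0 \<or> t' \<le> weight (\<alpha> + a) (b + (k - \<alpha>)) z)"
        using bound[OF z(2-4), of "weight (\<alpha> + a) (b + (k - \<alpha>)) z"] unfolding weight_def by simp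
    qed (use z \<open>\<alpha> + a \<le> \<eta>\<close> in auto)
    then show ?thesis by (simp add: z(1) power_add mult_ac flip: power_mult)
  qed
  show ?thesis
    using yk
  proof (induction rule: group_closure.induct)
    case (base s)
    then show ?case using gen by auto
  qed (auto simp: right_diff_distrib intro: group_closure.diff)
qed

lemma span_mult_unit_power:
  assumes c: "profile \<eta> c" and x: "x \<in> span \<eta> c r w t" and s: "s \<in> E" "val_ge v 0 s"
  shows "s ^ (p ^ \<eta>) * x \<in> span \<eta> c r w t"
  using span_mult[OF c span_integral_power[OF c s, of "t - w"] x, of t] by simp

end

section \<open>Towers\<close>

text \<open>Three expansions with unrelated uniformizers: \<open>\<pi>K\<close> in
  \<open>\<pi>L\<close> for L/K, \<open>\<pi>L'\<close> in \<open>\<pi>M\<close> for M/L, and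
  \<open>\<pi>K'\<close> in \<open>\<pi>M'\<close> for M/K.\<close>

locale ramified_tower =
  KL: p_valued_ext K L vK vL p eK eL n + LM: p_valued_ext L M vL vM p eL eM m
  for K L M :: "'a::field set" and vK vL vM p eK eL eM n m +
  fixes \<nu> \<mu> :: nat and I J H :: "nat \<Rightarrow> nat" and a b g :: "nat \<Rightarrow> 'a"
    and \<pi>K \<pi>L \<pi>L' \<pi>M \<pi>K' \<pi>M' :: 'a
  assumes \<nu>: "\<nu> = multiplicity p n" and \<mu>: "\<mu> = multiplicity p m"
    and \<pi>K: "\<pi>K \<in> K" "\<pi>K \<noteq> 0" "vK \<pi>K = 1" and \<pi>L: "\<pi>L \<in> L" "\<pi>L \<noteq> 0" "vL \<pi>L = 1"
    and \<pi>L': "\<pi>L' \<in> L" "\<pi>L' \<noteq> 0" "vL \<pi>L' = 1" and \<pi>M: "\<pi>M \<in> M" "\<pi>M \<noteq> 0" "vM \<pi>M = 1"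
    and \<pi>K': "\<pi>K' \<in> K" "\<pi>K' \<noteq> 0" "vK \<pi>K' = 1" and \<pi>M': "\<pi>M' \<in> M" "\<pi>M' \<noteq> 0" "vM \<pi>M' = 1"
    and a: "\<And>h k. \<exists>s\<in>K. a h = s ^ (p ^ k) \<and> (s = 0 \<or> vL s = 0)"
    and b: "\<And>h k. \<exists>s\<in>L. b h = s ^ (p ^ k) \<and> (s = 0 \<or> vM s = 0)"
    and g: "\<And>h k. \<exists>s\<in>K. g h = s ^ (p ^ k) \<and> (s = 0 \<or> vM s = 0)"
    and conv_a: "\<And>k. val_ge vL (int n + int k) (\<pi>K - (\<Sum>h<k. a h * \<pi>L ^ (h + n)))"
    and conv_b: "\<And>k. val_ge vM (int m + int k) (\<pi>L' - (\<Sum>h<k. b h * \<pi>M ^ (h + m)))"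
    and conv_g: "\<And>k. val_ge vM (int (n * m) + int k) (\<pi>K' - (\<Sum>h<k. g h * \<pi>M' ^ (h + n * m)))"
    and I: "index_facts p \<nu> n eL a I" and J: "index_facts p \<mu> m eM b J"
    and H: "index_facts p (\<nu> + \<mu>) (n * m) eM g H"
    and char_p: "of_nat p = (0::'a) \<Longrightarrow> I 0 < eL"
begin

lemma subKM: "K \<subseteq> M" using KL.sub LM.sub by blast

sublocale KM: p_valued_ext K M vK vM p eK eM "n * m"
proof
  show "eM = n * m * eK" using KL.e_mult LM.e_mult by (simp add: mult_ac)
  show "vM y = int (n * m) * vK y" if "y \<in> K" "y \<noteq> 0" for y
    using that KL.val_ext[of y] LM.val_ext[of y] KL.sub by (auto simp: mult_ac)
qed (use subKM KL.N_pos LM.N_pos in auto)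

section \<open>Minima over pairs of indices, and the lower bound (a)\<close>

abbreviation "profI \<equiv> (\<lambda>j. int (I j))"
abbreviation "profJ \<equiv> (\<lambda>j. int (J j))"
abbreviation "profH \<equiv> (\<lambda>j. int (H j))"

lemma profI: "KL.E.profile \<nu> profI" and profJ: "LM.E.profile \<mu> profJ" and profH: "LM.E.profile (\<nu> + \<mu>) profH"
  using KL.E.index_profile[OF I] LM.E.index_profile[OF J] LM.E.index_profile[OF H] .

text \<open>The constant term of the composite of the two affine functions belonging to (j, k); the
  slope of the composite is \<open>p ^ (j + k)\<close>.\<close>

definition val :: "nat \<Rightarrow> nat \<Rightarrow> int" where
  "val j k = int m * int (I j) + int p ^ j * int (J k)"

definition pairs :: "nat \<Rightarrow> (nat \<times> nat) set" where
  "pairs l = {(j, k). j \<le> \<nu> \<and> k \<le> \<mu> \<and> j + k \<le> l}"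

definition Lam :: "nat \<Rightarrow> int" where
  "Lam l = Min ((\<lambda>(j, k). val j k) ` pairs l)"

lemma finite_pairs: "finite (pairs l)"
  by (rule finite_subset[of _ "{..\<nu>} \<times> {..\<mu>}"]) (auto simp: pairs_def)

lemma Lam_le: "j \<le> \<nu> \<Longrightarrow> k \<le> \<mu> \<Longrightarrow> j + k \<le> l \<Longrightarrow> Lam l \<le> val j k"
  unfolding Lam_def using finite_pairs[of l] by (intro Min_le) (auto simp: pairs_def)

lemma Lam_attained: obtains j k where "j \<le> \<nu>" "k \<le> \<mu>" "j + k \<le> l" "Lam l = val j k"
proof -
  have "(0, 0) \<in> pairs l" by (simp add: pairs_def)
  then have "Lam l \<in> (\<lambda>(j, k). val j k) ` pairs l"
    unfolding Lam_def using finite_pairs[of l] by (intro Min_in) auto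
  then show thesis using that by (auto simp: pairs_def)
qed

lemma val_nonneg: "0 \<le> val j k" by (simp add: val_def)

lemma I_le: "j < \<nu> \<Longrightarrow> I j \<le> I (Suc j) + eL" and J_le: "k < \<mu> \<Longrightarrow> J k \<le> J (Suc k) + eM"
  and I_pos: "j < \<nu> \<Longrightarrow> 0 < I j" and J_pos: "k < \<mu> \<Longrightarrow> 0 < J k"
  and I_top: "I \<nu> = 0" and J_top: "J \<mu> = 0" and H_top: "H (\<nu> + \<mu>) = 0"
  using I J H by (auto simp: index_facts_def)

lemma int_eM: "int eM = int m * int eL" using LM.e_mult by simp

text \<open>A positive j is lowered first: this costs at most m * eL = eM and shrinks the second
  summand. Lowering k may cost \<open>p ^ j * eM\<close>, which is affordable only for j = 0. The
  last clause lets \<open>H_le_val\<close> recover where a pair came from.\<close>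

lemma val_pred:
  assumes "j \<le> \<nu>" "k \<le> \<mu>" "0 < j + k"
  obtains j' k' where "j' \<le> \<nu>" "k' \<le> \<mu>" "Suc (j' + k') = j + k" "val j' k' \<le> val j k + int eM"
    "j = Suc j' \<and> k = k' \<or> j = 0 \<and> j' = 0 \<and> k = Suc k'"
proof (cases j)
  case (Suc i)
  have "int (I i) \<le> int (I j) + int eL" using I_le[of i] Suc assms(1) by simp
  then have "int m * int (I i) \<le> int m * (int (I j) + int eL)" by (intro mult_left_mono) auto
  moreover have "int p ^ i * int (J k) \<le> int p ^ j * int (J k)"
    using Suc by (intro mult_right_mono power_increasing) (auto simp: Suc_le_eq)
  ultimately have "val i k \<le> val j k + int eM" unfolding val_def int_eM by (simp add: algebra_simps)
  then show thesis using that[of i k] Suc assms by auto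
next
  case 0
  then obtain i where k: "k = Suc i" using assms(3) by (cases k) auto
  have "int (J i) \<le> int (J k) + int eM" using J_le[of i] k assms(2) by simp
  then have "val 0 i \<le> val 0 k + int eM" by (simp add: val_def)
  then show thesis using that[of 0 i] 0 k assms by auto
qed

lemma prof_Lam: "LM.E.profile (\<nu> + \<mu>) Lam"
  unfolding LM.E.profile_def
proof (intro conjI allI impI)
  have "Lam (\<nu> + \<mu>) \<le> 0" using Lam_le[of \<nu> \<mu> "\<nu> + \<mu>"] I_top J_top by (simp add: val_def)
  moreover have "0 \<le> Lam (\<nu> + \<mu>)" using Lam_attained[of "\<nu> + \<mu>"] val_nonneg by metis
  ultimately show "Lam (\<nu> + \<mu>) = 0" by simp
next
  fix l assume l: "l < \<nu> + \<mu>"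
  obtain j k where "j \<le> \<nu>" "k \<le> \<mu>" "j + k \<le> l" "Lam l = val j k" by (rule Lam_attained)
  then show "Lam (Suc l) \<le> Lam l" using Lam_le[of j k "Suc l"] by simp
  obtain j k where jk: "j \<le> \<nu>" "k \<le> \<mu>" "j + k \<le> Suc l" "Lam (Suc l) = val j k" by (rule Lam_attained)
  show "Lam l \<le> Lam (Suc l) + int eM"
  proof (cases "j + k \<le> l")
    case True
    then show ?thesis using Lam_le[OF jk(1,2) True] jk(4) by simp
  next
    case False
    obtain j' k' where "j' \<le> \<nu>" "k' \<le> \<mu>" "Suc (j' + k') = j + k" "val j' k' \<le> val j k + int eM"
      using val_pred[OF jk(1,2)] False by (metis add_gr_0 gr0I le0 not_le)
    then show ?thesis using Lam_le[of j' k' l] jk by simp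
  qed
qed

lemma \<pi>L'_mem: "\<pi>L' \<in> LM.E.pure_span \<mu> profJ 0 (int m) (int m)"
proof (rule LM.E.digits_pure_span[OF J LM.N_pos \<pi>M _ _ conv_b])
  show "\<exists>s\<in>M. b h = s ^ (p ^ \<mu>) \<and> (s = 0 \<or> vM s = 0)" for h using b[of h \<mu>] LM.sub by blast
qed (use \<pi>L' LM.sub in auto)

text \<open>The link between the two expansions: passes from the uniformizer expanded in M to the
  one used for K.\<close>

lemma \<pi>L_mem: "\<pi>L \<in> LM.E.pure_span \<mu> profJ 0 (int m) (int m)"
  using LM.mem_pure_span[OF profJ \<pi>L' \<pi>L'_mem \<pi>L(1), of 1] \<pi>L by (simp add: val_ge_def)

lemma \<pi>K'_mem: "\<pi>K' \<in> LM.E.pure_span (\<nu> + \<mu>) profH 0 (int (n * m)) (int (n * m))"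
proof (rule LM.E.digits_pure_span[OF H _ \<pi>M' _ _ conv_g])
  show "\<exists>s\<in>M. g h = s ^ (p ^ (\<nu> + \<mu>)) \<and> (s = 0 \<or> vM s = 0)" for h using g[of h "\<nu> + \<mu>"] subKM by blast
qed (use \<pi>K' subKM KM.N_pos in auto)

lemma a_unit: obtains s where "s \<in> M" "a h = s ^ (p ^ k)" "val_ge vM 0 s" "a h \<noteq> 0 \<Longrightarrow> s \<noteq> 0 \<and> vM s = 0"
proof -
  obtain s where s: "s \<in> K" "a h = s ^ (p ^ k)" "s = 0 \<or> vL s = 0" using a by blast
  have "s \<in> L" using s(1) KL.sub by blast
  then have "s = 0 \<or> vM s = 0" using s(3) LM.val_ext[of s] by (cases "s = 0") auto
  then show thesis using s subKM by (intro that[of s]) (auto simp: val_ge_def power_0_left)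
qed

text \<open>Reduces a statement on \<open>\<pi>K\<close> to single terms of its expansion. C is so
  large that the tail has valuation above n * m + \<open>c 0\<close> in M and is a generator of
  exponent 0.\<close>

lemma \<pi>K_minus_mem:
  assumes c: "LM.E.profile (\<nu> + \<mu>) c"
    and T: "(if a h0 = 0 then 0 else a h0 * \<pi>L ^ (h0 + n)) - T \<in> LM.E.span (\<nu> + \<mu>) c (int (n * m)) (int (n * m)) t"
    and terms: "\<And>h. h \<noteq> h0 \<Longrightarrow> a h \<noteq> 0 \<Longrightarrow> a h * \<pi>L ^ (h + n) \<in> LM.E.span (\<nu> + \<mu>) c (int (n * m)) (int (n * m)) t"
  shows "\<pi>K - T \<in> LM.E.span (\<nu> + \<mu>) c (int (n * m)) (int (n * m)) t"
proof -
  let ?S = "LM.E.span (\<nu> + \<mu>) c (int (n * m)) (int (n * m)) t"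
  define C where "C = Suc h0 + nat (c 0)"
  let ?f = "\<lambda>h. a h * \<pi>L ^ (h + n)"
  have c0: "0 \<le> c 0" using c by (intro LM.E.profile_nonneg[of "\<nu> + \<mu>"]) auto
  have 1: "(\<Sum>h\<in>{..<C} - {h0}. ?f h) \<in> ?S"
    using terms by (intro group_closure_sum_mem) (metis DiffE insertCI mult_zero_left zero_in_group_closure)
  have 2: "?f h0 - T \<in> ?S" using T by (auto split: if_splits)
  define R where "R = \<pi>K - (\<Sum>h<C. ?f h)"
  have "a h \<in> L" for h using a[of h 0] KL.sub by (auto intro: KL.E.mem)
  then have RL: "R \<in> L" using \<pi>K \<pi>L KL.sub by (auto simp: R_def intro!: KL.E.mem)
  have "val_ge vL (int n + int C) R" unfolding R_def by (rule conv_a)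
  then have "val_ge vM (int m * (int n + int C)) R" using RL by (rule LM.val_ge_ext[rotated])
  moreover have "1 * int C \<le> int m * int C" using LM.N_pos by (intro mult_right_mono) auto
  ultimately have "R = 0 \<or> int (n * m) + c 0 + 1 \<le> vM R" using c0 by (auto simp: val_ge_def C_def algebra_simps)
  then have 3: "of_nat p ^ 0 * R ^ (p ^ 0) \<in> ?S"
    using RL LM.sub c0 by (intro LM.E.genI) (auto simp: LM.E.weight_def)
  have "(\<Sum>h\<in>{..<C} - {h0}. ?f h) + (?f h0 - T) + of_nat p ^ 0 * R ^ (p ^ 0) \<in> ?S"
    by (rule group_closure_add[OF group_closure_add[OF 1 2] 3])
  moreover have "(\<Sum>h<C. ?f h) = ?f h0 + (\<Sum>h\<in>{..<C} - {h0}. ?f h)"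
    by (rule sum.remove) (auto simp: C_def)
  ultimately show ?thesis by (simp add: R_def algebra_simps)
qed

text \<open>This is m times \<open>index_facts_bound\<close>: lowering the level of h to \<alpha> is
  paid for by factors p, each of weight eM = m * eL.\<close>

lemma val_le_weight:
  assumes h: "a h \<noteq> 0" and \<alpha>: "\<alpha> \<le> level p \<nu> n h"
    and W: "int m * int (h + n) + int p ^ \<alpha> * int (J k) + int (level p \<nu> n h - \<alpha>) * int eM \<le> W"
  shows "int (n * m) + val \<alpha> k \<le> W"
proof -
  have "I \<alpha> \<le> h + (level p \<nu> n h - \<alpha>) * eL"
    by (rule index_facts_bound[OF I LM.E.prime_p KL.N_pos h \<alpha>])
  then have "int (I \<alpha>) \<le> int h + int (level p \<nu> n h - \<alpha>) * int eL"
    by (simp flip: of_nat_mult of_nat_add)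
  then have "int m * int (I \<alpha>) \<le> int m * (int h + int (level p \<nu> n h - \<alpha>) * int eL)"
    by (intro mult_left_mono) auto
  then show ?thesis using W unfolding val_def int_eM by (simp add: algebra_simps)
qed

lemma \<pi>K_mem: "\<pi>K \<in> LM.E.span (\<nu> + \<mu>) Lam (int (n * m)) (int (n * m)) (int (n * m) + 1)"
proof -
  let ?S = "LM.E.span (\<nu> + \<mu>) Lam (int (n * m)) (int (n * m)) (int (n * m) + 1)"
  have terms: "a h * \<pi>L ^ (h + n) \<in> ?S" if h: "a h \<noteq> 0" for h
  proof -
    let ?l = "level p \<nu> n h"
    obtain u where u: "h + n = p ^ ?l * u" using level_dvd by (metis dvdE)
    then have "0 < u" using KL.N_pos by (cases u) auto
    then have y: "\<pi>L ^ u \<in> LM.E.pure_span \<mu> profJ 0 (int u * int m) (int u * int m)"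
      using LM.E.pure_span_power[OF profJ \<pi>L_mem] by simp
    have pu: "int p ^ ?l * (int u * int m) = int m * int (h + n)"
      unfolding u by simp
    have "of_nat p ^ 0 * (\<pi>L ^ u) ^ (p ^ ?l) \<in> ?S"
    proof (rule LM.E.pure_span_prime_power[OF profJ y], unfold pu)
      fix \<alpha> k W
      assume *: "\<alpha> \<le> ?l" "k \<le> \<mu>"
        "int m * int (h + n) + int p ^ \<alpha> * int (J k) + int (0 + (?l - \<alpha>)) * int eM \<le> W"
      have W: "int (n * m) + val \<alpha> k \<le> W" using val_le_weight[OF h *(1)] *(3) by simp
      have \<alpha>k: "\<alpha> \<le> \<nu>" "\<alpha> + k \<le> \<nu> + \<mu>" using * level_le[of p \<nu> n h] by linarith+
      have "Lam (\<alpha> + k) \<le> val \<alpha> k" using Lam_le \<alpha>k * by simp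
      \<comment> \<open>A factor p occurs only for \<alpha> < \<nu>, where the index is positive;
        this provides the strict bound n * m + 1 for such generators.\<close>
      moreover have "1 \<le> val \<alpha> k" if "?l - \<alpha> \<noteq> 0"
      proof -
        have "\<alpha> < \<nu>" using that level_le[of p \<nu> n h] by linarith
        then have "1 * 1 \<le> int m * int (I \<alpha>)" using I_pos[of \<alpha>] LM.N_pos by (intro mult_mono) auto
        then show ?thesis by (simp add: val_def add_increasing2)
      qed
      ultimately show "\<alpha> + k \<le> \<nu> + \<mu> \<and> int (n * m) + Lam (\<alpha> + k) \<le> W \<and> int (n * m) \<le> W \<and>
          (0 + (?l - \<alpha>) = 0 \<or> int (n * m) + 1 \<le> W)"
        using W \<alpha>k val_nonneg[of \<alpha> k] by (cases "?l - \<alpha> = 0") auto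
    qed
    then have "\<pi>L ^ (h + n) \<in> ?S" by (simp add: u mult.commute flip: power_mult)
    moreover obtain s where "s \<in> M" "a h = s ^ (p ^ (\<nu> + \<mu>))" "val_ge vM 0 s" by (rule a_unit)
    ultimately show ?thesis using LM.E.span_mult_unit_power[OF prof_Lam] by simp
  qed
  have "\<pi>K - 0 \<in> ?S"
  proof (rule \<pi>K_minus_mem[OF prof_Lam, where ?h0.0 = 0])
    show "(if a 0 = 0 then 0 else a 0 * \<pi>L ^ (0 + n)) - 0 \<in> ?S"
      using terms[of 0] by (cases "a 0 = 0") simp_all
  qed (rule terms)
  then show ?thesis by simp
qed

text \<open>Downward in l. If \<open>H l\<close> is the next index plus eM, the inequality for
  \<open>Lam\<close> suffices. Otherwise \<open>H l\<close> is the position of a digit not divisible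
  enough for exponents above l, so \<open>digit_bound\<close> yields an exponent d \<le> l.\<close>

theorem Lam_le_H:
  assumes "l \<le> \<nu> + \<mu>"
  shows "Lam l \<le> int (H l)"
  using assms
proof (induction l rule: inc_induct)
  case base
  then show ?case using prof_Lam H_top by (simp add: LM.E.profile_def)
next
  case (step l)
  show ?case
  proof (cases "H l < H (Suc l) + eM")
    case False
    then have "int (H (Suc l)) + int eM \<le> int (H l)" by simp
    moreover have "Lam l \<le> Lam (Suc l) + int eM" using prof_Lam step.hyps by (simp add: LM.E.profile_def)
    ultimately show ?thesis using step.IH by simp
  next
    case True
    then have h: "g (H l) \<noteq> 0" "\<not> p ^ Suc l dvd H l + n * m" using H step.hyps by (auto simp: index_facts_def)
    have "\<pi>K' \<in> LM.E.span (\<nu> + \<mu>) Lam (int 1 * int (n * m)) (int 1 * int (n * m)) (int 1 * int (n * m) + 1)"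
      using \<pi>K' by (intro KM.mem_span[OF prof_Lam \<pi>K \<pi>K_mem]) (auto simp: val_ge_def)
    then have mem: "\<pi>K' \<in> LM.E.span (\<nu> + \<mu>) Lam (int (n * m)) (int (n * m)) (int (n * m))"
      by (rule LM.E.span_mono) auto
    have "\<exists>s\<in>M. g h = s ^ (p ^ (\<nu> + \<mu>)) \<and> (s = 0 \<or> vM s = 0)" for h using g[of h "\<nu> + \<mu>"] subKM by blast
    from LM.E.digit_bound[OF prof_Lam KM.p_mem_span[OF prof_Lam \<pi>K \<pi>K_mem] mem \<pi>M' this conv_g h(1)]
    obtain d where d: "d \<le> \<nu> + \<mu>" "p ^ d dvd H l + n * m" "Lam d \<le> int (H l)" by blast
    have "d \<le> l"
    proof (rule ccontr)
      assume "\<not> d \<le> l"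
      then have "p ^ Suc l dvd p ^ d" by (intro le_imp_power_dvd) simp
      then show False using h(2) d(2) dvd_trans by blast
    qed
    then have "Lam l \<le> Lam d" using step.hyps by (intro LM.E.profile_antimono[OF prof_Lam]) auto
    then show ?thesis using d by simp
  qed
qed

section \<open>Splitting a uniformizer of L according to p-exponents\<close>

lemma \<pi>L'_split:
  assumes k: "k < \<mu>" and Jk: "J k < J (Suc k) + eM"
  obtains P Q where "\<pi>L' = P + Q" "P \<in> LM.E.pure_span \<mu> profJ (Suc k) (int m) (int m)"
    "Q \<in> LM.E.pure_span \<mu> profJ 0 (int m) (int m + int (J k))" "Q \<noteq> 0" "vM Q = int m + int (J k)"
proof -
  \<comment> \<open>Beyond C the remainder has valuation above m + \<open>J 0\<close>, hence above m
    + \<open>J k\<close>, and cannot disturb the leading term of Q.\<close>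
  define C where "C = Suc (J 0)"
  \<comment> \<open>The positions in D give p-powers of exponent above k. Among the nonzero digits
    outside D the first is at \<open>J k\<close>, which by \<open>Jk\<close> is the position of a
    digit; it determines the valuation of Q.\<close>
  define D where "D = {h. h < C \<and> p ^ Suc k dvd h + m}"
  let ?f = "\<lambda>h. b h * \<pi>M ^ (h + m)"
  define P where "P = sum ?f D"
  define R where "R = \<pi>L' - (\<Sum>h<C. ?f h)"
  define Q where "Q = R + sum ?f ({..<C} - D)"
  have digit: "b (J k) \<noteq> 0" "\<not> p ^ Suc k dvd J k + m" using J k Jk by (auto simp: index_facts_def)
  have bM: "b h \<in> M" and bv: "b h \<noteq> 0 \<Longrightarrow> vM (b h) = 0" for h
  proof -
    obtain s where "s \<in> L" "b h = s ^ (p ^ 0)" "s = 0 \<or> vM s = 0" using b by blast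
    then show "b h \<in> M" "b h \<noteq> 0 \<Longrightarrow> vM (b h) = 0" using LM.sub by auto
  qed
  have fM: "?f h \<in> M" for h using bM \<pi>M by (auto intro!: LM.E.mem)
  have fv: "?f h \<noteq> 0" "vM (?f h) = int (h + m)" if "b h \<noteq> 0" for h
    using that bM[of h] bv[of h] \<pi>M by (auto simp: LM.E.val_mult LM.E.val_power LM.E.mem)
  have anti: "J k \<le> J 0"
    using LM.E.profile_antimono[OF profJ, of 0 k] k by simp
  have RM: "R \<in> M" using fM \<pi>L' LM.sub by (auto simp: R_def intro!: LM.E.diff_mem LM.E.sum_mem)
  have Rv: "val_ge vM (int m + int (J 0) + 1) R" using conv_b[of C] by (simp add: R_def C_def add_ac)
  have gen: "\<exists>y\<in>M. ?f h = y ^ (p ^ l) \<and> (y \<noteq> 0 \<longrightarrow> int p ^ l * vM y = int (h + m))" if "p ^ l dvd h + m" "l \<le> \<mu>" for h l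
  proof -
    obtain s where s: "s \<in> L" "b h = s ^ (p ^ \<mu>)" "s = 0 \<or> vM s = 0" using b by blast
    have "s \<in> M" using s(1) LM.sub by blast
    from LM.E.pow_gen[OF this \<pi>M(1,2) that] obtain y where
      y: "y \<in> M" "s ^ (p ^ \<mu>) * \<pi>M ^ (h + m) = y ^ (p ^ l)"
      "y \<noteq> 0 \<Longrightarrow> s \<noteq> 0 \<and> int p ^ l * vM y = int p ^ \<mu> * vM s + int (h + m) * vM \<pi>M" by blast
    then show ?thesis using s \<pi>M(3) by (intro bexI[of _ y]) auto
  qed
  have J_bound: "J (level p \<mu> m h) \<le> h" if "b h \<noteq> 0" for h
    using index_facts_bound[OF J LM.E.prime_p LM.N_pos that order_refl] by simp
  have "?f h \<in> LM.E.pure_span \<mu> profJ (Suc k) (int m) (int m)" if "h \<in> D" for h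
  proof (cases "b h = 0")
    case False
    let ?l = "level p \<mu> m h"
    have "Suc k \<le> ?l" using that k by (intro le_level LM.E.prime_p LM.N_pos) (auto simp: D_def)
    moreover obtain y where y: "y \<in> M" "?f h = y ^ (p ^ ?l)" "y \<noteq> 0 \<longrightarrow> int p ^ ?l * vM y = int (h + m)"
      using gen[OF level_dvd level_le] by blast
    ultimately show ?thesis unfolding y(2) using J_bound[OF False] by (intro LM.E.pure_genI) auto
  qed simp
  then have P: "P \<in> LM.E.pure_span \<mu> profJ (Suc k) (int m) (int m)"
    unfolding P_def by (intro group_closure_sum_mem)
  have small: "J k \<le> h" if "h \<notin> D" "h < C" "b h \<noteq> 0" for h
    using J that k unfolding index_facts_def D_def by (metis (mono_tags) less_imp_le_nat mem_Collect_eq)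
  have "?f h \<in> LM.E.pure_span \<mu> profJ 0 (int m) (int m + int (J k))" if h: "h \<in> {..<C} - D" for h
  proof (cases "b h = 0")
    case False
    let ?l = "level p \<mu> m h"
    obtain y where y: "y \<in> M" "?f h = y ^ (p ^ ?l)" "y \<noteq> 0 \<longrightarrow> int p ^ ?l * vM y = int (h + m)"
      using gen[OF level_dvd level_le] by blast
    then show ?thesis unfolding y(2) using J_bound[OF False] small[of h] h False
      by (intro LM.E.pure_genI) auto
  qed simp
  then have "sum ?f ({..<C} - D) \<in> LM.E.pure_span \<mu> profJ 0 (int m) (int m + int (J k))"
    by (intro group_closure_sum_mem)
  moreover have "R ^ (p ^ 0) \<in> LM.E.pure_span \<mu> profJ 0 (int m) (int m + int (J k))"
    using RM Rv anti by (intro LM.E.pure_genI) (auto simp: val_ge_def)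
  ultimately have Q: "Q \<in> LM.E.pure_span \<mu> profJ 0 (int m) (int m + int (J k))"
    unfolding Q_def by (intro group_closure_add) auto
  have sum: "(\<Sum>h<C. ?f h) = P + sum ?f ({..<C} - D)"
    unfolding P_def using sum.subset_diff[of D "{..<C}" ?f] by (simp add: D_def subset_eq add.commute)
  then have split: "\<pi>L' = P + Q" by (simp add: Q_def R_def algebra_simps)
  have Jk_in: "J k \<in> {..<C} - D" using anti digit(2) by (auto simp: C_def D_def)
  let ?rest = "R + sum ?f ({..<C} - D - {J k})"
  have "sum ?f ({..<C} - D) = ?f (J k) + sum ?f ({..<C} - D - {J k})"
    using Jk_in by (intro sum.remove) auto
  then have Qeq: "Q = ?f (J k) + ?rest" by (simp add: Q_def algebra_simps)
  have "val_ge vM (int m + int (J k) + 1) (?f h)" if "h \<in> {..<C} - D - {J k}" for h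
  proof (cases "b h = 0")
    case False
    have "J k < h" using small[of h] that False by fastforce
    then show ?thesis using fv[OF False] by (simp add: val_ge_def)
  qed simp
  then have "val_ge vM (int m + int (J k) + 1) (sum ?f ({..<C} - D - {J k}))"
    using fM by (intro LM.E.val_ge_sum) auto
  moreover have "val_ge vM (int m + int (J k) + 1) R" using Rv by (rule val_ge_mono) (use anti in simp)
  ultimately have "val_ge vM (int m + int (J k) + 1) ?rest"
    using RM fM by (intro LM.E.val_ge_add LM.E.sum_mem) auto
  then have restv: "val_ge vM (vM (?f (J k)) + 1) ?rest" unfolding fv(2)[OF digit(1)] by (simp add: add_ac)
  have restM: "?rest \<in> M" using RM fM by (intro LM.E.add_mem LM.E.sum_mem)
  have "Q \<noteq> 0" "vM Q = int m + int (J k)"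
    using LM.E.val_add_dominant[OF fM restM fv(1)[OF digit(1)] restv] unfolding Qeq fv(2)[OF digit(1)] by simp_all
  then show thesis using that[OF split P Q] by blast
qed

text \<open>Transports the splitting to the other uniformizer. In the expansion of
  \<open>\<pi>L\<close> in powers of \<open>\<pi>L'\<close>, each power is replaced by that of P',
  which keeps the exponents above k. The differences \<Delta> go to Q, and only the first,
  multiplied by the unit \<open>w 0 ^ (p ^ \<mu>)\<close>, reaches the least valuation.\<close>

lemma \<pi>L_split:
  assumes k: "k < \<mu>" and Jk: "J k < J (Suc k) + eM"
  obtains P Q where "\<pi>L = P + Q" "P \<in> LM.E.pure_span \<mu> profJ (Suc k) (int m) (int m)"
    "Q \<in> LM.E.pure_span \<mu> profJ 0 (int m) (int m + int (J k))"
    "P \<noteq> 0" "vM P = int m" "Q \<noteq> 0" "vM Q = int m + int (J k)"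
proof -
  obtain P' Q' where split': "\<pi>L' = P' + Q'" and P': "P' \<in> LM.E.pure_span \<mu> profJ (Suc k) (int m) (int m)"
    and Q': "Q' \<in> LM.E.pure_span \<mu> profJ 0 (int m) (int m + int (J k))" "Q' \<noteq> 0" "vM Q' = int m + int (J k)"
    by (rule \<pi>L'_split[OF assms])
  define C where "C = Suc (J 0)"
  have "val_ge vL (int 1) \<pi>L" using \<pi>L by (simp add: val_ge_def)
  then obtain w where w: "\<And>i. w i \<in> L" "\<And>i. val_ge vL 0 (w i)"
    and R: "val_ge vL (int 1 + int C) (\<pi>L - (\<Sum>i<C. w i ^ (p ^ \<mu>) * \<pi>L' ^ (1 + i)))"
    using KL.E.expansion[OF \<pi>L' \<pi>L(1), of 1 C \<mu>] by blast
  define R where "R = \<pi>L - (\<Sum>i<C. w i ^ (p ^ \<mu>) * \<pi>L' ^ (1 + i))"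
  have RL: "R \<in> L" using w \<pi>L \<pi>L' by (auto simp: R_def intro!: KL.E.mem)
  have RM: "R \<in> M" using RL LM.sub by blast
  have wM: "w i \<in> M" "val_ge vM 0 (w i)" for i using w[of i] LM.sub LM.val_ge_ext[of "w i" 0] by auto
  have P'M: "P' \<in> M" and Q'M: "Q' \<in> M" using P' Q'(1) LM.E.pure_span_mem by auto
  define P where "P = (\<Sum>i<C. w i ^ (p ^ \<mu>) * P' ^ (1 + i))"
  define \<Delta> where "\<Delta> i = \<pi>L' ^ (1 + i) - P' ^ (1 + i)" for i
  define Q where "Q = R + (\<Sum>i<C. w i ^ (p ^ \<mu>) * \<Delta> i)"
  have \<Delta>M: "\<Delta> i \<in> M" for i using \<pi>L' LM.sub P'M by (auto simp: \<Delta>_def intro!: LM.E.mem)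
  have split: "\<pi>L = P + Q"
    by (simp add: P_def Q_def R_def \<Delta>_def algebra_simps sum_subtractf)
  have coef: "w i ^ (p ^ \<mu>) \<in> LM.E.pure_span \<mu> profJ lo 0 0" if "lo \<le> \<mu>" for i lo
    using LM.E.integral_power_mem_pure_span[OF profJ wM that] .
  have P'i: "P' ^ (1 + i) \<in> LM.E.pure_span \<mu> profJ (Suc k) (int (1 + i) * int m) (int (1 + i) * int m)" for i
    using k by (intro LM.E.pure_span_power'[OF profJ P']) auto
  have "w i ^ (p ^ \<mu>) * P' ^ (1 + i) \<in> LM.E.pure_span \<mu> profJ (Suc k) (int m) (int m)" for i
  proof (rule LM.E.pure_span_mono[OF LM.E.pure_span_mult[OF profJ coef P'i]])
    show "int m \<le> 0 + int (1 + i) * int m" by (simp add: algebra_simps)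
    then show "int m \<le> 0 + int (1 + i) * int m" .
  qed (use k in auto)
  then have P: "P \<in> LM.E.pure_span \<mu> profJ (Suc k) (int m) (int m)"
    unfolding P_def by (intro group_closure_sum_mem)
  have \<Delta>: "\<Delta> i \<in> LM.E.pure_span \<mu> profJ 0 (int (1 + i) * int m) (int (1 + i) * int m + int (J k))" for i
  proof (induction i)
    case 0
    then show ?case using Q'(1) by (simp add: \<Delta>_def split')
  next
    case (Suc i)
    have eqs: "int m + (int (1 + i) * int m + int (J k)) = int (1 + Suc i) * int m + int (J k)"
      "int m + int (J k) + int (1 + i) * int m = int (1 + Suc i) * int m + int (J k)"
      "int m + int (1 + i) * int m = int (1 + Suc i) * int m" by (simp_all add: algebra_simps)
    have "P' ^ (1 + i) \<in> LM.E.pure_span \<mu> profJ 0 (int (1 + i) * int m) (int (1 + i) * int m)"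
      using P'i by (rule LM.E.pure_span_mono) auto
    from group_closure_add[OF LM.E.pure_span_mult[OF profJ \<pi>L'_mem Suc, unfolded eqs]
      LM.E.pure_span_mult[OF profJ Q'(1) this, unfolded eqs]]
    have "\<pi>L' * \<Delta> i + Q' * P' ^ (1 + i) \<in> LM.E.pure_span \<mu> profJ 0 (int (1 + Suc i) * int m) (int (1 + Suc i) * int m + int (J k))" .
    moreover have "\<Delta> (Suc i) = \<pi>L' * \<Delta> i + Q' * P' ^ (1 + i)" by (simp add: \<Delta>_def split' algebra_simps)
    ultimately show ?case by simp
  qed
  have w\<Delta>: "w i ^ (p ^ \<mu>) * \<Delta> i \<in> LM.E.pure_span \<mu> profJ 0 (int (1 + i) * int m) (int (1 + i) * int m + int (J k))" for i
    using LM.E.pure_span_mult[OF profJ coef[OF le0] \<Delta>] by simp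
  have anti: "J k \<le> J 0"
    using LM.E.profile_antimono[OF profJ, of 0 k] k by simp
  have Rv: "val_ge vM (int m + int (J 0) + 1) R"
  proof -
    have "val_ge vM (int m * (int 1 + int C)) R" using R RL unfolding R_def by (intro LM.val_ge_ext)
    moreover have "1 * int C \<le> int m * int C" using LM.N_pos by (intro mult_right_mono) auto
    ultimately show ?thesis by (rule_tac val_ge_mono) (auto simp: C_def algebra_simps)
  qed
  have "w i ^ (p ^ \<mu>) * \<Delta> i \<in> LM.E.pure_span \<mu> profJ 0 (int m) (int m + int (J k))" for i
    by (rule LM.E.pure_span_mono[OF w\<Delta>]) (auto simp: algebra_simps)
  then have "(\<Sum>i<C. w i ^ (p ^ \<mu>) * \<Delta> i) \<in> LM.E.pure_span \<mu> profJ 0 (int m) (int m + int (J k))"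
    by (intro group_closure_sum_mem)
  moreover have "R ^ (p ^ 0) \<in> LM.E.pure_span \<mu> profJ 0 (int m) (int m + int (J k))"
    using RM Rv anti by (intro LM.E.pure_genI) (auto simp: val_ge_def)
  ultimately have Q: "Q \<in> LM.E.pure_span \<mu> profJ 0 (int m) (int m + int (J k))"
    unfolding Q_def by (intro group_closure_add) auto
  \<comment> \<open>If \<open>w 0\<close> were not a unit, every term and the remainder would have
    valuation at least 2, but \<open>\<pi>L\<close> has valuation 1.\<close>
  have w0: "w 0 \<noteq> 0" "vL (w 0) = 0"
  proof -
    have "\<not> val_ge vL 1 (w 0)"
    proof
      assume w0: "val_ge vL 1 (w 0)"
      have "val_ge vL 2 (w i ^ (p ^ \<mu>) * \<pi>L' ^ (1 + i))" for i
      proof (cases "i = 0")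
        case True
        have "val_ge vL (int (p ^ \<mu>) * 1 + int (1 + i) * 1) (w i ^ (p ^ \<mu>) * \<pi>L' ^ (1 + i))"
          using w \<pi>L' w0 True by (intro KL.E.val_ge_mult KL.E.val_ge_power) (auto intro: KL.E.mem simp: val_ge_def[of vL 1 \<pi>L'])
        moreover have "1 \<le> int (p ^ \<mu>)" by (simp add: Suc_le_eq)
        ultimately show ?thesis using True by (rule_tac val_ge_mono) auto
      next
        case False
        have "val_ge vL (int (p ^ \<mu>) * 0 + int (1 + i) * 1) (w i ^ (p ^ \<mu>) * \<pi>L' ^ (1 + i))"
          using w \<pi>L' by (intro KL.E.val_ge_mult KL.E.val_ge_power) (auto intro: KL.E.mem simp: val_ge_def[of vL 1 \<pi>L'])
        then show ?thesis using False by (rule_tac val_ge_mono) auto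
      qed
      then have "val_ge vL 2 (\<Sum>i<C. w i ^ (p ^ \<mu>) * \<pi>L' ^ (1 + i))"
        using w \<pi>L' by (intro KL.E.val_ge_sum) (auto intro!: KL.E.mem)
      moreover have "val_ge vL 2 R" using R unfolding R_def C_def by (rule val_ge_mono) simp
      ultimately have "val_ge vL 2 (R + (\<Sum>i<C. w i ^ (p ^ \<mu>) * \<pi>L' ^ (1 + i)))"
        using w \<pi>L' RL by (intro KL.E.val_ge_add) (auto intro!: KL.E.mem)
      then show False using \<pi>L by (simp add: R_def val_ge_def)
    qed
    then show "w 0 \<noteq> 0" "vL (w 0) = 0" using w(2)[of 0] by (auto simp: val_ge_def)
  qed
  have \<Delta>0: "\<Delta> 0 = Q'" by (simp add: \<Delta>_def split')
  let ?t = "w 0 ^ (p ^ \<mu>) * Q'"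
  have vt: "?t \<noteq> 0" "vM ?t = int m + int (J k)"
    using w0 Q' Q'M wM[of 0] LM.val_ext[OF w(1) w0(1)] by (auto simp: LM.E.val_mult LM.E.val_power LM.E.mem)
  let ?rest = "R + (\<Sum>i\<in>{..<C} - {0}. w i ^ (p ^ \<mu>) * \<Delta> i)"
  have "(\<Sum>i<C. w i ^ (p ^ \<mu>) * \<Delta> i) = ?t + (\<Sum>i\<in>{..<C} - {0}. w i ^ (p ^ \<mu>) * \<Delta> i)"
    unfolding \<Delta>0[symmetric] by (rule sum.remove) (auto simp: C_def)
  then have Qeq: "Q = ?t + ?rest" by (simp add: Q_def algebra_simps)
  have w\<Delta>M: "w i ^ (p ^ \<mu>) * \<Delta> i \<in> M" for i using wM \<Delta>M by (auto intro!: LM.E.mem)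
  have "val_ge vM (int m + int (J k) + 1) (w i ^ (p ^ \<mu>) * \<Delta> i)" if "i \<in> {..<C} - {0}" for i
  proof (rule val_ge_mono[OF LM.E.pure_span_val_ge[OF w\<Delta>]])
    have "1 * 1 \<le> int i * int m" using that LM.N_pos by (intro mult_mono) auto
    then show "int m + int (J k) + 1 \<le> int (1 + i) * int m + int (J k)" by (simp add: algebra_simps)
  qed
  then have "val_ge vM (int m + int (J k) + 1) (\<Sum>i\<in>{..<C} - {0}. w i ^ (p ^ \<mu>) * \<Delta> i)"
    using w\<Delta>M by (intro LM.E.val_ge_sum) auto
  moreover have "val_ge vM (int m + int (J k) + 1) R" using Rv by (rule val_ge_mono) (use anti in simp)
  ultimately have "val_ge vM (int m + int (J k) + 1) ?rest"
    using RM w\<Delta>M by (intro LM.E.val_ge_add LM.E.sum_mem) auto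
  then have restv: "val_ge vM (vM ?t + 1) ?rest" unfolding vt(2) .
  have restM: "?rest \<in> M" using RM w\<Delta>M by (intro LM.E.add_mem LM.E.sum_mem)
  have tM: "?t \<in> M" using w\<Delta>M[of 0] by (simp add: \<Delta>0)
  have vQ: "Q \<noteq> 0" "vM Q = int m + int (J k)"
    using LM.E.val_add_dominant[OF tM restM vt(1) restv] unfolding Qeq vt(2) by simp_all
  have "\<pi>L \<in> M" "- Q \<in> M" using \<pi>L LM.sub LM.E.pure_span_mem[OF Q] by (auto intro: LM.E.mem)
  moreover have "vM \<pi>L = int m" using LM.val_ext[OF \<pi>L(1,2)] \<pi>L(3) by simp
  moreover have "val_ge vM (int m + 1) (- Q)"
    using vQ J_pos[OF k] LM.E.pure_span_mem[OF Q] by (auto simp: val_ge_def LM.E.val_uminus)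
  ultimately have "\<pi>L + - Q \<noteq> 0" "vM (\<pi>L + - Q) = int m"
    using LM.E.val_add_dominant[of \<pi>L "- Q"] \<pi>L(2) by auto
  then have "P \<noteq> 0" "vM P = int m" using split by simp_all
  then show thesis using that[OF split P Q _ _ vQ] by blast
qed

text \<open>A form of the uniqueness in (b) that does not mention x. For x > 0 it follows from
  uniqueness at one sum, because pairs of smaller sum have smaller slope and so must have larger
  constant term.\<close>

definition strict_min :: "nat \<Rightarrow> nat \<Rightarrow> bool" where
  "strict_min j k \<longleftrightarrow> j \<le> \<nu> \<and> k \<le> \<mu> \<and>
     (\<forall>j' k'. j' \<le> \<nu> \<longrightarrow> k' \<le> \<mu> \<longrightarrow> j' + k' \<le> j + k \<longrightarrow> (j', k') \<noteq> (j, k) \<longrightarrow> val j k < val j' k')"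

lemma strict_minD:
  "strict_min j k \<Longrightarrow> j' \<le> \<nu> \<Longrightarrow> k' \<le> \<mu> \<Longrightarrow> j' + k' \<le> j + k \<Longrightarrow> (j', k') \<noteq> (j, k) \<Longrightarrow> val j k < val j' k'"
  by (simp add: strict_min_def)

text \<open>Otherwise (j', k) would have smaller sum and no larger value.\<close>

lemma I_less:
  assumes "strict_min j k" "j' < j"
  shows "I j < I j'"
proof (rule ccontr)
  assume "\<not> I j < I j'"
  then have "int m * int (I j') \<le> int m * int (I j)" by (intro mult_left_mono) auto
  moreover have "int p ^ j' * int (J k) \<le> int p ^ j * int (J k)"
    using assms(2) by (intro mult_right_mono power_increasing) (auto simp: Suc_le_eq)
  ultimately have "val j' k \<le> val j k" unfolding val_def by linarith
  then show False using strict_minD[OF assms(1), of j' k] assms by (auto simp: strict_min_def)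
qed

text \<open>If the index at the minimum were larger, the leading part of the uniformizer of K coming from
  the pair (j, k) would be isolated at a valuation that the key property of spans forbids.\<close>

lemma not_isolated:
  assumes lt: "j + k < \<nu> + \<mu>" and less: "val j k < int (H (j + k))"
  defines "c \<equiv> (\<lambda>l. if l \<le> j + k then val j k + 1 else min (val j k + 1) (Lam l))"
  assumes T: "T \<noteq> 0" "vM T = int (n * m) + val j k" "\<not> int p ^ Suc (j + k) dvd int (n * m) + val j k"
    and a0: "a h0 \<noteq> 0"
    and h0: "a h0 * \<pi>L ^ (h0 + n) - T \<in> LM.E.span (\<nu> + \<mu>) c (int (n * m)) (int (n * m)) (int (n * m))"
    and terms: "\<And>h. h \<noteq> h0 \<Longrightarrow> a h \<noteq> 0 \<Longrightarrow> a h * \<pi>L ^ (h + n) \<in> LM.E.span (\<nu> + \<mu>) c (int (n * m)) (int (n * m)) (int (n * m))"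
    and prof: "LM.E.profile (\<nu> + \<mu>) c"
  shows False
proof -
  let ?S = "LM.E.span (\<nu> + \<mu>) c (int (n * m)) (int (n * m)) (int (n * m))"
  \<comment> \<open>The assumption \<open>less\<close> enters here: c lies below the index sequence
    of M/K, so the memberships of p and of \<open>\<pi>K\<close> for the latter hold for c as
    well.\<close>
  have cH: "c l \<le> int (H l)" if "l \<le> \<nu> + \<mu>" for l
  proof (cases "l \<le> j + k")
    case True
    then have "int (H (j + k)) \<le> int (H l)" using lt by (intro LM.E.profile_antimono[OF profH]) auto
    then show ?thesis using True less by (simp add: c_def)
  next
    case False
    then show ?thesis using Lam_le_H[OF that] by (simp add: c_def)
  qed
  have memH: "\<pi>K' \<in> LM.E.span (\<nu> + \<mu>) profH (int (n * m)) (int (n * m)) (int (n * m) + 1)"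
    by (rule LM.E.pure_span_subset_span[OF profH \<pi>K'_mem])
  have "of_nat p \<in> LM.E.span (\<nu> + \<mu>) profH (int eM) (int eM) (int eM + 1)"
    by (rule KM.p_mem_span[OF profH \<pi>K' memH])
  then have P: "of_nat p \<in> LM.E.span (\<nu> + \<mu>) c (int eM) (int eM) (int eM + 1)"
    by (rule LM.E.span_mono) (auto intro: cH)
  have "\<pi>K \<in> LM.E.span (\<nu> + \<mu>) profH (int 1 * int (n * m)) (int 1 * int (n * m)) (int 1 * int (n * m) + 1)"
    using \<pi>K by (intro KM.mem_span[OF profH \<pi>K' memH]) (auto simp: val_ge_def)
  then have \<pi>KS: "\<pi>K \<in> ?S" by (rule LM.E.span_mono) (auto intro: cH)
  have "\<pi>K - T \<in> ?S"
    by (rule \<pi>K_minus_mem[OF prof, where ?h0.0 = h0]) (use a0 h0 terms in auto)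
  then have "\<pi>K - (\<pi>K - T) \<in> ?S" using \<pi>KS by (rule group_closure.diff[rotated])
  then have "T \<in> ?S" by simp
  from LM.E.span_val[OF prof P this T(1)] obtain d where
    d: "d \<le> \<nu> + \<mu>" "int p ^ d dvd int (n * m) + val j k" "c d \<le> val j k"
    unfolding T(2) by auto
  have "d \<le> j + k"
  proof (rule ccontr)
    assume "\<not> d \<le> j + k"
    then have "int p ^ Suc (j + k) dvd int p ^ d" by (intro le_imp_power_dvd) simp
    then show False using d(2) T(3) dvd_trans by blast
  qed
  then show False using d(3) by (simp add: c_def)
qed

text \<open>\<open>nored\<close> ensures that the raised sequence c is a profile at j + k. The
  isolated part T depends on k. For k = \<mu> the second index is 0 and T is the term of
  \<open>\<pi>K\<close> at position \<open>I j\<close>. For k < \<mu>, with \<open>\<pi>L\<close>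
  split as P + Q, T is the binomial term containing \<open>Q ^ (p ^ j)\<close> in the power of
  \<open>\<pi>L\<close> whose digit gives rise to \<open>I j\<close>.\<close>

lemma H_le_val_step:
  assumes sm: "strict_min j k" and lt: "j + k < \<nu> + \<mu>"
    and nored: "val j k + 1 \<le> Lam (Suc (j + k)) + int eM"
  shows "int (H (j + k)) \<le> val j k"
proof (rule ccontr)
  assume "\<not> int (H (j + k)) \<le> val j k"
  then have less: "val j k < int (H (j + k))" by simp
  define A where "A = val j k"
  define c where "c l = (if l \<le> j + k then A + 1 else min (A + 1) (Lam l))" for l
  let ?S = "LM.E.span (\<nu> + \<mu>) c (int (n * m)) (int (n * m)) (int (n * m))"
  have j\<nu>: "j \<le> \<nu>" and k\<mu>: "k \<le> \<mu>" using sm by (auto simp: strict_min_def)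
  have e0: "0 \<le> int eM" by simp
  have prof: "LM.E.profile (\<nu> + \<mu>) c"
    unfolding LM.E.profile_def
  proof (intro conjI allI impI)
    show "c (\<nu> + \<mu>) = 0" using lt prof_Lam val_nonneg[of j k] by (simp add: c_def A_def LM.E.profile_def)
    fix l assume l: "l < \<nu> + \<mu>"
    have "Lam (Suc l) \<le> Lam l" "Lam l \<le> Lam (Suc l) + int eM"
      using prof_Lam l by (auto simp: LM.E.profile_def)
    moreover have "A + 1 \<le> Lam (Suc l) + int eM" if "l = j + k" using nored that by (simp add: A_def)
    ultimately show "c (Suc l) \<le> c l" "c l \<le> c (Suc l) + int eM"
      using e0 by (auto simp: c_def not_le less_Suc_eq_le le_Suc_eq)
  qed
  \<comment> \<open>By strict minimality the other pairs of sum at most j + k exceed A, and larger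
    sums are covered by \<open>Lam\<close>. Only for (j, k) must the weight exceed its lower bound
    by one.\<close>
  have neg: "\<alpha> + k' \<le> \<nu> + \<mu> \<and> int (n * m) + c (\<alpha> + k') \<le> W \<and> int (n * m) \<le> W \<and> (B \<or> int (n * m) \<le> W)"
    if "\<alpha> \<le> \<nu>" "k' \<le> \<mu>" "int (n * m) + val \<alpha> k' \<le> W" "\<alpha> = j \<Longrightarrow> k' = k \<Longrightarrow> int (n * m) + A + 1 \<le> W" for \<alpha> k' W B
  proof -
    have "int (n * m) + c (\<alpha> + k') \<le> W"
    proof (cases "\<alpha> + k' \<le> j + k")
      case True
      show ?thesis
      proof (cases "\<alpha> = j \<and> k' = k")
        case False
        then have "A < val \<alpha> k'" unfolding A_def using that True by (intro strict_minD[OF sm]) auto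
        then show ?thesis using that(3) True by (simp add: c_def)
      qed (use that True in \<open>auto simp: c_def\<close>)
    next
      case False
      then have "c (\<alpha> + k') \<le> Lam (\<alpha> + k')" by (simp add: c_def)
      also have "\<dots> \<le> val \<alpha> k'" using that by (intro Lam_le) auto
      finally show ?thesis using that(3) by simp
    qed
    moreover have "0 \<le> c (\<alpha> + k')" using that by (intro LM.E.profile_nonneg[OF prof]) simp
    ultimately show ?thesis using that by simp
  qed
  have a_mult: "a h * x \<in> ?S" if "x \<in> ?S" for h x
  proof -
    obtain s where "s \<in> M" "a h = s ^ (p ^ (\<nu> + \<mu>))" "val_ge vM 0 s" by (rule a_unit)
    then show ?thesis using LM.E.span_mult_unit_power[OF prof that] by simp
  qed
  have aM: "a h \<in> M" and av: "a h \<noteq> 0 \<Longrightarrow> vM (a h) = 0" for h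
  proof -
    obtain s where s: "s \<in> K" "a h = s ^ (p ^ 0)" "s = 0 \<or> vL s = 0" using a by blast
    then have "s \<in> L" using KL.sub by blast
    then show "a h \<in> M" "a h \<noteq> 0 \<Longrightarrow> vM (a h) = 0"
      using s LM.sub LM.val_ext[of s] by auto
  qed
  note final = not_isolated[OF lt less, folded A_def, folded c_def, OF _ _ _ _ _ _ prof]
  show False
  proof (cases "k = \<mu>")
    case True
    then have jlt: "j < \<nu>" using lt by simp
    have Aeq: "A = int m * int (I j)" by (simp add: A_def val_def True J_top)
    have "Lam (Suc (j + k)) \<le> val (Suc j) \<mu>" using jlt True by (intro Lam_le) auto
    then have "int m * int (I j) + 1 \<le> int m * int (I (Suc j)) + int m * int eL"
      using nored Aeq by (simp add: A_def val_def J_top int_eM)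
    then have "int m * int (I j) < int m * (int (I (Suc j)) + int eL)" by (simp add: algebra_simps)
    then have Ij: "I j < I (Suc j) + eL" using LM.N_pos by (simp add: mult_less_cancel_left flip: of_nat_add)
    then have dig: "a (I j) \<noteq> 0" "\<not> p ^ Suc j dvd I j + n" using I jlt by (auto simp: index_facts_def)
    \<comment> \<open>A level below j would contradict \<open>I_less\<close>, because the index at
      the level of a digit is at most its position.\<close>
    have lev: "level p \<nu> n (I j) = j"
    proof (rule antisym)
      show "level p \<nu> n (I j) \<le> j"
      proof (rule ccontr)
        assume "\<not> level p \<nu> n (I j) \<le> j"
        then have "p ^ Suc j dvd p ^ level p \<nu> n (I j)" by (intro le_imp_power_dvd) simp
        then show False using dig(2) level_dvd[of p \<nu> n "I j"] dvd_trans by blast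
      qed
      show "j \<le> level p \<nu> n (I j)"
      proof (rule ccontr)
        assume "\<not> j \<le> level p \<nu> n (I j)"
        then have "I j < I (level p \<nu> n (I j))" by (intro I_less[OF sm]) simp
        then show False using index_facts_bound[OF I LM.E.prime_p KL.N_pos dig(1) order_refl] by simp
      qed
    qed
    let ?T = "a (I j) * \<pi>L ^ (I j + n)"
    have \<pi>LM: "\<pi>L \<in> M" "vM \<pi>L = int m" using \<pi>L LM.sub LM.val_ext[OF \<pi>L(1,2)] by auto
    have T: "?T \<noteq> 0" "vM ?T = int (n * m) + A"
      using dig(1) av[OF dig(1)] aM[of "I j"] \<pi>L(2) \<pi>LM
      by (auto simp: LM.E.val_mult LM.E.val_power LM.E.mem Aeq algebra_simps)
    show False
    proof (rule final[of ?T "I j"])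
      show "\<not> int p ^ Suc (j + k) dvd int (n * m) + A"
      proof
        assume "int p ^ Suc (j + k) dvd int (n * m) + A"
        also have "int (n * m) + A = int (m * (I j + n))" by (simp add: Aeq algebra_simps)
        finally have "p ^ Suc (j + k) dvd m * (I j + n)" by (metis of_nat_dvd_iff of_nat_power)
        then have "Suc (j + k) \<le> multiplicity p (m * (I j + n))"
          using LM.N_pos KL.N_pos LM.E.prime_p by (subst (asm) prime_power_dvd_iff) auto
        also have "\<dots> = \<mu> + multiplicity p (I j + n)"
          using LM.N_pos KL.N_pos LM.E.prime_p by (simp add: \<mu> prime_elem_multiplicity_mult_distrib)
        also have "multiplicity p (I j + n) \<le> j"
          using dig(2) LM.E.prime_p KL.N_pos by (simp add: prime_power_dvd_iff del: power_Suc)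
        finally show False using True by simp
      qed
      fix h assume h: "h \<noteq> I j" "a h \<noteq> 0"
      let ?l = "level p \<nu> n h"
      obtain u where u: "h + n = p ^ ?l * u" using level_dvd by (metis dvdE)
      then have "0 < u" using KL.N_pos by (cases u) auto
      then have y: "\<pi>L ^ u \<in> LM.E.pure_span \<mu> profJ 0 (int u * int m) (int u * int m)"
        using LM.E.pure_span_power[OF profJ \<pi>L_mem] by simp
      have pu: "int p ^ ?l * (int u * int m) = int m * int (h + n)" unfolding u by simp
      have "of_nat p ^ 0 * (\<pi>L ^ u) ^ (p ^ ?l) \<in> ?S"
      proof (rule LM.E.pure_span_prime_power[OF profJ y], unfold pu)
        fix \<alpha> k' W
        assume *: "\<alpha> \<le> ?l" "k' \<le> \<mu>"
          "int m * int (h + n) + int p ^ \<alpha> * int (J k') + int (0 + (?l - \<alpha>)) * int eM \<le> W"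
        have W: "int (n * m) + val \<alpha> k' \<le> W" using val_le_weight[OF h(2) *(1)] *(3) by simp
        show "\<alpha> + k' \<le> \<nu> + \<mu> \<and> int (n * m) + c (\<alpha> + k') \<le> W \<and> int (n * m) \<le> W \<and> (0 + (?l - \<alpha>) = 0 \<or> int (n * m) \<le> W)"
        proof (rule neg[OF _ *(2) W])
          show "\<alpha> \<le> \<nu>" using *(1) level_le[of p \<nu> n h] by linarith
          assume jk: "\<alpha> = j" "k' = k"
          have "I j < h + (?l - j) * eL"
          proof (cases "?l = j")
            case True
            then have "I j \<le> h" using index_facts_bound[OF I LM.E.prime_p KL.N_pos h(2), of j] by simp
            then show ?thesis using h(1) True by simp
          next
            case False
            then have l: "Suc j \<le> ?l" using * jk by simp
            then have "I (Suc j) \<le> h + (?l - Suc j) * eL"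
              by (rule index_facts_bound[OF I LM.E.prime_p KL.N_pos h(2)])
            moreover have "?l - j = Suc (?l - Suc j)" using l by simp
            ultimately show ?thesis using Ij by simp
          qed
          then have "int (I j) + 1 \<le> int h + int (?l - j) * int eL" by (simp flip: of_nat_mult of_nat_add)
          then have "int m * (int (I j) + 1) \<le> int m * (int h + int (?l - j) * int eL)" by (intro mult_left_mono) auto
          moreover have "1 \<le> int m" using LM.N_pos by simp
          ultimately have "int m * int (I j) + 1 \<le> int m * int h + int (?l - j) * (int m * int eL)"
            unfolding distrib_left by (simp add: mult_ac)
          then show "int (n * m) + A + 1 \<le> W"
            using *(3) unfolding jk int_eM Aeq True J_top by (simp add: algebra_simps)
        qed
      qed
      then have "\<pi>L ^ (h + n) \<in> ?S" by (simp add: u mult.commute flip: power_mult)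
      then show "a h * \<pi>L ^ (h + n) \<in> ?S" by (rule a_mult)
    qed (use T dig(1) in auto)
  next
    case False
    then have klt: "k < \<mu>" using k\<mu> by simp
    \<comment> \<open>If \<open>J k\<close> came from the next index plus eM, then for j > 0 the
      pair (j - 1, k + 1) would have the same sum and no larger value, and for j = 0 the pair (0, k
      + 1) would contradict \<open>nored\<close>.\<close>
    have Jk: "J k < J (Suc k) + eM"
    proof (rule ccontr)
      assume "\<not> ?thesis"
      then have Jeq: "J k = J (Suc k) + eM" using J_le[OF klt] by simp
      show False
      proof (cases j)
        case 0
        have "Lam (Suc (j + k)) \<le> val 0 (Suc k)" using 0 klt by (intro Lam_le) auto
        then show False using nored 0 Jeq by (simp add: val_def)
      next
        case (Suc i)
        have "int (I i) \<le> int (I j) + int eL" using I_le[of i] Suc j\<nu> by simp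
        then have "int m * int (I i) \<le> int m * (int (I j) + int eL)" by (intro mult_left_mono) auto
        moreover have "int p ^ i * int (J (Suc k)) \<le> int p ^ j * int (J (Suc k))"
          using Suc by (intro mult_right_mono power_increasing) (auto simp: Suc_le_eq)
        moreover have "1 * int eM \<le> int p ^ j * int eM" by (intro mult_right_mono) (auto simp: Suc_le_eq)
        ultimately have "val i (Suc k) \<le> val j k" using int_eM unfolding val_def Jeq of_nat_add distrib_left by linarith
        moreover have "val j k < val i (Suc k)" using Suc klt j\<nu> by (intro strict_minD[OF sm]) auto
        ultimately show False by simp
      qed
    qed
    have ndvd: "\<not> p ^ Suc k dvd J k + m" using J klt Jk by (auto simp: index_facts_def)
    obtain P Q where split: "\<pi>L = P + Q" and P: "P \<in> LM.E.pure_span \<mu> profJ (Suc k) (int m) (int m)"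
      and Q: "Q \<in> LM.E.pure_span \<mu> profJ 0 (int m) (int m + int (J k))"
      and P0: "P \<noteq> 0" "vM P = int m" and Q0: "Q \<noteq> 0" "vM Q = int m + int (J k)"
      by (rule \<pi>L_split[OF klt Jk])
    have PM: "P \<in> M" and QM: "Q \<in> M" using P Q LM.E.pure_span_mem by auto
    have P': "P \<in> LM.E.pure_span \<mu> profJ 0 (int m) (int m)" using P by (rule LM.E.pure_span_mono) auto
    have eL0: "0 < eL" using KL.E.e_pos .
    \<comment> \<open>The digit that produces \<open>I j\<close>, possibly of higher level and
      lowered to j at cost eL a step; position \<open>I j\<close> itself need not carry a
      digit.\<close>
    obtain h0 where h0: "a h0 \<noteq> 0" "I j = h0 + (max j (level p \<nu> n h0) - j) * eL"
      using index_facts_attained[OF I LM.E.prime_p KL.N_pos eL0 j\<nu>] by blast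
    let ?lv = "level p \<nu> n h0"
    have jl0: "j \<le> ?lv"
    proof (rule ccontr)
      assume "\<not> j \<le> ?lv"
      then have "I j < I ?lv" by (intro I_less[OF sm]) simp
      moreover have "I ?lv \<le> h0" using index_facts_bound[OF I LM.E.prime_p KL.N_pos h0(1) order_refl] by simp
      ultimately show False using h0(2) by simp
    qed
    then have Ij: "I j = h0 + (?lv - j) * eL" using h0(2) by (simp add: max_absorb2)
    \<comment> \<open>The cap in \<open>level\<close> is not in effect at h0: at level \<nu>,
      comparison with the digit at 0, also of level \<nu>, forces h0 = 0, and n has exactly \<nu>
      factors p.\<close>
    have mult0: "multiplicity p (h0 + n) = ?lv"
    proof (rule ccontr)
      assume ne: "multiplicity p (h0 + n) \<noteq> ?lv"
      then have l0: "?lv = \<nu>" by (simp add: level_def min_def split: if_splits)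
      have "I j \<le> 0 + (level p \<nu> n 0 - j) * eL"
        using I j\<nu> by (intro index_facts_bound[OF I LM.E.prime_p KL.N_pos]) (auto simp: index_facts_def level_def \<nu>)
      then have "h0 = 0" using Ij l0 by (simp add: level_def \<nu>)
      then show False using ne l0 \<nu> by simp
    qed
    have p\<nu>_eL: "p ^ \<nu> dvd eL" using KL.e_mult multiplicity_dvd[of p n] by (simp add: \<nu>)
    \<comment> \<open>As \<open>p ^ \<nu>\<close> divides eL, a second digit attaining
      \<open>I j\<close> would have the same level as h0, hence the same position.\<close>
    have uniq: "I j < h + (level p \<nu> n h - j) * eL" if h: "h \<noteq> h0" "a h \<noteq> 0" "j \<le> level p \<nu> n h" for h
    proof (rule ccontr)
      let ?l = "level p \<nu> n h"
      assume "\<not> ?thesis"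
      then have eq: "h + (?l - j) * eL = h0 + (?lv - j) * eL"
        using index_facts_bound[OF I LM.E.prime_p KL.N_pos h(2,3)] Ij by linarith
      have key: "l' \<le> level p \<nu> n h1" if "l' = level p \<nu> n h2" "h1 + x * eL = h2 + y * eL" for l' h1 h2 x y
      proof (rule le_level[OF LM.E.prime_p KL.N_pos])
        show "l' \<le> \<nu>" using that by simp
        then have "p ^ l' dvd eL" by (rule dvd_trans[OF le_imp_power_dvd p\<nu>_eL])
        moreover have "p ^ l' dvd h2 + n" using that level_dvd by simp
        ultimately have "p ^ l' dvd (h2 + n) + y * eL" by (rule_tac dvd_add) auto
        also have "(h2 + n) + y * eL = (h1 + n) + x * eL" using that(2) by simp
        finally show "p ^ l' dvd h1 + n" using \<open>p ^ l' dvd eL\<close> by (simp add: dvd_add_left_iff)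
      qed
      have "?l = ?lv" using key[OF refl eq] key[OF refl eq[symmetric]] by linarith
      then show False using eq h(1) by simp
    qed
    have mI: "int m * int (I j) + 1 \<le> int m * int h + int (level p \<nu> n h - j) * int eM"
      if "h \<noteq> h0" "a h \<noteq> 0" "j \<le> level p \<nu> n h" for h
    proof -
      have "int (I j) + 1 \<le> int h + int (level p \<nu> n h - j) * int eL"
        using uniq[OF that] by (simp flip: of_nat_mult of_nat_add)
      then have "int m * (int (I j) + 1) \<le> int m * (int h + int (level p \<nu> n h - j) * int eL)"
        by (intro mult_left_mono) auto
      moreover have "1 \<le> int m" using LM.N_pos by simp
      ultimately show ?thesis unfolding distrib_left int_eM by (simp add: mult_ac)
    qed
    \<comment> \<open>Only generators for the pair (j, k) could violate the bounds. For i > 0 they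
      require that \<open>p ^ j\<close> divides i, and Q contributes i * \<open>J k\<close>: this
      exceeds the share in A if i > \<open>p ^ j\<close>, while for i = \<open>p ^ j\<close> and h
      different from h0 the extra unit comes from \<open>uniq\<close>.\<close>
    have summand: "of_nat (h + n choose i) * Q ^ i * P ^ (h + n - i) \<in> ?S"
      if h: "a h \<noteq> 0" and i: "i \<le> h + n" "i \<noteq> p ^ j \<or> h \<noteq> h0" for h i
    proof (cases "i = 0")
      \<comment> \<open>A pure power of P has only inner exponents above k, so the pair (j, k) does
        not occur.\<close>
      case True
      let ?l = "level p \<nu> n h"
      obtain u where u: "h + n = p ^ ?l * u" using level_dvd by (metis dvdE)
      have y: "P ^ u \<in> LM.E.pure_span \<mu> profJ (Suc k) (int u * int m) (int u * int m)"
        using LM.E.pure_span_power'[OF profJ P] klt by simp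
      have pu: "int p ^ ?l * (int u * int m) = int m * int (h + n)" unfolding u by simp
      have "of_nat p ^ 0 * (P ^ u) ^ (p ^ ?l) \<in> ?S"
      proof (rule LM.E.pure_span_prime_power[OF profJ y], unfold pu)
        fix \<alpha> k' W
        assume *: "\<alpha> \<le> ?l" "Suc k \<le> k'" "k' \<le> \<mu>"
          "int m * int (h + n) + int p ^ \<alpha> * int (J k') + int (0 + (?l - \<alpha>)) * int eM \<le> W"
        have W: "int (n * m) + val \<alpha> k' \<le> W" using val_le_weight[OF h *(1)] *(4) by simp
        show "\<alpha> + k' \<le> \<nu> + \<mu> \<and> int (n * m) + c (\<alpha> + k') \<le> W \<and> int (n * m) \<le> W \<and> (0 + (?l - \<alpha>) = 0 \<or> int (n * m) \<le> W)"
          using *(2) by (intro neg[OF order_trans[OF *(1) level_le] *(3) W]) auto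
      qed
      then show ?thesis using True by (simp add: u mult.commute flip: power_mult)
    next
      case False
      let ?l = "level p \<nu> n h"
      \<comment> \<open>The exponent that h + n and i have in common; what is missing to the level
        of h comes as factors p of the binomial coefficient.\<close>
      define i' where "i' = min ?l (multiplicity p i)"
      have d1: "p ^ i' dvd i" unfolding i'_def by (rule multiplicity_dvd') simp
      have "p ^ i' dvd p ^ ?l" unfolding i'_def by (intro le_imp_power_dvd) simp
      then have d2: "p ^ i' dvd h + n" using level_dvd dvd_trans by blast
      then have "p ^ i' dvd h + n - i" using d1 by (rule dvd_diff_nat)
      then obtain x where x: "h + n - i = p ^ i' * x" by (elim dvdE)
      obtain u where u: "i = p ^ i' * u" using d1 by (elim dvdE)
      have "p ^ (?l - i') dvd (h + n choose i)"
      proof (cases "?l \<le> multiplicity p i")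
        case False
        then have "i' = multiplicity p i" by (simp add: i'_def)
        then have "\<not> p ^ Suc i' dvd i" using LM.E.prime_p \<open>i \<noteq> 0\<close> by (simp add: prime_power_dvd_iff del: power_Suc)
        then show ?thesis using level_dvd[of p \<nu> n h] LM.E.prime_p by (intro power_dvd_choose) (auto simp: i'_def)
      qed (simp add: i'_def)
      then obtain q where q: "(h + n choose i) = p ^ (?l - i') * q" by (elim dvdE)
      define y where "y = Q ^ u * P ^ x"
      have ux: "int p ^ i' * int u = int i" "int p ^ i' * int x = int (h + n) - int i"
        using arg_cong[OF u, of int] arg_cong[OF x, of int] i(1) by (simp_all add: of_nat_diff)
      define r where "r = int u * int m + int x * int m"
      define t where "t = int u * (int m + int (J k)) + int x * int m"
      have yS: "y \<in> LM.E.pure_span \<mu> profJ 0 r t"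
        unfolding y_def r_def t_def
        by (intro LM.E.pure_span_mult[OF profJ] LM.E.pure_span_power'[OF profJ] Q P') auto
      have pr: "int p ^ i' * r = int m * int (h + n)"
      proof -
        have "int p ^ i' * r = (int p ^ i' * int u) * int m + (int p ^ i' * int x) * int m"
          by (simp add: r_def algebra_simps)
        then show ?thesis unfolding ux by (simp add: algebra_simps)
      qed
      have pt: "int p ^ i' * t = int m * int (h + n) + int i * int (J k)"
      proof -
        have "int p ^ i' * t = (int p ^ i' * int u) * (int m + int (J k)) + (int p ^ i' * int x) * int m"
          by (simp add: t_def algebra_simps)
        then show ?thesis unfolding ux by (simp add: algebra_simps)
      qed
      have "of_nat p ^ (?l - i') * y ^ (p ^ i') \<in> ?S"
      proof (rule LM.E.pure_span_prime_power[OF profJ yS], unfold pr pt)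
        fix \<alpha> k' W
        assume *: "\<alpha> \<le> i'" "k' \<le> \<mu>"
          "int m * int (h + n) + int p ^ \<alpha> * int (J k') + int (?l - i' + (i' - \<alpha>)) * int eM \<le> W"
          "int m * int (h + n) + int i * int (J k) + int (?l - i' + (i' - \<alpha>)) * int eM \<le> W"
        have i'l: "i' \<le> ?l" by (simp add: i'_def)
        have l\<alpha>: "?l - i' + (i' - \<alpha>) = ?l - \<alpha>" "\<alpha> \<le> ?l" using *(1) i'l by auto
        have W: "int (n * m) + val \<alpha> k' \<le> W" using val_le_weight[OF h l\<alpha>(2) *(3)[unfolded l\<alpha>(1)]] .
        show "\<alpha> + k' \<le> \<nu> + \<mu> \<and> int (n * m) + c (\<alpha> + k') \<le> W \<and> int (n * m) \<le> W \<and>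
            (?l - i' + (i' - \<alpha>) = 0 \<or> int (n * m) \<le> W)"
        proof (rule neg[OF _ *(2) W])
          show "\<alpha> \<le> \<nu>" using l\<alpha>(2) level_le[of p \<nu> n h] by linarith
          assume jk: "\<alpha> = j" "k' = k"
          have jl: "j \<le> ?l" using l\<alpha> jk by simp
          have W2: "int m * int (h + n) + int i * int (J k) + int (?l - j) * int eM \<le> W"
            using *(4)[unfolded l\<alpha>(1)] unfolding jk .
          have "p ^ j dvd p ^ i'" using *(1) jk by (intro le_imp_power_dvd) simp
          then have "p ^ j dvd i" using d1 dvd_trans by blast
          then have pj: "p ^ j \<le> i" using False by (intro dvd_imp_le) auto
          then have pjJ: "int p ^ j * int (J k) \<le> int i * int (J k)"
            by (intro mult_right_mono) (auto simp flip: of_nat_power)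
          show "int (n * m) + A + 1 \<le> W"
          proof (cases "i = p ^ j")
            case True
            then have "h \<noteq> h0" using i(2) by simp
            from mI[OF this h jl] pjJ W2 show ?thesis unfolding A_def val_def by (simp add: algebra_simps)
          next
            case False
            then have "int p ^ j + 1 \<le> int i" using pj by (simp flip: of_nat_power)
            then have "(int p ^ j + 1) * int (J k) \<le> int i * int (J k)" by (intro mult_right_mono) auto
            moreover have "1 \<le> int (J k)" using J_pos[OF klt] by simp
            moreover have "int (n * m) + int m * int (I j) \<le> int m * int (h + n) + int (?l - j) * int eM"
              using val_le_weight[OF h jl order_refl, of \<mu>] by (simp add: val_def J_top)
            ultimately show ?thesis using W2 unfolding A_def val_def distrib_right by linarith
          qed
        qed
      qed
      then have "of_nat q * (of_nat p ^ (?l - i') * y ^ (p ^ i')) \<in> ?S" by (rule group_closure_scalar_mult_left)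
      moreover have "y ^ (p ^ i') = Q ^ i * P ^ (h + n - i)"
        unfolding y_def x u[symmetric] power_mult_distrib
        by (simp add: mult.commute flip: power_mult) (metis mult.commute u)
      ultimately show ?thesis by (simp add: q mult_ac)
    qed
    let ?T = "a h0 * (of_nat (h0 + n choose p ^ j) * Q ^ (p ^ j) * P ^ (h0 + n - p ^ j))"
    have "p ^ j dvd p ^ ?lv" using jl0 by (intro le_imp_power_dvd)
    then have pjd: "p ^ j dvd h0 + n" using level_dvd dvd_trans by blast
    then obtain N' where N': "h0 + n = p ^ j * N'" by (elim dvdE)
    have N'0: "0 < N'" using N' KL.N_pos by (cases N') auto
    have pjle: "p ^ j \<le> h0 + n" using pjd KL.N_pos by (intro dvd_imp_le) auto
    \<comment> \<open>With \<open>mult0\<close> the binomial coefficient has exactly the level - j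
      factors p that are accounted for in \<open>Ij\<close>, so the valuation of T is exact.\<close>
    have "multiplicity p (h0 + n choose p ^ j) = multiplicity p N'"
      unfolding N' using N'0 LM.E.prime_p by (rule const_p_fac)
    moreover have "?lv = j + multiplicity p N'"
      unfolding mult0[symmetric] N' using N'0 LM.E.prime_p by (simp add: prime_elem_multiplicity_mult_distrib)
    ultimately have multC: "multiplicity p (h0 + n choose p ^ j) = ?lv - j" by simp
    \<comment> \<open>In characteristic p every index is below eL, so no level was lowered to obtain
      \<open>I j\<close> and the coefficient does not vanish.\<close>
    have char: "?lv - j = 0 \<or> of_nat p \<noteq> (0::'a)"
    proof (rule ccontr)
      assume "\<not> ?thesis"
      then have "I 0 < eL" "1 \<le> ?lv - j" using char_p by auto
      moreover have "I j \<le> I 0" using KL.E.profile_antimono[OF profI, of 0 j] j\<nu> by simp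
      moreover have "1 * eL \<le> (?lv - j) * eL" using calculation(2) by (intro mult_right_mono) auto
      ultimately show False using Ij by linarith
    qed
    have C: "of_nat (h0 + n choose p ^ j) \<noteq> (0::'a)" "vM (of_nat (h0 + n choose p ^ j)) = int (?lv - j) * int eM"
      using LM.E.val_of_nat[OF _ multC char] pjle by auto
    have T0: "?T \<noteq> 0" using C h0(1) P0(1) Q0(1) by simp
    have Tv: "vM ?T = int (n * m) + A"
    proof -
      have "vM ?T = int (?lv - j) * int eM + int (p ^ j) * (int m + int (J k)) + int (h0 + n - p ^ j) * int m"
        using C h0(1) av[OF h0(1)] aM[of h0] P0 Q0 PM QM by (simp add: LM.E.val_mult LM.E.val_power LM.E.mem)
      also have "int (h0 + n - p ^ j) = int (h0 + n) - int (p ^ j)" using pjle by (rule of_nat_diff)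
      also have "int (?lv - j) * int eM + int (p ^ j) * (int m + int (J k)) + (int (h0 + n) - int (p ^ j)) * int m
          = int (n * m) + (int m * (int h0 + int (?lv - j) * int eL) + int p ^ j * int (J k))"
        unfolding int_eM by (simp add: algebra_simps)
      also have "int h0 + int (?lv - j) * int eL = int (I j)" unfolding Ij by simp
      finally show ?thesis unfolding A_def val_def .
    qed
    have full: "a h * \<pi>L ^ (h + n) = (\<Sum>i\<le>h + n. a h * (of_nat (h + n choose i) * Q ^ i * P ^ (h + n - i)))" for h
    proof -
      have "\<pi>L ^ (h + n) = (\<Sum>i\<le>h + n. of_nat (h + n choose i) * Q ^ i * P ^ (h + n - i))"
        unfolding split add.commute[of P Q] by (rule binomial_ring)
      then show ?thesis by (simp only: sum_distrib_left)
    qed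
    show False
    proof (rule final[of ?T h0])
      show "\<not> int p ^ Suc (j + k) dvd int (n * m) + A"
      proof
        \<comment> \<open>n * m + A is m * (n + \<open>I j\<close>) plus \<open>p ^ j\<close> *
          \<open>J k\<close>. The first part is divisible by \<open>p ^ Suc (j + k)\<close>, but
          \<open>J k\<close> is not divisible by \<open>p ^ Suc k\<close>.\<close>
        assume dvd: "int p ^ Suc (j + k) dvd int (n * m) + A"
        have "p ^ j dvd eL" using j\<nu> by (rule dvd_trans[OF le_imp_power_dvd p\<nu>_eL])
        then have "p ^ j dvd (h0 + n) + (?lv - j) * eL" using pjd by (rule_tac dvd_add) auto
        then have "p ^ j dvd n + I j" using Ij by (simp add: add_ac)
        moreover have "p ^ Suc k dvd m" using klt by (intro multiplicity_dvd') (simp add: \<mu>)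
        ultimately have "p ^ Suc k * p ^ j dvd m * (n + I j)" by (intro mult_dvd_mono)
        then have "p ^ Suc (j + k) dvd m * (n + I j)" by (simp add: power_add mult_ac)
        then have "int (p ^ Suc (j + k)) dvd int (m * (n + I j))" by (simp only: of_nat_dvd_iff)
        then have "int p ^ Suc (j + k) dvd int m * (int n + int (I j))" by simp
        then have "int p ^ Suc (j + k) dvd (int (n * m) + A) - int m * (int n + int (I j))" using dvd by (intro dvd_diff)
        also have "(int (n * m) + A) - int m * (int n + int (I j)) = int p ^ j * int (J k)"
          by (simp add: A_def val_def algebra_simps)
        finally have "int p ^ j * int p ^ Suc k dvd int p ^ j * int (J k)" by (simp add: power_add)
        then have "int (p ^ Suc k) dvd int (J k)" by simp
        then have "p ^ Suc k dvd J k" by (simp only: of_nat_dvd_iff)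
        then show False using ndvd \<open>p ^ Suc k dvd m\<close> by (simp del: power_Suc)
      qed
      have "a h0 * \<pi>L ^ (h0 + n) - ?T
          = (\<Sum>i\<in>{..h0 + n} - {p ^ j}. a h0 * (of_nat (h0 + n choose i) * Q ^ i * P ^ (h0 + n - i)))"
        unfolding full using pjle by (subst sum.remove[of "{..h0 + n}" "p ^ j"]) auto
      also have "\<dots> \<in> ?S" using summand[OF h0(1)] by (intro group_closure_sum_mem a_mult) auto
      finally show "a h0 * \<pi>L ^ (h0 + n) - ?T \<in> ?S" .
      fix h assume "h \<noteq> h0" "a h \<noteq> 0"
      then show "a h * \<pi>L ^ (h + n) \<in> ?S"
        unfolding full using summand by (intro group_closure_sum_mem a_mult) auto
    qed (use T0 Tv h0(1) in auto)
  qed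
qed

text \<open>Where \<open>H_le_val_step\<close> does not apply, the value at (j, k) is at least eM
  above the minimum for the next sum. The pair attaining that minimum is again a strict minimum, and
  \<open>H\<close> drops by at most eM from one place to the next.\<close>

theorem H_le_val:
  assumes "strict_min j k"
  shows "int (H (j + k)) \<le> val j k"
  using assms
proof (induction "\<nu> + \<mu> - (j + k)" arbitrary: j k rule: less_induct)
  case less
  have jk: "j \<le> \<nu>" "k \<le> \<mu>" using less.prems by (auto simp: strict_min_def)
  show ?case
  proof (cases "j + k = \<nu> + \<mu>")
    case True
    then show ?thesis using H_top val_nonneg by simp
  next
    case False
    then have lt: "j + k < \<nu> + \<mu>" using jk by simp
    show ?thesis
    proof (cases "val j k + 1 \<le> Lam (Suc (j + k)) + int eM")
      case True
      then show ?thesis by (rule H_le_val_step[OF less.prems lt])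
    next
      case False
      have e0: "0 < int eM" using LM.E.e_pos by simp
      \<comment> \<open>Undoing \<open>val_pred\<close> from such a low pair must lead to (j, k) by
        strict minimality, so only (j + 1, k) and, for j = 0, (0, k + 1) remain.\<close>
      have low: "val x y = val j k - int eM \<and> x + y = Suc (j + k) \<and> (x = Suc j \<and> y = k \<or> x = 0 \<and> j = 0 \<and> y = Suc k)"
        if xy: "x \<le> \<nu>" "y \<le> \<mu>" "x + y \<le> Suc (j + k)" "val x y \<le> val j k - int eM" for x y
      proof -
        have s: "x + y = Suc (j + k)"
        proof (rule ccontr)
          assume "x + y \<noteq> Suc (j + k)"
          then have "val j k \<le> val x y" using strict_minD[OF less.prems xy(1,2)] xy(3) by fastforce
          then show False using xy(4) e0 by simp
        qed
        then have "0 < x + y" by simp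
        from val_pred[OF xy(1,2) this] obtain x' y' where
          *: "x' \<le> \<nu>" "y' \<le> \<mu>" "Suc (x' + y') = x + y" "val x' y' \<le> val x y + int eM"
          "x = Suc x' \<and> y = y' \<or> x = 0 \<and> x' = 0 \<and> y = Suc y'" by blast
        have "x' = j \<and> y' = k"
        proof (rule ccontr)
          assume "\<not> (x' = j \<and> y' = k)"
          then have "val j k < val x' y'" using * s by (intro strict_minD[OF less.prems]) auto
          then show False using *(4) xy(4) by simp
        qed
        then show ?thesis using * s xy(4) by auto
      qed
      \<comment> \<open>For k < \<mu> raising j strictly increases the second summand, since
        \<open>J k\<close> is positive, so the value cannot fall by all of eM. Thus (j + 1, k) needs
        k = \<mu>, where k + 1 is not admissible, and the two candidates exclude each other.\<close>
      have notboth: "k = \<mu>" if "Suc j \<le> \<nu>" "val (Suc j) k \<le> val j k - int eM"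
      proof (rule ccontr)
        assume "k \<noteq> \<mu>"
        then have "0 < int (J k)" using J_pos[of k] jk by simp
        moreover have "int p ^ j < int p ^ Suc j" using LM.E.prime_p by (intro power_strict_increasing) (auto dest: prime_gt_1_nat)
        ultimately have "int p ^ j * int (J k) < int p ^ Suc j * int (J k)" by (intro mult_strict_right_mono)
        moreover have "int (I j) \<le> int (I (Suc j)) + int eL" using I_le[of j] that(1) by simp
        then have "int m * int (I j) \<le> int m * (int (I (Suc j)) + int eL)" by (intro mult_left_mono) auto
        ultimately show False using that(2) unfolding val_def int_eM distrib_left by linarith
      qed
      obtain x y where xy: "x \<le> \<nu>" "y \<le> \<mu>" "x + y \<le> Suc (j + k)" "Lam (Suc (j + k)) = val x y"
        by (rule Lam_attained)
      have v: "val x y \<le> val j k - int eM" using False xy(4) by simp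
      note l = low[OF xy(1-3) v]
      have "strict_min x y"
        unfolding strict_min_def
      proof (intro conjI allI impI)
        fix x' y' assume *: "x' \<le> \<nu>" "y' \<le> \<mu>" "x' + y' \<le> x + y" "(x', y') \<noteq> (x, y)"
        show "val x y < val x' y'"
        proof (rule ccontr)
          assume "\<not> val x y < val x' y'"
          then have v': "val x' y' \<le> val j k - int eM" using v by simp
          have "x' + y' \<le> Suc (j + k)" using * xy(3) by simp
          from low[OF *(1,2) this v'] l *(4) have
            "x = Suc j \<and> y = k \<and> y' = Suc k \<or> x' = Suc j \<and> y' = k \<and> y = Suc k" by auto
          then have "k = \<mu> \<and> (y' = Suc k \<or> y = Suc k)" using notboth v v' xy(1) *(1) by auto
          then show False using xy(2) *(2) by auto
        qed
      qed (use xy in auto)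
      then have "int (H (x + y)) \<le> val x y" using l lt by (intro less.hyps) auto
      moreover have "H (j + k) \<le> H (Suc (j + k)) + eM" using H lt by (simp add: index_facts_def)
      ultimately show ?thesis using l by simp
    qed
  qed
qed

section \<open>From integer values to the functions of x\<close>

abbreviation lam :: "nat \<Rightarrow> real \<Rightarrow> real" where
  "lam l x \<equiv> lambdaMK p I J m \<nu> \<mu> l x"

definition term_at :: "nat \<Rightarrow> nat \<Rightarrow> real \<Rightarrow> real" where
  "term_at j k x = real_of_int (val j k) + real p ^ (j + k) * x"

lemma phitm_phit: "phitm p I m j (phit p J k x) = term_at j k x"
  using LM.N_pos by (simp add: phitm_def phit_def term_at_def val_def field_simps power_add)

lemma finite_Omega: "finite (Omega \<nu> \<mu> l)"
  by (rule finite_subset[of _ "{..\<nu>} \<times> {..\<mu>}"]) (auto simp: Omega_def)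

text \<open>A pair of smaller sum is dominated coordinatewise by one in \<open>Omega\<close>, and
  the two functions \<open>phi\<close> at the latter are minima that include the former.\<close>

lemma lam_le:
  assumes "j \<le> \<nu>" "k \<le> \<mu>" "j + k \<le> l" "l \<le> \<nu> + \<mu>"
  shows "lam l x \<le> term_at j k x"
proof -
  define j1 where "j1 = min \<nu> (l - k)"
  define k1 where "k1 = l - j1"
  have jk1: "(j1, k1) \<in> Omega \<nu> \<mu> l" "j \<le> j1" "k \<le> k1"
    using assms by (auto simp: Omega_def j1_def k1_def)
  have "lam l x \<le> phim p I m j1 (phi p J k1 x)"
    unfolding lambdaMK_def using jk1(1) finite_Omega[of l] by (intro Min_le) force+
  also have "\<dots> \<le> real m * phit p I j (phi p J k1 x / real m)"
    unfolding phim_def using jk1(2) by (intro mult_left_mono phi_le) auto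
  also have "\<dots> = real m * real (I j) + real p ^ j * phi p J k1 x"
    using LM.N_pos by (simp add: phit_def algebra_simps)
  also have "\<dots> \<le> real m * real (I j) + real p ^ j * phit p J k x"
    using jk1(3) by (intro add_left_mono mult_left_mono phi_le) auto
  also have "\<dots> = term_at j k x" by (simp add: phit_def term_at_def val_def algebra_simps power_add)
  finally show ?thesis .
qed

lemma lam_le_phi:
  assumes l: "l \<le> \<nu> + \<mu>" and x: "0 \<le> x"
  shows "lam l x \<le> phi p H l x"
proof -
  obtain l1 where l1: "l1 \<le> l" "phi p H l x = phit p H l1 x" by (rule phi_attained)
  obtain j k where jk: "j \<le> \<nu>" "k \<le> \<mu>" "j + k \<le> l1" "Lam l1 = val j k" by (rule Lam_attained)
  have "real p ^ (j + k) * x \<le> real p ^ l1 * x"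
    using jk(3) x by (intro mult_right_mono power_increasing) (auto simp: Suc_le_eq)
  moreover have "val j k \<le> int (H l1)" using Lam_le_H[of l1] l1 l jk by simp
  then have "real_of_int (val j k) \<le> real (H l1)" by linarith
  ultimately have "term_at j k x \<le> phit p H l1 x" by (simp add: term_at_def phit_def)
  then show ?thesis using lam_le[of j k l x] jk l1 l by simp
qed

lemma phi_le_lam:
  assumes "strict_min j k" "j + k \<le> l" "term_at j k x = lam l x"
  shows "phi p H l x \<le> lam l x"
proof -
  have "phi p H l x \<le> phit p H (j + k) x" using assms(2) by (rule phi_le)
  moreover have "real (H (j + k)) \<le> real_of_int (val j k)" using H_le_val[OF assms(1)] by linarith
  ultimately show ?thesis using assms(3) by (simp add: phit_def term_at_def)
qed

text \<open>At x = 0 the unique minimal pair need not have the least sum, but then the minimal pair of least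
  sum is unique as well.\<close>

lemma unique_least_zero:
  assumes l: "l \<le> \<nu> + \<mu>" and l0: "l0 \<le> l"
    and uniq: "\<And>j k j' k'. j \<le> \<nu> \<Longrightarrow> k \<le> \<mu> \<Longrightarrow> j' \<le> \<nu> \<Longrightarrow> k' \<le> \<mu> \<Longrightarrow> j + k = l0 \<Longrightarrow> j' + k' = l0 \<Longrightarrow>
       term_at j k 0 = lam l 0 \<Longrightarrow> term_at j' k' 0 = lam l 0 \<Longrightarrow> j = j'"
    and 1: "j1 \<le> \<nu>" "k1 \<le> \<mu>" "term_at j1 k1 0 = lam l 0"
    and 2: "j2 \<le> \<nu>" "k2 \<le> \<mu>" "term_at j2 k2 0 = lam l 0"
    and sum: "j1 + k1 = j2 + k2" "j1 + k1 \<le> l0"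
  shows "\<not> j1 < j2"
proof
  assume lt: "j1 < j2"
  \<comment> \<open>Both pairs are moved in the second coordinate to the sum l0. At x = 0 this
    cannot increase their values, so they remain minimal, and uniqueness at l0 applies.\<close>
  define d where "d = l0 - (j1 + k1)"
  have t: "term_at j k 0 = real_of_int (val j k)" for j k by (simp add: term_at_def)
  have low: "lam l 0 \<le> real_of_int (val j k)" if "j \<le> \<nu>" "k \<le> \<mu>" "j + k \<le> l" for j k
    using lam_le[OF that l, of 0] by (simp add: t)
  have Jmono: "J k' \<le> J k" if "k \<le> k'" "k' \<le> \<mu>" for k k'
    using LM.E.profile_antimono[OF profJ that] by simp
  have valJ: "val j k' \<le> val j k" if "k \<le> k'" "k' \<le> \<mu>" for j k k'
    using Jmono[OF that] by (simp add: val_def mult_left_mono)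
  have k2: "k2 < \<mu>" using lt sum(1) 1(2) by simp
  have strict: "val j2 \<mu> < val j2 k2"
  proof -
    have "0 < int p ^ j2 * int (J k2)" using J_pos[OF k2] by (intro mult_pos_pos) auto
    then show ?thesis by (simp add: val_def J_top)
  qed
  have v1: "real_of_int (val j1 k1) = lam l 0" and v2: "real_of_int (val j2 k2) = lam l 0" using 1 2 by (auto simp: t)
  \<comment> \<open>If the second pair reached \<mu>, then (j2, \<mu>) would be an admissible pair
    with a value strictly below the minimum.\<close>
  have ls: "k2 + d < \<mu>"
  proof (rule ccontr)
    assume "\<not> k2 + d < \<mu>"
    then have "j2 + \<mu> \<le> l" using sum l0 by (simp add: d_def)
    then have "lam l 0 \<le> real_of_int (val j2 \<mu>)" using 2 by (intro low) auto
    then show False using strict v2 by linarith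
  qed
  have "val j2 (k2 + d) \<le> val j2 k2" using ls by (intro valJ) auto
  moreover have "lam l 0 \<le> real_of_int (val j2 (k2 + d))" using 2 ls sum l0 by (intro low) (auto simp: d_def)
  ultimately have S2: "term_at j2 (k2 + d) 0 = lam l 0" using v2 unfolding t by linarith
  have sum2: "j2 + (k2 + d) = l0" using sum by (simp add: d_def)
  show False
  proof (cases "k1 + d \<le> \<mu>")
    case True
    have "val j1 (k1 + d) \<le> val j1 k1" using True by (intro valJ) auto
    moreover have "lam l 0 \<le> real_of_int (val j1 (k1 + d))" using 1 True sum l0 by (intro low) (auto simp: d_def)
    ultimately have "term_at j1 (k1 + d) 0 = lam l 0" using v1 unfolding t by linarith
    moreover have "j1 + (k1 + d) = l0" using sum by (simp add: d_def)
    ultimately have "j1 = j2" using uniq[OF 1(1) True 2(1) _ _ sum2 _ S2] ls by simp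
    then show False using lt by simp
  next
    case False
    \<comment> \<open>The first pair may overrun \<mu>; then the first coordinate is raised as well.
      Uniqueness would give j3 = j2 and put the second pair at \<mu>, against
      \<open>ls\<close>.\<close>
    define j3 where "j3 = l0 - \<mu>"
    have j3: "j1 \<le> j3" "j3 \<le> \<nu>" "j3 + \<mu> = l0" using False sum l l0 by (auto simp: d_def j3_def)
    have "I j3 \<le> I j1" using KL.E.profile_antimono[OF profI j3(1,2)] by simp
    then have "int m * int (I j3) \<le> int m * int (I j1)" by (intro mult_left_mono) auto
    then have "val j3 \<mu> \<le> val j1 \<mu>" by (simp add: val_def J_top)
    also have "\<dots> \<le> val j1 k1" using 1 by (intro valJ) auto
    finally have "val j3 \<mu> \<le> val j1 k1" .
    moreover have "lam l 0 \<le> real_of_int (val j3 \<mu>)" using j3 l0 by (intro low) auto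
    ultimately have "term_at j3 \<mu> 0 = lam l 0" using v1 unfolding t by linarith
    then have "j3 = j2" using uniq[OF j3(2) order_refl 2(1) _ j3(3) sum2 _ S2] ls by simp
    then show False using j3(3) sum2 ls by simp
  qed
qed

text \<open>For x > 0 the pair in the singleton is a strict minimum. At x = 0 slopes do not count,
  so a minimal pair of least sum is taken instead.\<close>

lemma phi_eq_lam:
  assumes l: "l \<le> \<nu> + \<mu>" and x: "0 \<le> x" and l0: "l0 \<le> l" and card: "card (S_set p I J m \<nu> \<mu> l l0 x) = 1"
  shows "phi p H l x \<le> lam l x"
proof -
  obtain j k where S: "S_set p I J m \<nu> \<mu> l l0 x = {(j, k)}"
    using card by (auto simp: card_1_singleton_iff)
  have S_iff: "(j', k') \<in> S_set p I J m \<nu> \<mu> l l0 x \<longleftrightarrow> j' \<le> \<nu> \<and> k' \<le> \<mu> \<and> j' + k' = l0 \<and> term_at j' k' x = lam l x" for j' k'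
    by (auto simp: S_set_def Omega_def phitm_phit)
  have jk: "j \<le> \<nu>" "k \<le> \<mu>" "j + k = l0" "term_at j k x = lam l x" using S_iff[of j k] S by auto
  have uniq: "j' = j \<and> k' = k" if "j' \<le> \<nu>" "k' \<le> \<mu>" "j' + k' = l0" "term_at j' k' x = lam l x" for j' k'
    using S_iff[of j' k'] S that by auto
  show ?thesis
  proof (cases "x = 0")
    case False
    have "strict_min j k"
      unfolding strict_min_def
    proof (intro conjI allI impI)
      fix j' k' assume *: "j' \<le> \<nu>" "k' \<le> \<mu>" "j' + k' \<le> j + k" "(j', k') \<noteq> (j, k)"
      have le: "term_at j k x \<le> term_at j' k' x" using lam_le[OF *(1,2) _ l, of x] *(3) jk l0 by simp
      show "val j k < val j' k'"
      proof (cases "j' + k' = j + k")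
        case True
        then have "term_at j' k' x \<noteq> lam l x" using uniq[of j' k'] * jk by auto
        then have "term_at j k x < term_at j' k' x" using le jk(4) by simp
        then show ?thesis using True by (simp add: term_at_def)
      next
        case ne: False
        have "real p ^ (j' + k') < real p ^ (j + k)"
          using ne *(3) prime_gt_1_nat[OF LM.E.prime_p] by (intro power_strict_increasing) auto
        then have "real p ^ (j' + k') * x < real p ^ (j + k) * x" using x False by (intro mult_strict_right_mono) auto
        then show ?thesis using le by (simp add: term_at_def)
      qed
    qed (use jk in auto)
    then show ?thesis using jk l0 by (intro phi_le_lam) auto
  next
    case True
    define R where "R s \<longleftrightarrow> (\<exists>j k. j \<le> \<nu> \<and> k \<le> \<mu> \<and> j + k = s \<and> term_at j k 0 = lam l 0)" for s
    define s where "s = (LEAST s. R s)"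
    have Rl0: "R l0" unfolding R_def using jk True by blast
    have Rs: "R s" unfolding s_def using Rl0 by (rule LeastI)
    have sl0: "s \<le> l0" unfolding s_def using Rl0 by (rule Least_le)
    have least: "\<not> R s'" if "s' < s" for s' using that unfolding s_def by (rule not_less_Least)
    obtain j' k' where jk': "j' \<le> \<nu>" "k' \<le> \<mu>" "j' + k' = s" "term_at j' k' 0 = lam l 0"
      using Rs unfolding R_def by blast
    have u0: "j = j'" if "j \<le> \<nu>" "k \<le> \<mu>" "j' \<le> \<nu>" "k' \<le> \<mu>" "j + k = l0" "j' + k' = l0"
       "term_at j k 0 = lam l 0" "term_at j' k' 0 = lam l 0" for j k j' k'
      using uniq[of j k] uniq[of j' k'] that True by auto
    have "strict_min j' k'"
      unfolding strict_min_def
    proof (intro conjI allI impI)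
      fix x y assume *: "x \<le> \<nu>" "y \<le> \<mu>" "x + y \<le> j' + k'" "(x, y) \<noteq> (j', k')"
      have le: "lam l 0 \<le> term_at x y 0" using lam_le[OF *(1,2) _ l, of 0] *(3) jk' sl0 l0 by simp
      have "term_at x y 0 \<noteq> lam l 0"
      proof
        assume t: "term_at x y 0 = lam l 0"
        then have "R (x + y)" unfolding R_def using * by blast
        then have eq: "x + y = j' + k'" using least[of "x + y"] *(3) jk'(3) by linarith
        have "\<not> x < j'" using unique_least_zero[OF l l0 u0 *(1,2) t jk'(1,2,4)] eq jk'(3) sl0 by simp
        moreover have "\<not> j' < x" using unique_least_zero[OF l l0 u0 jk'(1,2,4) *(1,2) t] eq jk'(3) sl0 by simp
        ultimately show False using eq *(4) by simp
      qed
      then have "term_at j' k' 0 < term_at x y 0" using le jk'(4) by simp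
      then show "val j' k' < val x y" by (simp add: term_at_def)
    qed (use jk' in auto)
    then show ?thesis using jk' sl0 l0 True by (intro phi_le_lam) auto
  qed
qed

end

theorem theorem3p3:
  fixes K L M :: "'a::field set" and vK vL vM :: "'a \<Rightarrow> int"
    and p n m l :: nat and x :: real and iLK iML iMK :: "nat \<Rightarrow> nat"
  assumes fields: "subfield K" "subfield L" "subfield M" "K \<subseteq> L" "L \<subseteq> M"
    and valK: "discrete_valuation K vK" "val_complete K vK"
    and resK: "residue_char K vK p" "residue_perfect K vK p"
    and sep: "separable_ext K M"
    and degL: "has_degree K L n" "n > 1"
    and degM: "has_degree L M m" "m > 1"
    and valL: "discrete_valuation L vL" "\<forall>y\<in>K. y \<noteq> 0 \<longrightarrow> vL y = int n * vK y"
    and valM: "discrete_valuation M vM" "\<forall>y\<in>L. y \<noteq> 0 \<longrightarrow> vM y = int m * vL y"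
    and indLK: "is_indices p K L vK vL n iLK"
    and indML: "is_indices p L M vL vM m iML"
    and indMK: "is_indices p K M vK vM (n * m) iMK"
    and l: "l \<le> multiplicity p n + multiplicity p m"
    and x: "x \<ge> 0"
  shows "phi p iMK l x \<ge> lambdaMK p iLK iML m (multiplicity p n) (multiplicity p m) l x
       \<and> ((\<exists>l0\<le>l. card (S_set p iLK iML m (multiplicity p n) (multiplicity p m) l l0 x) = 1)
           \<longrightarrow> phi p iMK l x = lambdaMK p iLK iML m (multiplicity p n) (multiplicity p m) l x)"
proof -
  have p: "prime p" using resK(1) by (simp add: residue_char_def)
  \<comment> \<open>In characteristic p the infinite v(p) is replaced by a number above all three
    initial indices; multiplied by the degrees, it stays above them in L and M.\<close>
  define eK where "eK = (if of_nat p = (0::'a) then Suc (iLK 0 + iML 0 + iMK 0) else nat (vK (of_nat p)))"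
  have eK: "0 < eK" "of_nat p = (0::'a) \<or> vK (of_nat p :: 'a) = int eK"
    using resK(1) by (auto simp: eK_def residue_char_def)
  have eK': "of_nat p = (0::'a) \<Longrightarrow> iLK 0 < eK \<and> iML 0 < eK \<and> iMK 0 < eK" by (simp add: eK_def)
  have vfK: "valued_field K vK" and vfL: "valued_field L vL" and vfM: "valued_field M vM"
    using fields valK valL valM by (auto simp: valued_field_def)
  have extL: "vL y = int n * vK y" if "y \<in> K" "y \<noteq> 0" for y using valL(2) that by blast
  have extM: "vM y = int m * vL y" if "y \<in> L" "y \<noteq> 0" for y using valM(2) that by blast
  have extMK: "vM y = int (n * m) * vK y" if "y \<in> K" "y \<noteq> 0" for y
    using extL[OF that] extM[of y] that fields(4) by (auto simp: mult_ac)
  interpret KL: p_valued_ext K L vK vL p eK "n * eK" n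
    using p_valued_ext_total[OF p_valued_field_base[OF fields(1) valK(1) resK eK] vfL fields(4) degL(1) _ extL] degL(2)
    by simp
  interpret LM: p_valued_ext L M vL vM p "n * eK" "m * (n * eK)" m
    using p_valued_ext_total[OF KL.E.p_valued_field_axioms vfM fields(5) degM(1) _ extM] degM(2) by simp
  have "1 * eK \<le> n * eK" "1 * (1 * eK) \<le> m * (n * eK)" using degL(2) degM(2) by (intro mult_le_mono; simp)+
  then have le: "eK \<le> n * eK" "eK \<le> m * (n * eK)" by (simp_all only: mult_1)
  have lt: "iLK 0 < n * eK" "iML 0 < m * (n * eK)" "iMK 0 < m * (n * eK)" if "of_nat p = (0::'a)"
    using eK'[OF that] le by linarith+
  have cond: "of_nat p = (0::'a) \<and> iLK 0 < n * eK \<or> of_nat p \<noteq> (0::'a) \<and> vL (of_nat p :: 'a) = int (n * eK)"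
    "of_nat p = (0::'a) \<and> iML 0 < m * (n * eK) \<or> of_nat p \<noteq> (0::'a) \<and> vM (of_nat p :: 'a) = int (m * (n * eK))"
    "of_nat p = (0::'a) \<and> iMK 0 < m * (n * eK) \<or> of_nat p \<noteq> (0::'a) \<and> vM (of_nat p :: 'a) = int (m * (n * eK))"
    using lt KL.E.val_p LM.E.val_p by blast+
  have pos: "0 < n" "0 < m" "0 < n * m" "0 < n * eK" "0 < m * (n * eK)" using degL(2) degM(2) eK(1) by auto
  obtain \<pi>K \<pi>L a where A: "\<pi>K \<in> K" "\<pi>K \<noteq> 0" "vK \<pi>K = 1" "\<pi>L \<in> L" "\<pi>L \<noteq> 0" "vL \<pi>L = 1"
    "\<forall>h k. \<exists>s\<in>K. a h = s ^ (p ^ k) \<and> (s = 0 \<or> vL s = 0)"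
    "\<forall>k. val_ge vL (int n + int k) (\<pi>K - (\<Sum>h<k. a h * \<pi>L ^ (h + n)))"
    "index_facts p (multiplicity p n) n (n * eK) a iLK"
    by (rule is_indices_facts[OF indLK vfK vfL fields(4) p pos(1) extL pos(4) cond(1)])
  obtain \<pi>L' \<pi>M b where B: "\<pi>L' \<in> L" "\<pi>L' \<noteq> 0" "vL \<pi>L' = 1" "\<pi>M \<in> M" "\<pi>M \<noteq> 0" "vM \<pi>M = 1"
    "\<forall>h k. \<exists>s\<in>L. b h = s ^ (p ^ k) \<and> (s = 0 \<or> vM s = 0)"
    "\<forall>k. val_ge vM (int m + int k) (\<pi>L' - (\<Sum>h<k. b h * \<pi>M ^ (h + m)))"
    "index_facts p (multiplicity p m) m (m * (n * eK)) b iML"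
    by (rule is_indices_facts[OF indML vfL vfM fields(5) p pos(2) extM pos(5) cond(2)])
  have KM: "K \<subseteq> M" using fields by blast
  obtain \<pi>K' \<pi>M' g where C: "\<pi>K' \<in> K" "\<pi>K' \<noteq> 0" "vK \<pi>K' = 1" "\<pi>M' \<in> M" "\<pi>M' \<noteq> 0" "vM \<pi>M' = 1"
    "\<forall>h k. \<exists>s\<in>K. g h = s ^ (p ^ k) \<and> (s = 0 \<or> vM s = 0)"
    "\<forall>k. val_ge vM (int (n * m) + int k) (\<pi>K' - (\<Sum>h<k. g h * \<pi>M' ^ (h + n * m)))"
    "index_facts p (multiplicity p (n * m)) (n * m) (m * (n * eK)) g iMK"
    by (rule is_indices_facts[OF indMK vfK vfM KM p pos(3) extMK pos(5) cond(3)])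
  have mult: "multiplicity p (n * m) = multiplicity p n + multiplicity p m"
    using pos p by (simp add: prime_elem_multiplicity_mult_distrib)
  interpret ramified_tower K L M vK vL vM p eK "n * eK" "m * (n * eK)" n m "multiplicity p n" "multiplicity p m"
    iLK iML iMK a b g \<pi>K \<pi>L \<pi>L' \<pi>M \<pi>K' \<pi>M'
    by standard (use A B C lt(1) in \<open>simp_all add: mult\<close>)
  show ?thesis using lam_le_phi[OF l x] phi_eq_lam[OF l x] by (auto intro: antisym)
qed

end
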